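(* Let $X$ be a Banach lattice such that every principal band in $X$ admits a strictly positive order continuous functional. Then $X$ has the pre-Komlós property. Moreover, $X$ has the Komlós property if and only if $X$ is sequentially boundedly uo-complete.
   Context: The Cesàro means of a sequence $(x_n)$ are $a_n=\frac1n\sum_{k=1}^n x_k$. A net (in particular, a sequence) $(x_\alpha)_{\alpha\in\Gamma}$ in a vector lattice $X$ converges in order to $x\in X$ ($x_\alpha\xrightarrow{\rm o}x$) if there is a net $(a_\gamma)_{\gamma\in\Lambda}$ in $X$ (possibly over a different index set) with $a_\gamma\downarrow 0$ such that for every $\gamma\in\Lambda$ there is $\alpha_0\in\Gamma$ with $|x_\alpha-x|\le a_\gamma$ for all $\alpha\ge\alpha_0$. It uo-converges to $x$ if $|x_\alpha-x|\wedge y\xrightarrow{\rm o}0$ for every $y\in X_+$. A sequence $(x_n)$ is uo-Cauchy if the double net $(x_n-x_m)_{(n,m)}$, indexed by $\mathbb N\times\mathbb N$ with the product order, uo-converges to $0$. A principal band is the band $B_x$ generated by a single vector $x\in X_+$. A linear functional $f$ on a vector lattice $B$ is strictly positive if $f(b)>0$ for every $b>0$ in $B$, and order continuous if $b_\alpha\xrightarrow{\rm o}0$ in $B$ implies $f(b_\alpha)\to 0$. $X$ has the Komlós property if for every norm bounded sequence $(x_n)$ in $X$ there exist a subsequence $(y_n)$ and a vector $y\in X$ such that the Cesàro means of every subsequence of $(y_n)$ uo-converge to $y$. $X$ has the pre-Komlós property if every norm bounded sequence in $X$ has a subsequence $(y_n)$ such that the Cesàro means of any subsequence of $(y_n)$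 are uo-Cauchy in $X$. $X$ is sequentially boundedly uo-complete if every norm bounded uo-Cauchy sequence in $X$ is uo-convergent in $X$. *)

theory Defs
  imports "HOL-Analysis.Analysis" "HOL-Library.Lattice_Algebras"
begin

class vector_lattice = ordered_real_vector + lattice_ab_group_add_abs

class banach_lattice = vector_lattice + banach +
  assumes lattice_norm: "\<bar>x\<bar> \<le> \<bar>y\<bar> \<Longrightarrow> norm x \<le> norm y"

instance real :: vector_lattice ..

instance real :: banach_lattice
  by standard simp


section \<open>Nets and order convergence\<close>

text \<open>A net is given by an index set, a directed preorder on it, and a family. Only the values
  of the relation and of the family on the index set matter.\<close>

definition directed_index :: "'i set \<Rightarrow> ('i \<Rightarrow> 'i \<Rightarrow> bool) \<Rightarrow> bool" where
  "directed_index I le \<longleftrightarrow>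
     I \<noteq> {} \<and> reflp_on I le \<and> transp_on I le \<and>
     (\<forall>i\<in>I. \<forall>j\<in>I. \<exists>k\<in>I. le i k \<and> le j k)"

text \<open>Below, \<open>S\<close> is the carrier of a vector sublattice, viewed as a vector lattice in its own
  right: the dominating net lies in \<open>S\<close>, and its infimum is taken in \<open>S\<close>.
  The whole space is \<open>S = UNIV\<close>.\<close>

definition decreases_to_0_in ::
    "'a::vector_lattice set \<Rightarrow> 'k set \<Rightarrow> ('k \<Rightarrow> 'k \<Rightarrow> bool) \<Rightarrow> ('k \<Rightarrow> 'a) \<Rightarrow> bool" where
  "decreases_to_0_in S K le a \<longleftrightarrow>
     directed_index K le \<and>
     (\<forall>k\<in>K. a k \<in> S) \<and>
     (\<forall>j\<in>K. \<forall>k\<in>K. le j k \<longrightarrow> a k \<le> a j) \<and>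
     (\<forall>k\<in>K. 0 \<le> a k) \<and>
     (\<forall>l\<in>S. (\<forall>k\<in>K. l \<le> a k) \<longrightarrow> l \<le> 0)"

text \<open>HOL cannot quantify over the type of the index set of the dominating net. Taking its index
  set inside the space itself loses no generality: see \<open>order_converges_inI\<close>.\<close>

definition order_converges_in ::
    "'a::vector_lattice set \<Rightarrow> 'i set \<Rightarrow> ('i \<Rightarrow> 'i \<Rightarrow> bool) \<Rightarrow> ('i \<Rightarrow> 'a) \<Rightarrow> 'a \<Rightarrow> bool" where
  "order_converges_in S I le x l \<longleftrightarrow>
     (\<exists>(K::'a set) leK a. decreases_to_0_in S K leK a \<and>
        (\<forall>k\<in>K. \<exists>i0\<in>I. \<forall>i\<in>I. le i0 i \<longrightarrow> \<bar>x i - l\<bar> \<le> a k))"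

lemma order_converges_inI:
  fixes a :: "'k \<Rightarrow> 'a::vector_lattice"
  assumes a: "decreases_to_0_in S K leK a"
    and dom: "\<forall>k\<in>K. \<exists>i0\<in>I. \<forall>i\<in>I. le i0 i \<longrightarrow> \<bar>x i - l\<bar> \<le> a k"
  shows "order_converges_in S I le x l"
proof -
  have "\<exists>w\<in>a ` K. w \<le> u \<and> w \<le> v" if uv: "u \<in> a ` K" "v \<in> a ` K" for u v
  proof -
    obtain i j where ij: "i \<in> K" "u = a i" "j \<in> K" "v = a j" using uv by blast
    then obtain k where k: "k \<in> K" "leK i k" "leK j k"
      using a unfolding decreases_to_0_in_def directed_index_def by meson
    then have "a k \<le> a i" "a k \<le> a j"
      using a ij unfolding decreases_to_0_in_def by simp_all
    then show ?thesis using ij k by blast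
  qed
  moreover have "a ` K \<noteq> {}"
    using a unfolding decreases_to_0_in_def directed_index_def by simp
  ultimately have "directed_index (a ` K) (\<lambda>u v. v \<le> u)"
    unfolding directed_index_def reflp_on_def transp_on_def
    by (intro conjI ballI impI) (assumption | rule order_refl | erule order_trans | blast)+
  then have "decreases_to_0_in S (a ` K) (\<lambda>u v. v \<le> u) (\<lambda>u. u)"
    using a unfolding decreases_to_0_in_def by auto
  then show ?thesis
    using dom unfolding order_converges_in_def
    by (intro exI[of _ "a ` K"] exI[of _ "\<lambda>u v. v \<le> u"] exI[of _ "\<lambda>u. u"]) auto
qed

definition uo_converges ::
    "'i set \<Rightarrow> ('i \<Rightarrow> 'i \<Rightarrow> bool) \<Rightarrow> ('i \<Rightarrow> 'a::vector_lattice) \<Rightarrow> 'a \<Rightarrow> bool" where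
  "uo_converges I le x l \<longleftrightarrow>
     (\<forall>y\<ge>0. order_converges_in UNIV I le (\<lambda>i. inf \<bar>x i - l\<bar> y) 0)"

definition uo_converges_seq :: "(nat \<Rightarrow> 'a::vector_lattice) \<Rightarrow> 'a \<Rightarrow> bool" where
  "uo_converges_seq x l \<longleftrightarrow> uo_converges UNIV (\<le>) x l"

definition uo_Cauchy :: "(nat \<Rightarrow> 'a::vector_lattice) \<Rightarrow> bool" where
  "uo_Cauchy x \<longleftrightarrow>
     uo_converges UNIV (\<lambda>(n, m) (n', m'). n \<le> n' \<and> m \<le> m') (\<lambda>(n, m). x n - x m) 0"


section \<open>Bands and functionals on them\<close>

definition order_ideal :: "'a::vector_lattice set \<Rightarrow> bool" where
  "order_ideal J \<longleftrightarrow> subspace J \<and> (\<forall>x y. y \<in> J \<and> \<bar>x\<bar> \<le> \<bar>y\<bar> \<longrightarrow> x \<in> J)"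

definition band :: "'a::vector_lattice set \<Rightarrow> bool" where
  "band B \<longleftrightarrow> order_ideal B \<and>
     (\<forall>A s. A \<subseteq> B \<and> (\<forall>a\<in>A. a \<le> s) \<and> (\<forall>u. (\<forall>a\<in>A. a \<le> u) \<longrightarrow> s \<le> u) \<longrightarrow> s \<in> B)"

definition principal_band :: "'a::vector_lattice \<Rightarrow> 'a set" where
  "principal_band x = band hull {x}"

text \<open>A functional on \<open>B\<close> is a total function of which only the values on \<open>B\<close> matter.\<close>

definition linear_functional_on :: "'a::vector_lattice set \<Rightarrow> ('a \<Rightarrow> real) \<Rightarrow> bool" where
  "linear_functional_on B f \<longleftrightarrow>
     (\<forall>x\<in>B. \<forall>y\<in>B. f (x + y) = f x + f y) \<and> (\<forall>c. \<forall>x\<in>B. f (c *\<^sub>R x) = c * f x)"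

definition strictly_positive_on :: "'a::vector_lattice set \<Rightarrow> ('a \<Rightarrow> real) \<Rightarrow> bool" where
  "strictly_positive_on B f \<longleftrightarrow> (\<forall>b\<in>B. 0 < b \<longrightarrow> 0 < f b)"

text \<open>The index type is fixed to \<open>'a \<times> 'a set\<close>, large enough that order continuity follows
  for nets over arbitrary index types: see \<open>order_continuous_onD\<close>.\<close>

definition order_continuous_on :: "'a::vector_lattice set \<Rightarrow> ('a \<Rightarrow> real) \<Rightarrow> bool" where
  "order_continuous_on B f \<longleftrightarrow>
     (\<forall>(I::('a \<times> 'a set) set) le b.
        directed_index I le \<and> (\<forall>i\<in>I. b i \<in> B) \<and> order_converges_in B I le b 0 \<longrightarrow>
        (\<forall>e>0. \<exists>i0\<in>I. \<forall>i\<in>I. le i0 i \<longrightarrow> \<bar>f (b i)\<bar> < e))"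

lemma order_continuous_onD:
  fixes b :: "'i \<Rightarrow> 'a::vector_lattice"
  assumes f: "order_continuous_on B f"
    and I: "directed_index I le"
    and b: "\<forall>i\<in>I. b i \<in> B"
    and conv: "order_converges_in B I le b 0"
    and e: "e > 0"
  shows "\<exists>i0\<in>I. \<forall>i\<in>I. le i0 i \<longrightarrow> \<bar>f (b i)\<bar> < e"
proof -
  define T where "T i = b ` {j \<in> I. le i j}" for i
  define J where "J = {(z, U). \<exists>i\<in>I. U = T i \<and> z \<in> U}"
  define leJ :: "'a \<times> 'a set \<Rightarrow> 'a \<times> 'a set \<Rightarrow> bool" where "leJ p q \<longleftrightarrow> snd q \<subseteq> snd p" for p q
  have inJ: "(b i, T i) \<in> J" if "i \<in> I" for i
    using that I unfolding J_def T_def directed_index_def by (auto dest: reflp_onD)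
  have mono: "T j \<subseteq> T i" if "i \<in> I" "j \<in> I" "le i j" for i j
    using that I unfolding T_def directed_index_def by (auto dest: transp_onD)
  have dirJ: "directed_index J leJ"
    unfolding directed_index_def
  proof (intro conjI ballI)
    show "J \<noteq> {}" using inJ I unfolding directed_index_def by blast
    show "reflp_on J leJ" by (auto simp: leJ_def reflp_on_def)
    show "transp_on J leJ" by (auto simp: leJ_def transp_on_def)
    fix p q assume "p \<in> J" "q \<in> J"
    then obtain i j where ij: "i \<in> I" "j \<in> I" "snd p = T i" "snd q = T j"
      unfolding J_def by auto
    then obtain k where k: "k \<in> I" "le i k" "le j k"
      using I unfolding directed_index_def by blast
    show "\<exists>r\<in>J. leJ p r \<and> leJ q r"
      using inJ[OF k(1)] mono ij k by (intro bexI[of _ "(b k, T k)"]) (auto simp: leJ_def)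
  qed
  have transfer: "(\<exists>p0\<in>J. \<forall>p\<in>J. leJ p0 p \<longrightarrow> P (fst p)) \<longleftrightarrow>
      (\<exists>i0\<in>I. \<forall>i\<in>I. le i0 i \<longrightarrow> P (b i))" for P
  proof
    assume "\<exists>p0\<in>J. \<forall>p\<in>J. leJ p0 p \<longrightarrow> P (fst p)"
    then obtain p0 where p0: "p0 \<in> J" "\<forall>p\<in>J. leJ p0 p \<longrightarrow> P (fst p)" by blast
    then obtain i0 where i0: "i0 \<in> I" "snd p0 = T i0" unfolding J_def by auto
    have "P (b i)" if "i \<in> I" "le i0 i" for i
      using bspec[OF p0(2) inJ[OF that(1)]] mono[OF i0(1) that] i0(2) by (simp add: leJ_def)
    then show "\<exists>i0\<in>I. \<forall>i\<in>I. le i0 i \<longrightarrow> P (b i)" using i0(1) by blast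
  next
    assume "\<exists>i0\<in>I. \<forall>i\<in>I. le i0 i \<longrightarrow> P (b i)"
    then obtain i0 where i0: "i0 \<in> I" "\<forall>i\<in>I. le i0 i \<longrightarrow> P (b i)" by blast
    have "P (fst p)" if "p \<in> J" "leJ (b i0, T i0) p" for p
    proof -
      have "fst p \<in> T i0" using that unfolding J_def leJ_def by auto
      then show ?thesis using i0(2) unfolding T_def by auto
    qed
    then show "\<exists>p0\<in>J. \<forall>p\<in>J. leJ p0 p \<longrightarrow> P (fst p)" using inJ[OF i0(1)] by blast
  qed
  have "\<forall>p\<in>J. fst p \<in> B" using b unfolding J_def T_def by auto
  moreover have "order_converges_in B J leJ fst 0"
    using conv unfolding order_converges_in_def transfer[of "\<lambda>z. \<bar>z - 0\<bar> \<le> _"] .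
  ultimately have "\<exists>p0\<in>J. \<forall>p\<in>J. leJ p0 p \<longrightarrow> \<bar>f (fst p)\<bar> < e"
    using f dirJ e unfolding order_continuous_on_def by blast
  then show ?thesis unfolding transfer[of "\<lambda>z. \<bar>f z\<bar> < e"] .
qed


section \<open>The Komlos properties\<close>

text \<open>Sequences are indexed from 0, so the mean with index \<open>n\<close> is that of the first
  \<open>n + 1\<close> terms.\<close>

definition cesaro :: "(nat \<Rightarrow> 'a::real_vector) \<Rightarrow> nat \<Rightarrow> 'a" where
  "cesaro x n = (1 / real (Suc n)) *\<^sub>R (\<Sum>k\<le>n. x k)"

definition komlos_property :: "'a::banach_lattice itself \<Rightarrow> bool" where
  "komlos_property _ \<longleftrightarrow>
     (\<forall>x::nat \<Rightarrow> 'a. bounded (range x) \<longrightarrow>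
        (\<exists>(r::nat \<Rightarrow> nat) y. strict_mono r \<and>
           (\<forall>s::nat \<Rightarrow> nat. strict_mono s \<longrightarrow> uo_converges_seq (cesaro (x \<circ> r \<circ> s)) y)))"

definition pre_komlos_property :: "'a::banach_lattice itself \<Rightarrow> bool" where
  "pre_komlos_property _ \<longleftrightarrow>
     (\<forall>x::nat \<Rightarrow> 'a. bounded (range x) \<longrightarrow>
        (\<exists>r::nat \<Rightarrow> nat. strict_mono r \<and>
           (\<forall>s::nat \<Rightarrow> nat. strict_mono s \<longrightarrow> uo_Cauchy (cesaro (x \<circ> r \<circ> s)))))"

definition seq_boundedly_uo_complete :: "'a::banach_lattice itself \<Rightarrow> bool" where
  "seq_boundedly_uo_complete _ \<longleftrightarrow>
     (\<forall>x::nat \<Rightarrow> 'a. bounded (range x) \<and> uo_Cauchy x \<longrightarrow> (\<exists>l. uo_converges_seq x l))"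

end

theory Submission
  imports Defs "HOL-Library.Diagonal_Subsequence" "HOL-Library.Function_Algebras"
begin

text \<open>For a norm bounded sequence \<open>x\<close>, all \<open>x n\<close> lie in the ideal generated by
  \<open>e = (\<Sum>n. (1/2)^n \<bar>x n\<bar>)\<close>. By Zorn's lemma this ideal is separated by its real-valued lattice
  homomorphisms, and a strictly positive order continuous functional \<open>f\<close> on the band of \<open>e\<close> becomes, by the
  Hahn--Banach theorem, a finitely additive expectation on the bounded functions of these homomorphisms.
  Komlos' theorem needs no countable additivity if almost everywhere convergence is replaced by bounds
  on the expectation of finite maxima: after reduction to nonnegative sequences, one truncates the
  \<open>i\<close>-th term at height \<open>i\<close>, subtracts approximate weak limits, chooses the subsequence so that the
  differences are nearly uncorrelated, and concludes with Etemadi's monotonicity argument.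

  To return to the lattice, let \<open>l\<close> be a positive lower bound of all dominators of a double net that is small
  in this sense. Then \<open>l\<close> is the supremum of its meets with finite suprema of tails of the net, and order
  continuity of \<open>f\<close> gives \<open>f l = 0\<close>, hence \<open>l = 0\<close>. The Cesaro means of any two
  subsequences are compared in this way, which makes the limit independent of the subsequence; the
  same comparison of a uo-Cauchy sequence with its Cesaro means yields completeness.\<close>

section \<open>Finitely additive expectations\<close>

text \<open>The lattice need not contain limits or countable suprema, and weak limits of truncations
  need not be functions on which \<open>E\<close> acts. So no limit is ever formed: a sequence is
  compared with genuine bounded functions \<open>b p\<close>, and a maximal function is replaced by
  arbitrary bounded test functions below a finite maximum, with estimates uniform in the length of
  the range. Quantities known only through their expectation have to enter pointwise estimates
  linearly, which explains the affine shape of several bounds. A second obstacle is the gap between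
  ideal and band: \<open>E\<close> represents \<open>f\<close> only on the ideal of
  \<open>e\<close>, while the lower bound \<open>l\<close> is merely found to lie in the band, and
  the vector \<open>y\<close> in the definition of uo-convergence is arbitrary. Before
  \<open>E\<close> can be used, \<open>l\<close> must be cut down to a vector below a multiple of
  \<open>e\<close>, at a cost that order continuity on the band makes small. Positivity in its
  strict form enters only at the end, where \<open>f l = 0\<close> has to give
  \<open>l = 0\<close>.\<close>

definition bdd_fun :: "('w \<Rightarrow> real) \<Rightarrow> bool" where
  "bdd_fun g \<longleftrightarrow> (\<exists>c. \<forall>\<xi>. \<bar>g \<xi>\<bar> \<le> c)"

lemma bdd_funI: "(\<And>\<xi>. \<bar>g \<xi>\<bar> \<le> c) \<Longrightarrow> bdd_fun g"
  unfolding bdd_fun_def by blast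

lemma bdd_funE:
  assumes "bdd_fun g"
  obtains c where "0 \<le> c" "\<And>\<xi>. \<bar>g \<xi>\<bar> \<le> c"
  using assms unfolding bdd_fun_def by (metis abs_ge_zero order_trans)

lemma bdd_fun_const [simp, intro]: "bdd_fun (\<lambda>\<xi>. c)"
  by (rule bdd_funI[of _ "\<bar>c\<bar>"]) simp

lemma bdd_fun_add [simp, intro]:
  assumes "bdd_fun g" "bdd_fun h"
  shows "bdd_fun (\<lambda>\<xi>. g \<xi> + h \<xi>)"
proof -
  obtain c d where "\<And>\<xi>. \<bar>g \<xi>\<bar> \<le> c" "\<And>\<xi>. \<bar>h \<xi>\<bar> \<le> d" using assms by (meson bdd_funE)
  then show ?thesis by (intro bdd_funI[of _ "c + d"]) (meson abs_triangle_ineq add_mono order_trans)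
qed

lemma bdd_fun_mult [simp, intro]:
  assumes "bdd_fun g" "bdd_fun h"
  shows "bdd_fun (\<lambda>\<xi>. g \<xi> * h \<xi>)"
proof -
  obtain c d where "0 \<le> c" "\<And>\<xi>. \<bar>g \<xi>\<bar> \<le> c" "\<And>\<xi>. \<bar>h \<xi>\<bar> \<le> d" using assms by (meson bdd_funE)
  then show ?thesis by (intro bdd_funI[of _ "c * d"]) (auto simp: abs_mult intro: mult_mono)
qed

lemma bdd_fun_minus [simp, intro]: "bdd_fun g \<Longrightarrow> bdd_fun (\<lambda>\<xi>. - g \<xi>)"
  unfolding bdd_fun_def by simp

lemma bdd_fun_diff [simp, intro]: "bdd_fun g \<Longrightarrow> bdd_fun h \<Longrightarrow> bdd_fun (\<lambda>\<xi>. g \<xi> - h \<xi>)"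
  using bdd_fun_add[of g "\<lambda>\<xi>. - h \<xi>"] by simp

lemma bdd_fun_abs [simp, intro]: "bdd_fun g \<Longrightarrow> bdd_fun (\<lambda>\<xi>. \<bar>g \<xi>\<bar>)"
  unfolding bdd_fun_def by simp

lemma bdd_fun_divide [simp, intro]: "bdd_fun g \<Longrightarrow> bdd_fun (\<lambda>\<xi>. g \<xi> / c)"
  using bdd_fun_mult[of g "\<lambda>_. 1 / c"] by simp

lemma bdd_fun_power2 [simp, intro]: "bdd_fun g \<Longrightarrow> bdd_fun (\<lambda>\<xi>. (g \<xi>)\<^sup>2)"
  by (simp add: power2_eq_square)

lemma bdd_fun_min [simp, intro]:
  assumes "bdd_fun g" "bdd_fun h"
  shows "bdd_fun (\<lambda>\<xi>. min (g \<xi>) (h \<xi>))"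
proof -
  obtain c d where "\<And>\<xi>. \<bar>g \<xi>\<bar> \<le> c" "\<And>\<xi>. \<bar>h \<xi>\<bar> \<le> d" using assms by (meson bdd_funE)
  then show ?thesis
    by (intro bdd_funI[of _ "max c d"]) (metis max.coboundedI1 max.coboundedI2 min_def)
qed

lemma bdd_fun_of_bool [simp, intro]: "bdd_fun (\<lambda>\<xi>. of_bool (P \<xi>))"
  by (rule bdd_funI[of _ 1]) simp

lemma bdd_fun_sum [simp, intro]:
  "(\<And>i. i \<in> A \<Longrightarrow> bdd_fun (g i)) \<Longrightarrow> bdd_fun (\<lambda>\<xi>. \<Sum>i\<in>A. g i \<xi>)"
  by (induction A rule: infinite_finite_induct) auto

locale expectation =
  fixes E :: "('w \<Rightarrow> real) \<Rightarrow> real"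
  assumes E_add [simp]: "bdd_fun g \<Longrightarrow> bdd_fun h \<Longrightarrow> E (\<lambda>\<xi>. g \<xi> + h \<xi>) = E g + E h"
    and E_scale [simp]: "bdd_fun g \<Longrightarrow> E (\<lambda>\<xi>. c * g \<xi>) = c * E g"
    and E_nonneg: "bdd_fun g \<Longrightarrow> (\<And>\<xi>. 0 \<le> g \<xi>) \<Longrightarrow> 0 \<le> E g"
begin

definition mass :: real where "mass = E (\<lambda>_. 1)"

lemma E_const [simp]: "E (\<lambda>_. c) = c * mass"
  using E_scale[of "\<lambda>_. 1" c] unfolding mass_def by simp

lemma mass_nonneg: "0 \<le> mass"
  unfolding mass_def by (rule E_nonneg) auto

lemma E_minus [simp]: "bdd_fun g \<Longrightarrow> E (\<lambda>\<xi>. - g \<xi>) = - E g"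
  using E_scale[of g "- 1"] by simp

lemma E_diff [simp]: "bdd_fun g \<Longrightarrow> bdd_fun h \<Longrightarrow> E (\<lambda>\<xi>. g \<xi> - h \<xi>) = E g - E h"
  using E_add[of g "\<lambda>\<xi>. - h \<xi>"] by simp

lemma E_divide [simp]: "bdd_fun g \<Longrightarrow> E (\<lambda>\<xi>. g \<xi> / c) = E g / c"
  using E_scale[of g "1 / c"] by simp

lemma E_sum [simp]:
  "(\<And>i. i \<in> A \<Longrightarrow> bdd_fun (g i)) \<Longrightarrow> E (\<lambda>\<xi>. \<Sum>i\<in>A. g i \<xi>) = (\<Sum>i\<in>A. E (g i))"
  by (induction A rule: infinite_finite_induct) auto

lemma E_mono: "bdd_fun g \<Longrightarrow> bdd_fun h \<Longrightarrow> (\<And>\<xi>. g \<xi> \<le> h \<xi>) \<Longrightarrow> E g \<le> E h"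
  using E_nonneg[of "\<lambda>\<xi>. h \<xi> - g \<xi>"] by simp

abbreviation ip :: "('w \<Rightarrow> real) \<Rightarrow> ('w \<Rightarrow> real) \<Rightarrow> real" where
  "ip g h \<equiv> E (\<lambda>\<xi>. g \<xi> * h \<xi>)"

abbreviation E2 :: "('w \<Rightarrow> real) \<Rightarrow> real" where
  "E2 g \<equiv> E (\<lambda>\<xi>. (g \<xi>)\<^sup>2)"

lemma Cauchy_Schwarz_E:
  assumes g: "bdd_fun g" and h: "bdd_fun h"
  shows "\<bar>ip g h\<bar> \<le> sqrt (E2 g) * sqrt (E2 h)"
proof -
  define a b c where "a = E2 h" and "b = ip g h" and "c = E2 g"
  have quad: "0 \<le> c - 2 * t * b + t\<^sup>2 * a" for t
  proof -
    have "0 \<le> E (\<lambda>\<xi>. (g \<xi> - t * h \<xi>)\<^sup>2)" using g h by (intro E_nonneg) auto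
    also have "(\<lambda>\<xi>. (g \<xi> - t * h \<xi>)\<^sup>2) = (\<lambda>\<xi>. (g \<xi>)\<^sup>2 - (2 * t) * (g \<xi> * h \<xi>) + t\<^sup>2 * (h \<xi>)\<^sup>2)"
      by (auto simp: power2_eq_square algebra_simps)
    finally show ?thesis using g h by (simp add: a_def b_def c_def)
  qed
  have a: "0 \<le> a" and c: "0 \<le> c" unfolding a_def c_def using g h by (auto intro: E_nonneg)
  have "b\<^sup>2 \<le> c * a"
  proof (cases "a = 0")
    case True
    have "b = 0"
    proof (rule ccontr)
      assume "b \<noteq> 0"
      \<comment> \<open>With \<open>a = 0\<close> the quadratic is linear in \<open>t\<close>; at
        this \<open>t\<close> it equals -1.\<close>
      then show False using quad[of "(c + 1) / (2 * b)"] True by simp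
    qed
    then show ?thesis using True by simp
  next
    case False
    then show ?thesis using quad[of "b / a"] a by (simp add: power2_eq_square field_simps)
  qed
  then have "\<bar>b\<bar> \<le> sqrt (c * a)" by (rule real_le_rsqrt[of "\<bar>b\<bar>", simplified])
  then show ?thesis by (simp add: a_def b_def c_def real_sqrt_mult)
qed

lemma E_abs_le:
  assumes "bdd_fun g"
  shows "E (\<lambda>\<xi>. \<bar>g \<xi>\<bar>) \<le> sqrt (E2 g) * sqrt mass"
  using Cauchy_Schwarz_E[of "\<lambda>\<xi>. \<bar>g \<xi>\<bar>" "\<lambda>_. 1"] assms by simp

lemma second_moment_sum:
  fixes v :: "nat \<Rightarrow> 'w \<Rightarrow> real"
  assumes v: "\<And>i. bdd_fun (v i)"
  shows "E (\<lambda>\<xi>. (\<Sum>i<n. v i \<xi>)\<^sup>2) \<le>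
    (\<Sum>i<n. E2 (v i)) + 2 * (\<Sum>j<n. \<Sum>i<j. \<bar>ip (v i) (v j)\<bar>)"
proof (induction n)
  case 0
  then show ?case by simp
next
  case (Suc n)
  have "E (\<lambda>\<xi>. (\<Sum>i<Suc n. v i \<xi>)\<^sup>2)
      = E (\<lambda>\<xi>. (\<Sum>i<n. v i \<xi>)\<^sup>2 + (v n \<xi>)\<^sup>2 + 2 * (\<Sum>i<n. v i \<xi> * v n \<xi>))"
    by (rule arg_cong[of _ _ E]) (auto simp: power2_sum sum_distrib_left mult_ac add_ac)
  also have "\<dots> = E (\<lambda>\<xi>. (\<Sum>i<n. v i \<xi>)\<^sup>2) + E2 (v n) + 2 * (\<Sum>i<n. ip (v i) (v n))"
    using v by simp
  also have "(\<Sum>i<n. ip (v i) (v n)) \<le> (\<Sum>i<n. \<bar>ip (v i) (v n)\<bar>)"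
    by (intro sum_mono) auto
  finally show ?case using Suc by (simp add: algebra_simps)
qed

end

section \<open>Averages of nonnegative numbers\<close>

text \<open>If \<open>w\<close> were large on all of \<open>S\<close>, then at least
  \<open>\<eta> * real (Suc n)\<close> indices of weight at least
  \<open>1 / (2 * real (Suc n))\<close> would exceed the budget \<open>Q\<close>. The bound is
  affine in \<open>Q\<close> because \<open>Q\<close> will depend on the point and is controlled
  only in expectation.\<close>

lemma exists_small_in_block:
  fixes w :: "nat \<Rightarrow> real"
  assumes Q: "(\<Sum>m\<in>{N..<M}. (w m)\<^sup>2 / real (Suc m)) \<le> Q"
    and S: "S \<subseteq> {N..<M}" "\<And>m. m \<in> S \<Longrightarrow> real (Suc m) \<le> 2 * real (Suc n)"
    and card: "\<eta> * real (Suc n) \<le> real (card S)" and \<eta>: "0 < \<eta>"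
  shows "\<exists>m\<in>S. \<bar>w m\<bar> \<le> \<eta> + Q / (2 * \<eta>\<^sup>2)"
proof -
  have "\<exists>m\<in>S. (w m)\<^sup>2 \<le> 2 * Q / \<eta>"
  proof (rule ccontr)
    assume "\<not> ?thesis"
    then have big: "2 * Q / \<eta> < (w m)\<^sup>2" if "m \<in> S" for m using that by fastforce
    have fin: "finite S" using S(1) finite_subset by blast
    have "card S > 0" using card \<eta> by (metis gr0I less_le_not_le mult_pos_pos of_nat_0 of_nat_0_less_iff zero_less_Suc)
    then have ne: "S \<noteq> {}" by auto
    have "0 \<le> (\<Sum>m\<in>{N..<M}. (w m)\<^sup>2 / real (Suc m))" by (intro sum_nonneg) auto
    then have Q0: "0 \<le> Q" using Q by simp
    have "Q = \<eta> * real (Suc n) * ((2 * Q / \<eta>) / (2 * real (Suc n)))"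
      using \<eta> by (simp del: of_nat_Suc)
    also have "\<dots> \<le> real (card S) * ((2 * Q / \<eta>) / (2 * real (Suc n)))"
      using card Q0 \<eta> by (intro mult_right_mono) auto
    also have "\<dots> = (\<Sum>m\<in>S. (2 * Q / \<eta>) / (2 * real (Suc n)))" by simp
    also have "\<dots> < (\<Sum>m\<in>S. (w m)\<^sup>2 / real (Suc m))"
    proof (rule sum_strict_mono[OF fin ne])
      fix m assume m: "m \<in> S"
      have "(2 * Q / \<eta>) / (2 * real (Suc n)) \<le> (2 * Q / \<eta>) / real (Suc m)"
        using S(2)[OF m] Q0 \<eta> by (intro divide_left_mono) auto
      also have "\<dots> < (w m)\<^sup>2 / real (Suc m)" using big[OF m] by (intro divide_strict_right_mono) auto
      finally show "(2 * Q / \<eta>) / (2 * real (Suc n)) < (w m)\<^sup>2 / real (Suc m)" .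
    qed
    also have "\<dots> \<le> (\<Sum>m\<in>{N..<M}. (w m)\<^sup>2 / real (Suc m))"
      using S(1) by (intro sum_mono2) auto
    finally show False using Q by simp
  qed
  then obtain m where m: "m \<in> S" "(w m)\<^sup>2 \<le> 2 * Q / \<eta>" by blast
  \<comment> \<open>AM-GM with weight \<open>\<eta>\<close> replaces the square root of
    \<open>2 * Q / \<eta>\<close> by an affine function of \<open>Q\<close>.\<close>
  have "0 \<le> (\<bar>w m\<bar> - 2 * \<eta>)\<^sup>2" by simp
  then have "\<bar>w m\<bar> * \<eta> * 4 \<le> 4 * \<eta>\<^sup>2 + (w m)\<^sup>2"
    by (simp add: power2_diff algebra_simps power2_eq_square)
  then have "\<bar>w m\<bar> * \<eta> * 4 \<le> 4 * \<eta>\<^sup>2 + 2 * Q / \<eta>" using m(2) by simp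
  then have "\<bar>w m\<bar> \<le> (4 * \<eta>\<^sup>2 + 2 * Q / \<eta>) / (\<eta> * 4)"
    using \<eta> by (subst pos_le_divide_eq) (auto simp: algebra_simps)
  also have "\<dots> = \<eta> + Q / (2 * \<eta>\<^sup>2)" using \<eta> by (simp add: field_simps power2_eq_square)
  finally show ?thesis using m(1) by blast
qed

text \<open>Etemadi's monotonicity argument. The weights \<open>1 / Suc m\<close> give every block
  \<open>{n..(1 + \<eta>) n}\<close> a mass bounded below, so each block contains an index \<open>m\<close> at which the average is
  close to \<open>b\<close>; the averages cannot change much inside a block because the terms are nonnegative.\<close>

lemma averages_close:
  fixes y w A :: "nat \<Rightarrow> real"
  assumes y: "\<And>i. 0 \<le> y i" and A: "\<And>m. A m = (\<Sum>i\<le>m. y i) / real (Suc m)"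
    and \<eta>: "0 < \<eta>" "\<eta> \<le> 1 / 2" and b: "0 \<le> b" and \<rho>: "0 \<le> \<rho>"
    and close: "\<And>m. m \<in> {N..<M} \<Longrightarrow> \<bar>A m - b\<bar> \<le> \<bar>w m\<bar> + \<rho>"
    and Q: "(\<Sum>m\<in>{N..<M}. (w m)\<^sup>2 / real (Suc m)) \<le> Q"
    and n: "2 * N + 1 \<le> n" "2 * n + 1 < M"
  shows "\<bar>A n - b\<bar> \<le> \<eta> * b + 2 * (\<eta> + Q / (2 * \<eta>\<^sup>2) + \<rho>)"
proof -
  define R where "R = \<eta> + Q / (2 * \<eta>\<^sup>2) + \<rho>"
  \<comment> \<open>The length of the block after \<open>n\<close> and of the block before it. As
    \<open>\<eta> \<le> 1 / 2\<close> gives \<open>2 * u \<le> Suc n\<close>, both blocks stay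
    inside \<open>{N..<M}\<close>.\<close>
  define u where "u = nat \<lfloor>\<eta> * real (Suc n)\<rfloor>"
  have u: "real u \<le> \<eta> * real (Suc n)" "\<eta> * real (Suc n) \<le> real u + 1"
    unfolding u_def using \<eta>
    by (auto simp: of_nat_nat)
  have "\<eta> * real (Suc n) \<le> 1 / 2 * real (Suc n)" using \<eta> by (intro mult_right_mono) auto
  then have "real u \<le> 1 / 2 * real (Suc n)" by (rule order_trans[OF u(1)])
  then have "real (2 * u) \<le> real (Suc n)"
    by simp
  then have u2: "2 * u \<le> Suc n" unfolding of_nat_le_iff .
  have R: "0 \<le> R" if "\<bar>w m\<bar> \<le> \<eta> + Q / (2 * \<eta>\<^sup>2)" for m
    using that \<rho> unfolding R_def by linarith
  have mono: "real (Suc m) * A m \<le> real (Suc m') * A m'" if "m \<le> m'" for m m'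
  proof -
    have "(\<Sum>i\<le>m. y i) \<le> (\<Sum>i\<le>m'. y i)" using that y by (intro sum_mono2) auto
    then show ?thesis unfolding A by simp
  qed
  have A0: "0 \<le> A m" for m unfolding A using y by (auto intro!: divide_nonneg_pos sum_nonneg)
  have "{n..n + u} \<subseteq> {N..<M}"
    unfolding atLeastatMost_subset_iff atLeastLessThan_def using n u2 by auto
  then have "\<exists>m\<in>{n..n + u}. \<bar>w m\<bar> \<le> \<eta> + Q / (2 * \<eta>\<^sup>2)"
    using u u2 \<eta>(1) by (intro exists_small_in_block[OF Q, where n = n]) auto
  then obtain m where m: "m \<in> {n..n + u}" "\<bar>w m\<bar> \<le> \<eta> + Q / (2 * \<eta>\<^sup>2)" by blast
  have "real (Suc n) * A n \<le> real (Suc m) * A m" using m by (intro mono) auto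
  also have "\<dots> \<le> ((1 + \<eta>) * real (Suc n)) * A m"
    using m u A0 by (intro mult_right_mono) (auto simp: algebra_simps)
  finally have "real (Suc n) * A n \<le> real (Suc n) * ((1 + \<eta>) * A m)" by (simp only: mult_ac)
  then have "A n \<le> (1 + \<eta>) * A m" by (rule mult_left_le_imp_le) simp
  moreover have "A m \<le> b + R"
    using close[of m] m n u2 unfolding R_def by auto
  ultimately have "A n \<le> (1 + \<eta>) * (b + R)"
    using \<eta> by (meson add_nonneg_nonneg less_imp_le mult_left_mono order_trans zero_le_one)
  also have "\<dots> \<le> b + \<eta> * b + 2 * R"
    using mult_right_mono[of \<eta> 1 R] \<eta> R[OF m(2)] by (simp add: algebra_simps)
  finally have upper: "A n - b \<le> \<eta> * b + 2 * R" by simp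
  have "u \<le> n" using n u2 by linarith
  then have "real (card {n - u..n}) = real u + 1" by simp
  moreover have "{n - u..n} \<subseteq> {N..<M}" using n u2 by auto
  ultimately have "\<exists>m\<in>{n - u..n}. \<bar>w m\<bar> \<le> \<eta> + Q / (2 * \<eta>\<^sup>2)"
    using u \<eta>(1) by (intro exists_small_in_block[OF Q, where n = n]) auto
  then obtain k where k: "k \<in> {n - u..n}" "\<bar>w k\<bar> \<le> \<eta> + Q / (2 * \<eta>\<^sup>2)" by blast
  have "n \<le> k + u" "k \<le> n" using k(1) by auto
  then have "N \<le> k" "k < M" using n u2 by linarith+
  then have "\<bar>A k - b\<bar> \<le> \<bar>w k\<bar> + \<rho>" by (intro close) simp
  then have Ak: "b - R \<le> A k" using k(2) unfolding R_def by linarith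
  have "(1 - \<eta>) * real (Suc n) * A k \<le> real (Suc k) * A k"
    using k u A0 u2 n by (intro mult_right_mono) (auto simp: algebra_simps of_nat_diff)
  also have "\<dots> \<le> real (Suc n) * A n" using k by (intro mono) auto
  finally have "real (Suc n) * ((1 - \<eta>) * A k) \<le> real (Suc n) * A n" by (simp only: mult_ac)
  then have Ank: "(1 - \<eta>) * A k \<le> A n" by (rule mult_left_le_imp_le) simp
  have lower: "b - \<eta> * b - R \<le> A n"
  proof (cases "b - R \<ge> 0")
    case True
    have "(1 - \<eta>) * (b - R) \<le> (1 - \<eta>) * A k" using Ak \<eta> by (intro mult_left_mono) auto
    then have "(1 - \<eta>) * (b - R) \<le> A n" using Ank by linarith
    moreover have "\<eta> * R \<ge> 0" using \<eta> R[OF m(2)] by simp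
    ultimately show ?thesis by (simp add: algebra_simps)
  next
    case False
    moreover have "0 \<le> \<eta> * b" using \<eta> b by simp
    ultimately show ?thesis using A0[of n] by linarith
  qed
  show ?thesis using upper lower R[OF m(2)] unfolding R_def[symmetric] by linarith
qed

text \<open>Exchanging the sums gives \<open>z i\<close> the tail of the series of 1 / (n+1)^3 as
  its weight, which is at most 2 / (i+1)^2. The subtracted term makes the induction on
  \<open>M\<close> close: with a = 1 / (M+1) it remains to see that a^3 + a^2 \<le> 1 / M^2.\<close>

lemma sum_averages_le:
  fixes z :: "nat \<Rightarrow> real"
  assumes z: "\<And>i. 0 \<le> z i"
  shows "(\<Sum>n<M. (\<Sum>i<Suc n. z i) / real (Suc n) ^ 3) \<le>
    2 * (\<Sum>i<M. z i / (real (Suc i))\<^sup>2) - (\<Sum>i<M. z i) / (real M)\<^sup>2"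
proof (induction M)
  case 0
  then show ?case by simp
next
  case (Suc M)
  define P where "P = (\<Sum>i<M. z i)"
  have P: "0 \<le> P" unfolding P_def using z by (simp add: sum_nonneg)
  define a where "a = 1 / real (Suc M)"
  have a: "0 \<le> a" "a \<le> 1" unfolding a_def by auto
  have a3: "a ^ 3 \<le> a\<^sup>2" using a by (intro power_decreasing) auto
  have "P * (a ^ 3 + a\<^sup>2) \<le> P / (real M)\<^sup>2"
  \<comment> \<open>At \<open>M = 0\<close> the right-hand side is 0 by the convention x / 0 = 0,
    but then \<open>P\<close> is an empty sum.\<close>
  proof (cases "M = 0")
    case True
    then show ?thesis unfolding P_def by simp
  next
    case False
    have "a ^ 3 + a\<^sup>2 \<le> 1 / (real M)\<^sup>2"
    proof -
      have "(real M)\<^sup>2 * (real M + 2) \<le> (real M + 1) ^ 3" by (simp add: power2_eq_square power3_eq_cube algebra_simps)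
      then have "(real M + 2) / (real M + 1) ^ 3 \<le> 1 / (real M)\<^sup>2"
        using False by (simp add: field_simps)
      moreover have "a ^ 3 + a\<^sup>2 = (real M + 2) / (real M + 1) ^ 3"
      proof -
        obtain s where s: "s = real M + 1" "s \<noteq> 0" by auto
        then have "a ^ 3 + a\<^sup>2 = (s + 1) / s ^ 3"
          unfolding a_def by (simp add: power2_eq_square power3_eq_cube add.commute divide_simps)
        then show ?thesis using s by simp
      qed
      ultimately show ?thesis by simp
    qed
    then show ?thesis using P mult_left_mono by fastforce
  qed
  moreover have "z M * a ^ 3 \<le> z M * a\<^sup>2" using a3 z by (intro mult_left_mono) auto
  moreover have "(\<Sum>i<Suc M. z i) / real (Suc M) ^ 3 = (P + z M) * a ^ 3"
    "(\<Sum>i<Suc M. z i) / (real (Suc M))\<^sup>2 = (P + z M) * a\<^sup>2"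
    "z M / (real (Suc M))\<^sup>2 = z M * a\<^sup>2"
    unfolding P_def a_def by (simp_all add: power_divide)
  ultimately show ?case using Suc unfolding P_def[symmetric]
    by (simp add: algebra_simps)
qed

section \<open>A strong law of large numbers for nearly uncorrelated terms\<close>

context expectation
begin

text \<open>Stands in for almost everywhere convergence: \<open>b\<close> plays the role of a sequence
  approximating the almost everywhere limit of \<open>a\<close>.\<close>

definition tracks :: "(nat \<Rightarrow> 'w \<Rightarrow> real) \<Rightarrow> (nat \<Rightarrow> 'w \<Rightarrow> real) \<Rightarrow> bool" where
  "tracks a b \<longleftrightarrow> (\<forall>\<epsilon>>0. \<exists>N0. \<forall>p\<ge>N0. \<exists>N. \<forall>M h. bdd_fun h \<and>
    (\<forall>\<xi>. h \<xi> \<le> 1 \<and> (\<exists>n\<in>{N..M}. h \<xi> \<le> \<bar>a n \<xi> - b p \<xi>\<bar>)) \<longrightarrow> E h \<le> \<epsilon>)"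

text \<open>\<open>g\<close> is the Borel-Cantelli condition for truncation at height
  \<open>i\<close>, \<open>z\<close> is Kolmogorov's variance condition for the centred terms, and
  \<open>K\<close> bounds each row of covariances by a constant, since row \<open>j\<close> has
  \<open>j\<close> entries of size \<open>K / real (Suc j)\<close>. The summable \<open>d\<close>
  allows all late compensators to be replaced by a single \<open>b p\<close>; \<open>C\<close>
  controls the error \<open>\<eta> * b p\<close> of the block argument.\<close>

lemma cesaro_tracks_compensator:
  fixes x b :: "nat \<Rightarrow> 'w \<Rightarrow> real" and g z d :: "nat \<Rightarrow> real"
  assumes x: "\<And>i. bdd_fun (x i)" "\<And>i \<xi>. 0 \<le> x i \<xi>"
    and b: "\<And>i. bdd_fun (b i)" "\<And>i \<xi>. 0 \<le> b i \<xi>" "\<And>i. E (b i) \<le> C"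
    and g: "\<And>i. E (\<lambda>\<xi>. of_bool (real i < x i \<xi>)) \<le> g i" "summable g"
    and z: "\<And>i. E (\<lambda>\<xi>. (min (x i \<xi>) (real i) - b i \<xi>)\<^sup>2) \<le> z i"
      "summable (\<lambda>i. z i / (real (Suc i))\<^sup>2)"
    and K: "\<And>i j. i < j \<Longrightarrow>
      \<bar>E (\<lambda>\<xi>. (min (x i \<xi>) (real i) - b i \<xi>) * (min (x j \<xi>) (real j) - b j \<xi>))\<bar> \<le> K / real (Suc j)"
    and d: "\<And>i. E (\<lambda>\<xi>. \<bar>b (Suc i) \<xi> - b i \<xi>\<bar>) \<le> d i" "summable d"
  shows "tracks (\<lambda>n \<xi>. (\<Sum>i\<le>n. x i \<xi>) / real (Suc n)) b"
  unfolding tracks_def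
proof (intro allI impI)
  fix \<epsilon> :: real assume \<epsilon>: "0 < \<epsilon>"
  define y where "y i \<xi> = min (x i \<xi>) (real i)" for i \<xi>
  define v where "v i \<xi> = y i \<xi> - b i \<xi>" for i \<xi>
  define W where "W n \<xi> = (\<Sum>i<Suc n. v i \<xi>) / real (Suc n)" for n \<xi>
  have y: "bdd_fun (y i)" for i unfolding y_def using x by auto
  have v: "bdd_fun (v i)" for i unfolding v_def using y b by auto
  have W: "bdd_fun (W n)" for n unfolding W_def using v by auto
  have K0: "0 \<le> K" using order_trans[OF abs_ge_zero K[of 0 1]] by simp
  have z0: "0 \<le> z i" for i using order_trans[OF E_nonneg z(1)] x b by auto
  have g0: "0 \<le> g i" for i using order_trans[OF E_nonneg g(1)] by auto
  have d0: "0 \<le> d i" for i using order_trans[OF E_nonneg d(1)] b by auto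
  have C0: "0 \<le> C" using order_trans[OF E_nonneg b(3)] b by auto

  \<comment> \<open>The expectation of one term of the budget \<open>Q\<close> in the block
    argument; its summability makes late budgets small.\<close>
  define q where "q n = E (\<lambda>\<xi>. (W n \<xi>)\<^sup>2 / real (Suc n))" for n
  \<comment> \<open>A row of covariances sums to at most \<open>K\<close> and enters the second
    moment twice, so it acts like additional variance \<open>2 * K\<close>.\<close>
  define z' where "z' i = z i + 2 * K" for i
  have q_le: "q n \<le> (\<Sum>i<Suc n. z' i) / real (Suc n) ^ 3" for n
  proof -
    have cov: "(\<Sum>i<j. \<bar>ip (v i) (v j)\<bar>) \<le> K" for j
    proof -
      have "(\<Sum>i<j. \<bar>ip (v i) (v j)\<bar>) \<le> (\<Sum>i<j. K / real (Suc j))"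
        using K unfolding v_def y_def by (intro sum_mono) auto
      also have "\<dots> \<le> K" using K0 by (simp add: field_simps)
      finally show ?thesis .
    qed
    have "E (\<lambda>\<xi>. (\<Sum>i<Suc n. v i \<xi>)\<^sup>2) \<le>
        (\<Sum>i<Suc n. E2 (v i)) + 2 * (\<Sum>j<Suc n. \<Sum>i<j. \<bar>ip (v i) (v j)\<bar>)"
      using v by (rule second_moment_sum)
    also have "\<dots> \<le> (\<Sum>i<Suc n. z i) + 2 * (\<Sum>j<Suc n. K)"
    proof (intro add_mono mult_left_mono sum_mono)
      show "E2 (v i) \<le> z i" for i using z(1) unfolding v_def y_def .
    qed (use cov in auto)
    also have "\<dots> = (\<Sum>i<Suc n. z' i)" unfolding z'_def by (simp add: sum.distrib algebra_simps)
    finally have "E (\<lambda>\<xi>. (\<Sum>i<Suc n. v i \<xi>)\<^sup>2) \<le> (\<Sum>i<Suc n. z' i)" .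
    moreover have "q n = E (\<lambda>\<xi>. (\<Sum>i<Suc n. v i \<xi>)\<^sup>2) / real (Suc n) ^ 3"
    proof -
      have "q n = E (\<lambda>\<xi>. (\<Sum>i<Suc n. v i \<xi>)\<^sup>2 / real (Suc n) ^ 3)"
        unfolding q_def W_def by (simp only: power_divide power2_eq_square power3_eq_cube
            times_divide_times_eq divide_divide_eq_left mult.assoc)
      then show ?thesis using v by (simp del: sum.lessThan_Suc)
    qed
    ultimately show ?thesis by (simp add: divide_right_mono del: sum.lessThan_Suc)
  qed
  have q0: "0 \<le> q n" for n unfolding q_def using W by (intro E_nonneg) auto
  have z'_sum: "summable (\<lambda>i. z' i / (real (Suc i))\<^sup>2)"
  proof -
    have "summable (\<lambda>i. inverse ((real (Suc i))\<^sup>2))"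
      using inverse_power_summable[of 2, where 'a = real] by (subst summable_Suc_iff) auto
    then have "summable (\<lambda>i. z i / (real (Suc i))\<^sup>2 + 2 * K * inverse ((real (Suc i))\<^sup>2))"
      using z(2) by (intro summable_add summable_mult) auto
    then show ?thesis unfolding z'_def by (simp add: divide_inverse distrib_right)
  qed
  have q_sum: "summable q"
  proof (rule summableI_nonneg_bounded)
    fix M
    have "(\<Sum>n<M. q n) \<le> (\<Sum>n<M. (\<Sum>i<Suc n. z' i) / real (Suc n) ^ 3)"
      using q_le by (intro sum_mono)
    also have "\<dots> \<le> 2 * (\<Sum>i<M. z' i / (real (Suc i))\<^sup>2) - (\<Sum>i<M. z' i) / (real M)\<^sup>2"
      using z0 K0 unfolding z'_def by (intro sum_averages_le) auto
    also have "\<dots> \<le> 2 * (\<Sum>i<M. z' i / (real (Suc i))\<^sup>2)"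
      using z0 K0 unfolding z'_def by (simp add: sum_nonneg)
    also have "\<dots> \<le> 2 * (\<Sum>i. z' i / (real (Suc i))\<^sup>2)"
      using z'_sum z0 K0 unfolding z'_def by (intro mult_left_mono sum_le_suminf) auto
    finally show "(\<Sum>n<M. q n) \<le> 2 * (\<Sum>i. z' i / (real (Suc i))\<^sup>2)" .
  qed (rule q0)

  have tail: "\<exists>N. \<forall>m\<ge>N. \<forall>n. (\<Sum>i\<in>{m..<n}. f i) \<le> e"
    if fe: "summable f" "0 < e" for f :: "nat \<Rightarrow> real" and e
  proof -
    obtain N where N: "\<And>m n. N \<le> m \<Longrightarrow> norm (sum f {m..<n}) < e"
      using fe unfolding summable_Cauchy by meson
    have "(\<Sum>i\<in>{m..<n}. f i) \<le> e" if "N \<le> m" for m n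
      using N[OF that, of n] by (simp add: abs_less_iff)
    then show ?thesis by blast
  qed
  \<comment> \<open>In the final expectation \<open>\<eta>\<close> has a coefficient of at most
    \<open>C + 2 * mass\<close>; the summand 1 keeps the denominator positive. Five contributions of
    at most \<open>\<epsilon> / 6\<close> will be added.\<close>
  define \<eta> where "\<eta> = min (1 / 2) (\<epsilon> / (6 * (C + 2 * mass + 1)))"
  have \<eta>: "0 < \<eta>" "\<eta> \<le> 1 / 2"
    using \<epsilon> C0 mass_nonneg unfolding \<eta>_def by (simp_all only: min.cobounded1) auto
  have \<eta>C: "\<eta> * (C + 2 * mass) \<le> \<epsilon> / 6"
  proof -
    have "\<eta> * (C + 2 * mass) \<le> \<epsilon> / (6 * (C + 2 * mass + 1)) * (C + 2 * mass + 1)"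
      using C0 mass_nonneg \<epsilon> unfolding \<eta>_def
      by (intro mult_mono min.cobounded2 divide_nonneg_nonneg) auto
    also have "\<dots> = \<epsilon> / 6"
    proof -
      have "C + 2 * mass + 1 \<noteq> 0" using C0 mass_nonneg by linarith
      then show ?thesis by (simp add: divide_simps)
    qed
    finally show ?thesis .
  qed
  obtain N1 where N1: "\<And>m n. N1 \<le> m \<Longrightarrow> (\<Sum>i\<in>{m..<n}. g i) \<le> \<epsilon> / 6"
    using tail[OF g(2), of "\<epsilon> / 6"] \<epsilon> by auto
  obtain N2 where N2: "\<And>m n. N2 \<le> m \<Longrightarrow> (\<Sum>i\<in>{m..<n}. d i) \<le> \<epsilon> / 12"
    using tail[OF d(2), of "\<epsilon> / 12"] \<epsilon> by auto
  obtain N3 where N3: "\<And>m n. N3 \<le> m \<Longrightarrow> (\<Sum>i\<in>{m..<n}. q i) \<le> \<epsilon> * \<eta>\<^sup>2 / 6"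
    using tail[OF q_sum, of "\<epsilon> * \<eta>\<^sup>2 / 6"] \<epsilon> \<eta> by auto
  let ?Q = "\<lambda>p N. \<forall>M h. bdd_fun h \<and>
      (\<forall>\<xi>. h \<xi> \<le> 1 \<and> (\<exists>n\<in>{N..M}. h \<xi> \<le> \<bar>(\<Sum>i\<le>n. x i \<xi>) / real (Suc n) - b p \<xi>\<bar>)) \<longrightarrow> E h \<le> \<epsilon>"
  show "\<exists>N0. \<forall>p\<ge>N0. \<exists>N. ?Q p N"
  \<comment> \<open>Past \<open>N1\<close> the truncations that bite have small total expectation,
    and past \<open>N2\<close> the compensators hardly move. What happens before \<open>p\<close> is
    bounded by \<open>K1\<close> and \<open>K2\<close> and is divided away by a large
    \<open>N'\<close>.\<close>
  proof (rule exI[of _ "max N1 N2"], intro allI impI)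
    fix p assume p: "max N1 N2 \<le> p"
    have "bdd_fun (\<lambda>\<xi>. \<Sum>i<p. x i \<xi>)" using x by auto
    then obtain K1 where K1: "0 \<le> K1" "\<And>\<xi>. \<bar>\<Sum>i<p. x i \<xi>\<bar> \<le> K1"
      by (elim bdd_funE) blast
    have "bdd_fun (\<lambda>\<xi>. \<Sum>i<p. \<bar>b i \<xi> - b p \<xi>\<bar>)" using b by auto
    then obtain K2 where K2: "0 \<le> K2" "\<And>\<xi>. \<bar>\<Sum>i<p. \<bar>b i \<xi> - b p \<xi>\<bar>\<bar> \<le> K2"
      by (elim bdd_funE) blast
    obtain N' :: nat where "max (real N3) (max (real p) ((K1 + 2 * K2) * mass * 6 / \<epsilon>)) \<le> real N'"
      using real_arch_simple by blast
    then have N': "N3 \<le> N'" "p \<le> N'" "(K1 + 2 * K2) * mass * 6 / \<epsilon> \<le> real N'" by auto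
    show "\<exists>N. ?Q p N"
    proof (rule exI[of _ "2 * N' + 1"], intro allI impI, elim conjE)
      fix M h assume h: "bdd_fun h" and
        hb: "\<forall>\<xi>. h \<xi> \<le> 1 \<and> (\<exists>n\<in>{2 * N' + 1..M}. h \<xi> \<le> \<bar>(\<Sum>i\<le>n. x i \<xi>) / real (Suc n) - b p \<xi>\<bar>)"
      \<comment> \<open>The block argument at \<open>n\<close> needs control up to
        \<open>2 * n + 1\<close>, and \<open>n\<close> ranges up to \<open>M\<close>.\<close>
      define M' where "M' = 2 * M + 2"
      define I where "I \<xi> = (\<Sum>i\<in>{p..<Suc M}. of_bool (real i < x i \<xi>) :: real)" for \<xi>
      define Q where "Q \<xi> = (\<Sum>m\<in>{N'..<M'}. (W m \<xi>)\<^sup>2 / real (Suc m))" for \<xi>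
      define T where "T \<xi> = (\<Sum>i\<in>{p..<M'}. \<bar>b (Suc i) \<xi> - b i \<xi>\<bar>)" for \<xi>
      define k where "k = (K1 + 2 * K2) / real (Suc N')"
      have I0: "0 \<le> I \<xi>" and Q0: "0 \<le> Q \<xi>" and T0: "0 \<le> T \<xi>" for \<xi>
        unfolding I_def Q_def T_def by (auto intro!: sum_nonneg divide_nonneg_pos)
      have I_zero: "I \<xi> = 0 \<longleftrightarrow> (\<forall>i\<in>{p..<Suc M}. x i \<xi> \<le> real i)" for \<xi>
        unfolding I_def by (subst sum_nonneg_eq_0_iff) (auto simp: not_less)
      have k0: "0 \<le> k" unfolding k_def using K1 K2 by simp
      \<comment> \<open>\<open>I\<close> counts the indices at which truncation changes the term.
        Where it is not 0 it is at least 1 and dominates \<open>h\<close>; where it is 0,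
        \<open>x\<close> and \<open>y\<close> agree from \<open>p\<close> to \<open>M\<close>, and
        the averages of \<open>y\<close> may be used.\<close>
      have pointwise: "h \<xi> \<le> (I \<xi> + k) + (\<eta> * b p \<xi> + 2 * (\<eta> + Q \<xi> / (2 * \<eta>\<^sup>2) + T \<xi>))" for \<xi>
      proof (cases "I \<xi> = 0")
        case False
        then obtain i where i: "i \<in> {p..<Suc M}" "real i < x i \<xi>"
          unfolding I_zero by (auto simp: not_le)
        have "of_bool (real i < x i \<xi>) \<le> I \<xi>"
          unfolding I_def using i(1) by (intro member_le_sum) auto
        then have "1 \<le> I \<xi>" using i(2) by simp
        then have "h \<xi> \<le> I \<xi>" using hb order_trans by blast
        moreover have "0 \<le> \<eta> * b p \<xi>" "0 \<le> \<eta> + Q \<xi> / (2 * \<eta>\<^sup>2) + T \<xi>" using \<eta> b T0[of \<xi>] Q0[of \<xi>] by auto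
        ultimately have "h \<xi> + 0 + (0 + 2 * 0) \<le> (I \<xi> + k) + (\<eta> * b p \<xi> + 2 * (\<eta> + Q \<xi> / (2 * \<eta>\<^sup>2) + T \<xi>))"
          using k0 by (intro add_mono mult_left_mono) auto
        then show ?thesis by simp
      next
        case True
        then have trunc: "x i \<xi> = y i \<xi>" if "i \<in> {p..<Suc M}" for i
          using that unfolding I_zero y_def by (auto simp: min_def)
        obtain n where n: "n \<in> {2 * N' + 1..M}" "h \<xi> \<le> \<bar>(\<Sum>i\<le>n. x i \<xi>) / real (Suc n) - b p \<xi>\<bar>"
          using hb by blast
        define A where "A m = (\<Sum>i\<le>m. y i \<xi>) / real (Suc m)" for m
        have bp: "\<bar>b i \<xi> - b p \<xi>\<bar> \<le> T \<xi>" if "p \<le> i" "i \<le> M'" for i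
        proof -
          have "\<bar>b i \<xi> - b p \<xi>\<bar> = \<bar>\<Sum>j\<in>{p..<i}. (b (Suc j) \<xi> - b j \<xi>)\<bar>"
            using sum_Suc_diff'[OF that(1), of "\<lambda>j. b j \<xi>"] by simp
          also have "\<dots> \<le> (\<Sum>j\<in>{p..<i}. \<bar>b (Suc j) \<xi> - b j \<xi>\<bar>)" by (rule sum_abs)
          also have "\<dots> \<le> T \<xi>" unfolding T_def using that by (intro sum_mono2) auto
          finally show ?thesis .
        qed
        have split: "(\<Sum>i\<le>m. f i) = (\<Sum>i<p. f i) + (\<Sum>i\<in>{p..m}. f i)" if "p \<le> m"
          for f :: "nat \<Rightarrow> real" and m
          using sum.atLeastLessThan_concat[of 0 p "Suc m" f] that
          by (simp add: atLeast0LessThan atLeast0AtMost atLeastLessThanSuc_atLeastAtMost lessThan_Suc_atMost)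
        have close: "\<bar>A m - b p \<xi>\<bar> \<le> \<bar>W m \<xi>\<bar> + (K2 / real (Suc N') + T \<xi>)" if m: "m \<in> {N'..<M'}" for m
        proof -
          have "(\<Sum>i\<le>m. y i \<xi>) = (\<Sum>i\<le>m. v i \<xi>) + (\<Sum>i\<le>m. b i \<xi>)"
            unfolding v_def by (simp add: sum_subtractf)
          also have "(\<Sum>i\<le>m. b i \<xi>) = real (Suc m) * b p \<xi> + (\<Sum>i\<le>m. b i \<xi> - b p \<xi>)"
            by (simp add: sum_subtractf)
          finally have "A m - b p \<xi> = W m \<xi> + (\<Sum>i\<le>m. b i \<xi> - b p \<xi>) / real (Suc m)"
            unfolding A_def W_def lessThan_Suc_atMost by (simp add: add_divide_distrib del: of_nat_Suc)
          moreover have "\<bar>\<Sum>i\<le>m. b i \<xi> - b p \<xi>\<bar> \<le> K2 + real (Suc m) * T \<xi>"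
          proof -
            have "\<bar>\<Sum>i\<le>m. b i \<xi> - b p \<xi>\<bar> \<le> (\<Sum>i\<le>m. \<bar>b i \<xi> - b p \<xi>\<bar>)" by (rule sum_abs)
            also have "\<dots> = (\<Sum>i<p. \<bar>b i \<xi> - b p \<xi>\<bar>) + (\<Sum>i\<in>{p..m}. \<bar>b i \<xi> - b p \<xi>\<bar>)"
              using m N' by (intro split) auto
            also have "\<dots> \<le> K2 + (\<Sum>i\<in>{p..m}. T \<xi>)"
              using K2(2)[of \<xi>] bp m by (intro add_mono sum_mono) auto
            also have "\<dots> \<le> K2 + real (Suc m) * T \<xi>" using T0[of \<xi>] by (auto intro!: mult_right_mono)
            finally show ?thesis .
          qed
          then have "\<bar>(\<Sum>i\<le>m. b i \<xi> - b p \<xi>) / real (Suc m)\<bar> \<le> K2 / real (Suc m) + T \<xi>"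
            by (auto dest: divide_right_mono[where c = "real (Suc m)"] simp: add_divide_distrib abs_divide simp del: of_nat_Suc)
          moreover have "K2 / real (Suc m) \<le> K2 / real (Suc N')"
            using K2 m by (intro divide_left_mono) auto
          ultimately show ?thesis by linarith
        qed
        have "\<bar>A n - b p \<xi>\<bar> \<le> \<eta> * b p \<xi> + 2 * (\<eta> + Q \<xi> / (2 * \<eta>\<^sup>2) + (K2 / real (Suc N') + T \<xi>))"
        proof (rule averages_close[where y = "\<lambda>i. y i \<xi>" and w = "\<lambda>m. W m \<xi>" and N = N' and M = M'])
          show "0 \<le> y i \<xi>" for i unfolding y_def using x by simp
          show "A m = (\<Sum>i\<le>m. y i \<xi>) / real (Suc m)" for m by (rule A_def)
          show "0 \<le> K2 / real (Suc N') + T \<xi>" using K2 T0[of \<xi>] by auto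
          show "(\<Sum>m\<in>{N'..<M'}. (W m \<xi>)\<^sup>2 / real (Suc m)) \<le> Q \<xi>" by (simp add: Q_def)
          show "2 * N' + 1 \<le> n" "2 * n + 1 < M'" using n unfolding M'_def by auto
        qed (use \<eta> b close in auto)
        moreover have "\<bar>(\<Sum>i\<le>n. x i \<xi>) / real (Suc n) - A n\<bar> \<le> K1 / real (Suc N')"
        proof -
          have "(\<Sum>i\<le>n. x i \<xi>) - (\<Sum>i\<le>n. y i \<xi>) = (\<Sum>i<p. x i \<xi> - y i \<xi>)"
            using trunc n N' split[of n] by (simp add: sum_subtractf)
          also have "\<bar>\<dots>\<bar> \<le> (\<Sum>i<p. \<bar>x i \<xi> - y i \<xi>\<bar>)" by (rule sum_abs)
          also have "\<dots> \<le> (\<Sum>i<p. x i \<xi>)"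
            unfolding y_def using x by (intro sum_mono) (auto simp: min_def)
          also have "\<dots> \<le> K1" using K1(2)[of \<xi>] by simp
          finally have "\<bar>(\<Sum>i\<le>n. x i \<xi>) - (\<Sum>i\<le>n. y i \<xi>)\<bar> / real (Suc n) \<le> K1 / real (Suc n)"
            by (simp add: divide_right_mono)
          also have "\<dots> \<le> K1 / real (Suc N')" using K1 n by (intro divide_left_mono) auto
          finally show ?thesis
            unfolding A_def diff_divide_distrib[symmetric] by (simp add: abs_divide)
        qed
        moreover have "k = K1 / real (Suc N') + 2 * (K2 / real (Suc N'))"
          unfolding k_def by (simp add: add_divide_distrib)
        ultimately show ?thesis using n(2) I0[of \<xi>] by argo
      qed
      have IQT: "bdd_fun I" "bdd_fun Q" "bdd_fun T"
        unfolding I_def[abs_def] Q_def[abs_def] T_def[abs_def] using b W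
        by (auto intro!: bdd_fun_sum simp del: sum.op_ivl_Suc sum_of_bool_eq)
      have "E h \<le> E (\<lambda>\<xi>. (I \<xi> + k) + (\<eta> * b p \<xi> + 2 * (\<eta> + Q \<xi> / (2 * \<eta>\<^sup>2) + T \<xi>)))"
        using h b IQT pointwise by (intro E_mono) auto
      also have "\<dots> = E I + k * mass + \<eta> * E (b p) + 2 * (\<eta> * mass + E Q / (2 * \<eta>\<^sup>2) + E T)"
        using b IQT by simp
      also have "\<dots> \<le> \<epsilon>"
      proof -
        have "E I = (\<Sum>i\<in>{p..<Suc M}. E (\<lambda>\<xi>. of_bool (real i < x i \<xi>)))"
          unfolding I_def by (rule E_sum) auto
        also have "\<dots> \<le> (\<Sum>i\<in>{p..<Suc M}. g i)" using g(1) by (rule sum_mono)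
        also have "\<dots> \<le> \<epsilon> / 6" using p by (intro N1) auto
        finally have 1: "E I \<le> \<epsilon> / 6" .
        have "E T = (\<Sum>i\<in>{p..<M'}. E (\<lambda>\<xi>. \<bar>b (Suc i) \<xi> - b i \<xi>\<bar>))"
          unfolding T_def using b by (intro E_sum) auto
        also have "\<dots> \<le> (\<Sum>i\<in>{p..<M'}. d i)" using d(1) by (rule sum_mono)
        also have "\<dots> \<le> \<epsilon> / 12" using p by (intro N2) auto
        finally have 2: "E T \<le> \<epsilon> / 12" .
        have "E Q = (\<Sum>m\<in>{N'..<M'}. q m)"
          unfolding Q_def q_def using W by (intro E_sum) auto
        also have "\<dots> \<le> \<epsilon> * \<eta>\<^sup>2 / 6" using N' by (intro N3) auto
        finally have 3: "E Q / (2 * \<eta>\<^sup>2) \<le> \<epsilon> / 12" using \<eta> by (simp add: field_simps)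
        have 4: "\<eta> * E (b p) + 2 * (\<eta> * mass) \<le> \<epsilon> / 6"
        proof -
          have "\<eta> * E (b p) \<le> \<eta> * C" using b(3) \<eta> by (intro mult_left_mono) auto
          then show ?thesis using \<eta>C by (simp add: distrib_left)
        qed
        have "(K1 + 2 * K2) * mass * 6 / \<epsilon> \<le> real (Suc N')" using N'(3) by simp
        then have 5: "k * mass \<le> \<epsilon> / 6"
          unfolding k_def using \<epsilon> by (simp add: field_simps)
        show ?thesis using 1 2 3 4 5 \<epsilon> unfolding distrib_left by linarith
      qed
      finally show "E h \<le> \<epsilon>" .
    qed
  qed
qed

end

section \<open>Selecting the subsequence\<close>

text \<open>The next index is chosen against every \<open>i \<le> r n\<close>, not only against the
  indices already selected, so the recursion has to remember the last index only.\<close>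

lemma exists_subsequence_pairwise:
  fixes P :: "nat \<Rightarrow> nat \<Rightarrow> nat \<Rightarrow> bool"
  assumes P: "\<And>j i. \<forall>\<^sub>F m in sequentially. P j i m"
  obtains r :: "nat \<Rightarrow> nat" where "strict_mono r" "\<And>i j. i < j \<Longrightarrow> P j (r i) (r j)"
proof -
  have "\<exists>y. True \<and> (x < y \<and> (\<forall>i\<le>x. P (Suc n) i y))" for x n :: nat
  proof -
    have "\<forall>\<^sub>F m in sequentially. \<forall>i\<in>{..x}. P (Suc n) i m"
      by (intro eventually_ball_finite ballI P) auto
    then have "\<forall>\<^sub>F m in sequentially. x < m \<and> (\<forall>i\<in>{..x}. P (Suc n) i m)"
      by (intro eventually_conj eventually_gt_at_top)
    then show ?thesis unfolding eventually_sequentially by auto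
  qed
  then obtain r :: "nat \<Rightarrow> nat" where r: "\<And>n. r n < r (Suc n) \<and> (\<forall>i\<le>r n. P (Suc n) i (r (Suc n)))"
    using dependent_nat_choice[of "\<lambda>_ _. True" "\<lambda>n x y. x < y \<and> (\<forall>i\<le>x. P (Suc n) i y)"] by auto
  have mono: "strict_mono r" using r by (simp add: strict_mono_Suc_iff)
  have "P j (r i) (r j)" if "i < j" for i j
  proof (cases j)
    case (Suc n)
    then have "r i \<le> r n" using that mono by (simp add: strict_mono_less_eq)
    then show ?thesis using r Suc by blast
  qed (use that in simp)
  then show ?thesis using that mono by blast
qed

lemma diagonal_convergent:
  fixes a :: "'j::countable \<Rightarrow> nat \<Rightarrow> real"
  assumes bdd: "\<And>j. bounded (range (a j))"
  obtains r :: "nat \<Rightarrow> nat" where "strict_mono r" "\<And>j. convergent (\<lambda>n. a j (r n))"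
proof -
  interpret subseqs "\<lambda>j s. convergent (\<lambda>n. a (from_nat j) (s n))"
  proof
    fix j and s :: "nat \<Rightarrow> nat"
    have "bounded (range (a (from_nat j) \<circ> s))"
      using bdd by (rule bounded_subset) auto
    then obtain l r where "strict_mono (r :: nat \<Rightarrow> nat)" "((a (from_nat j) \<circ> s) \<circ> r) \<longlonglongrightarrow> l"
      using bounded_imp_convergent_subsequence by blast
    then show "\<exists>r'. strict_mono r' \<and> convergent (\<lambda>n. a (from_nat j) ((s \<circ> r') n))"
      unfolding convergent_def by (auto simp: o_def)
  qed
  have "convergent (\<lambda>n. a j (diagseq n))" for j
  proof -
    have "convergent (\<lambda>n. a (from_nat (to_nat j)) ((diagseq \<circ> (+) (Suc (to_nat j))) n))"
    proof (rule diagseq_holds)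
      fix r s :: "nat \<Rightarrow> nat" and i
      assume "strict_mono r" "convergent (\<lambda>n. a (from_nat i) (s n))"
      then show "convergent (\<lambda>n. a (from_nat i) ((s \<circ> r) n))"
        using convergent_subseq_convergent by (fastforce simp: o_def)
    qed
    then have "convergent (\<lambda>n. a j (diagseq (n + Suc (to_nat j))))"
      by (simp add: o_def add.commute)
    then show ?thesis by (subst (asm) convergent_ignore_initial_segment)
  qed
  then show ?thesis using that subseq_diagseq by blast
qed

text \<open>Levels up to \<open>v\<close> contribute at most 1 each and level 0 nothing; later
  levels contribute v^2 / (k+1)^2, which telescopes against 1 / k - 1 / (k+1). Under
  \<open>E\<close> this becomes the variance condition, with a total of at most twice the
  mean.\<close>

lemma sum_truncations_le:
  fixes v :: real
  assumes v: "0 \<le> v"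
  shows "(\<Sum>k<K. (min v (real k))\<^sup>2 / (real (Suc k))\<^sup>2) \<le> 2 * v"
proof -
  have "(\<Sum>k<K. (min v (real k))\<^sup>2 / (real (Suc k))\<^sup>2) \<le>
      (if real K \<le> v + 1 then max 0 (real K - 1) else 2 * v - v\<^sup>2 / real K)"
  proof (induction K)
    case 0
    then show ?case using v by simp
  next
    case (Suc K)
    show ?case
    proof (cases "real K \<le> v")
      case True
      have "(real K)\<^sup>2 \<le> (real (Suc K))\<^sup>2" by (intro power_mono) auto
      then have "(real K)\<^sup>2 / (real (Suc K))\<^sup>2 \<le> 1" by (simp add: divide_le_eq_1)
      then have "(min v (real K))\<^sup>2 / (real (Suc K))\<^sup>2 \<le> (if K = 0 then 0 else 1)"
        using True by (simp add: min_absorb2)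
      moreover have "(\<Sum>k<K. (min v (real k))\<^sup>2 / (real (Suc k))\<^sup>2) \<le> max 0 (real K - 1)"
        using Suc True by auto
      moreover have "max 0 (real K - 1) + (if K = 0 then 0 else 1) = max 0 (real (Suc K) - 1)" by auto
      ultimately have "(\<Sum>k<Suc K. (min v (real k))\<^sup>2 / (real (Suc k))\<^sup>2) \<le> max 0 (real (Suc K) - 1)"
        unfolding sum.lessThan_Suc by linarith
      then show ?thesis using True by auto
    next
      case False
      have min: "min v (real K) = v" using False by simp
      have K: "real K > 0" using False v by linarith
      show ?thesis
      proof (cases "real K \<le> v + 1")
        case True
        have "(\<Sum>k<K. (min v (real k))\<^sup>2 / (real (Suc k))\<^sup>2) \<le> real K - 1"
          using Suc True K by (auto split: if_splits)
        \<comment> \<open>The bound switches here from its counting form to its telescoping form: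
          one copy of \<open>v\<close> pays for \<open>real K - 1\<close>, and this inequality fits
          the new term and the subtracted fraction into the other copy.\<close>
        moreover have "v\<^sup>2 / (real (Suc K))\<^sup>2 + v\<^sup>2 / real (Suc K) \<le> v"
        proof -
          define s where "s = real (Suc K)"
          have s: "s > 0" "v \<le> s - 1" unfolding s_def using False by auto
          have "v * (s + 1) \<le> (s - 1) * (s + 1)" using s by (intro mult_right_mono) auto
          also have "\<dots> \<le> s\<^sup>2" by (simp add: power2_eq_square algebra_simps)
          finally have "v * (s + 1) / s\<^sup>2 \<le> 1" using s by simp
          then have "v * (v * (s + 1) / s\<^sup>2) \<le> v * 1" using v by (rule mult_left_mono)
          moreover have "v\<^sup>2 / s\<^sup>2 + v\<^sup>2 / s = v * (v * (s + 1) / s\<^sup>2)"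
            using s by (simp add: power2_eq_square divide_simps distrib_left distrib_right)
          ultimately show ?thesis unfolding s_def by simp
        qed
        ultimately show ?thesis using False True min by simp
      next
        case F: False
        have "v\<^sup>2 / (real (Suc K))\<^sup>2 \<le> v\<^sup>2 / real K - v\<^sup>2 / real (Suc K)"
        proof -
          have "1 / (real (Suc K))\<^sup>2 \<le> 1 / (real K * real (Suc K))"
            unfolding power2_eq_square using K by (intro divide_left_mono mult_right_mono) auto
          also have "\<dots> = 1 / real K - 1 / real (Suc K)" using K by (simp add: field_simps)
          finally have "1 / (real (Suc K))\<^sup>2 \<le> 1 / real K - 1 / real (Suc K)" .
          from mult_left_mono[OF this, of "v\<^sup>2"] show ?thesis by (simp add: algebra_simps)
        qed
        then show ?thesis using Suc F min by simp
      qed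
    qed
  qed
  also have "\<dots> \<le> 2 * v" using v by (auto simp: max_def)
  finally show ?thesis .
qed

text \<open>Under \<open>E\<close> this is the classical estimate of the sum over k of P(X > k) by
  the mean plus 1, which makes the tail masses summable.\<close>

lemma sum_indicators_le:
  fixes v :: real
  assumes v: "0 \<le> v"
  shows "(\<Sum>k<K. of_bool (real k < v)) \<le> v + 1"
proof -
  have "(\<Sum>k<K. of_bool (real k < v)) \<le> min (real K) (v + 1)"
    using v by (induction K) auto
  then show ?thesis by simp
qed

locale positive_sequence = expectation E for E :: "('w \<Rightarrow> real) \<Rightarrow> real" +
  fixes X :: "nat \<Rightarrow> 'w \<Rightarrow> real" and C :: real
  assumes X_bdd [simp, intro]: "bdd_fun (X m)"
    and X_nonneg: "0 \<le> X m \<xi>"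
    and X_le: "E (X m) \<le> C"
begin

definition Y :: "nat \<Rightarrow> nat \<Rightarrow> 'w \<Rightarrow> real" where
  "Y m k \<xi> = min (X m \<xi>) (real k)"

abbreviation tail_mass :: "nat \<Rightarrow> nat \<Rightarrow> real" where
  "tail_mass m k \<equiv> E (\<lambda>\<xi>. of_bool (real k < X m \<xi>))"

lemma Y_bdd [simp, intro]: "bdd_fun (Y m k)"
  unfolding Y_def by auto

lemma Y_bounds: "0 \<le> Y m k \<xi>" "Y m k \<xi> \<le> real k" "Y m k \<xi> \<le> X m \<xi>"
  unfolding Y_def using X_nonneg by auto

end

lemma (in expectation) E_abs_bound:
  assumes "bdd_fun g" "\<And>\<xi>. \<bar>g \<xi>\<bar> \<le> c"
  shows "\<bar>E g\<bar> \<le> c * mass"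
proof -
  have "- c \<le> g \<xi>" "g \<xi> \<le> c" for \<xi> using assms(2)[of \<xi>] by linarith+
  then have "E (\<lambda>_. - c) \<le> E g" "E g \<le> E (\<lambda>_. c)" using assms(1) by (intro E_mono; simp)+
  then show ?thesis by (simp add: abs_le_iff)
qed

text \<open>Weak convergence of the truncations is demanded only against the truncations themselves,
  which are countably many conditions. The iterated limit in \<open>corr_lim\<close> is the squared
  norm that a weak limit at level \<open>k\<close> would have.\<close>

locale stabilized_sequence = positive_sequence E X C
  for E :: "('w \<Rightarrow> real) \<Rightarrow> real" and X C +
  assumes corr: "convergent (\<lambda>m. ip (Y i k) (Y m k'))"
    and corr_lim: "convergent (\<lambda>i. lim (\<lambda>m. ip (Y i k) (Y m k)))"
    and var: "convergent (\<lambda>m. E2 (Y m k))"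
    and tail: "convergent (\<lambda>m. tail_mass m k)"
begin

text \<open>\<open>L z k\<close> plays the role of the inner product of \<open>z\<close> with the weak \<open>L\<^sup>2\<close> limit of \<open>Y m k\<close>.\<close>

definition L :: "('w \<Rightarrow> real) \<Rightarrow> nat \<Rightarrow> real" where
  "L z k = lim (\<lambda>m. ip z (Y m k))"

text \<open>The functions against which weak limits can be formed. The class contains the
  truncations and is closed under differences and averages, so it contains every difference of
  compensators that will be tested.\<close>

definition testable :: "('w \<Rightarrow> real) \<Rightarrow> bool" where
  "testable z \<longleftrightarrow> bdd_fun z \<and> (\<forall>k. convergent (\<lambda>m. ip z (Y m k)))"

lemma testable_lim: "testable z \<Longrightarrow> (\<lambda>m. ip z (Y m k)) \<longlonglongrightarrow> L z k"
  unfolding testable_def L_def by (simp add: convergent_LIMSEQ_iff)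

lemma testable_bdd: "testable z \<Longrightarrow> bdd_fun z"
  unfolding testable_def by simp

lemma testable_Y: "testable (Y i k)"
  unfolding testable_def using corr by auto

lemma testable_diff:
  assumes "testable y" "testable z"
  shows "testable (\<lambda>\<xi>. y \<xi> - z \<xi>)"
proof -
  have "E (\<lambda>\<xi>. (y \<xi> - z \<xi>) * Y m k \<xi>) = ip y (Y m k) - ip z (Y m k)" for m k
    using assms[THEN testable_bdd] by (simp add: left_diff_distrib)
  then show ?thesis
    using assms unfolding testable_def by (auto simp del: E_diff intro!: convergent_diff)
qed

lemma testable_sum_divide:
  assumes "\<And>i. i \<in> A \<Longrightarrow> testable (z i)"
  shows "testable (\<lambda>\<xi>. (\<Sum>i\<in>A. z i \<xi>) / c)"
proof -
  have "E (\<lambda>\<xi>. (\<Sum>i\<in>A. z i \<xi>) / c * Y m k \<xi>) = (\<Sum>i\<in>A. ip (z i) (Y m k)) / c" for m k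
    using assms[THEN testable_bdd] by (simp add: sum_distrib_right)
  moreover have "(\<lambda>m. (\<Sum>i\<in>A. ip (z i) (Y m k)) / c) \<longlonglongrightarrow> (\<Sum>i\<in>A. L (z i) k) / c" for k
    unfolding divide_inverse using assms
    by (intro tendsto_mult tendsto_sum testable_lim tendsto_const) auto
  ultimately have "(\<lambda>m. E (\<lambda>\<xi>. (\<Sum>i\<in>A. z i \<xi>) / c * Y m k \<xi>)) \<longlonglongrightarrow> (\<Sum>i\<in>A. L (z i) k) / c" for k
    by presburger
  then show ?thesis
    using assms[THEN testable_bdd] unfolding testable_def by (auto simp del: E_divide intro: convergentI)
qed

definition avg :: "(nat \<Rightarrow> nat) \<Rightarrow> nat \<Rightarrow> nat \<Rightarrow> 'w \<Rightarrow> real" where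
  "avg q n k \<xi> = (\<Sum>i<n. Y (q i) k \<xi>) / real n"

lemma testable_avg: "testable (avg q n k)"
  unfolding avg_def by (intro testable_sum_divide testable_Y)

lemma avg_nonneg: "0 \<le> avg q n k \<xi>"
  unfolding avg_def using Y_bounds by (auto intro!: divide_nonneg_nonneg sum_nonneg)

lemma avg_le: "avg q n k \<xi> \<le> real k"
proof -
  have "(\<Sum>i<n. Y (q i) k \<xi>) \<le> (\<Sum>i<n. real k)" using Y_bounds by (intro sum_mono) auto
  then show ?thesis unfolding avg_def by (cases "n = 0") (auto simp: field_simps)
qed

text \<open>Averages over sufficiently spread out indices approximate the weak limits, at finitely many
  truncation levels simultaneously (Banach--Saks).\<close>

lemma exists_avg_close:
  assumes \<delta>: "0 < \<delta>"
  obtains q n where "0 < n" "\<And>i. N0 \<le> q i"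
    "\<And>k' z. k' \<le> k \<Longrightarrow> testable z \<Longrightarrow>
      \<bar>L z k' - ip z (avg q n k')\<bar> \<le> \<delta> * sqrt (E2 z)"
proof -
  \<comment> \<open>Each off-diagonal product below is at most \<open>4 * \<eta>\<close> and there
    are \<open>2 * n * n\<close> of them to pay for, which uses half of
    \<open>\<delta>\<^sup>2\<close>; the diagonal uses the other half.\<close>
  define \<eta> where "\<eta> = \<delta>\<^sup>2 / 16"
  have \<eta>: "0 < \<eta>" unfolding \<eta>_def using \<delta> by simp
  define c where "c k' = lim (\<lambda>i. L (Y i k') k')" for k'
  have c: "(\<lambda>i. L (Y i k') k') \<longlonglongrightarrow> c k'" for k'
    using corr_lim[of k'] unfolding c_def L_def by (simp add: convergent_LIMSEQ_iff)
  have "\<forall>\<^sub>F i in sequentially. \<forall>k'\<in>{..k}. dist (L (Y i k') k') (c k') < \<eta> / 2"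
    using \<eta> by (intro eventually_ball_finite ballI tendstoD[OF c]) auto
  then obtain N1 where N1: "\<And>i k'. N1 \<le> i \<Longrightarrow> k' \<le> k \<Longrightarrow> dist (L (Y i k') k') (c k') < \<eta> / 2"
    unfolding eventually_sequentially by auto
  have "\<forall>\<^sub>F m in sequentially. \<forall>k'\<in>{..k}. dist (ip (Y i k') (Y m k')) (L (Y i k') k') < \<eta> / 2" for i
    using \<eta> by (intro eventually_ball_finite ballI tendstoD[OF testable_lim] testable_Y) auto
  note sub = exists_subsequence_pairwise[of "\<lambda>_ i m. \<forall>k'\<in>{..k}. dist (ip (Y i k') (Y m k')) (L (Y i k') k') < \<eta> / 2", OF this]
  obtain r :: "nat \<Rightarrow> nat" where r: "strict_mono r" and rP: "\<And>i j. i < j \<Longrightarrow>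
      \<forall>k'\<in>{..k}. dist (ip (Y (r i) k') (Y (r j) k')) (L (Y (r i) k') k') < \<eta> / 2"
    by (rule sub) blast
  \<comment> \<open>The shift pushes all indices past \<open>N0\<close> and \<open>N1\<close>; from
    there on any two distinct terms correlate within \<open>\<eta>\<close> of
    \<open>c k'\<close>.\<close>
  define q where "q i = r (i + max N0 N1)" for i
  have qN: "max N0 N1 \<le> q i" for i
    unfolding q_def using seq_suble[OF r, of "i + max N0 N1"] by linarith
  have q_corr: "\<bar>ip (Y (q i) k') (Y (q j) k') - c k'\<bar> \<le> \<eta>" if "i \<noteq> j" "k' \<le> k" for i j k'
  proof -
    have *: "\<bar>ip (Y (q i) k') (Y (q j) k') - c k'\<bar> \<le> \<eta>" if "i < j" for i j
    proof -
      have "dist (ip (Y (q i) k') (Y (q j) k')) (L (Y (q i) k') k') < \<eta> / 2"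
        using rP[of "i + max N0 N1" "j + max N0 N1"] that \<open>k' \<le> k\<close> unfolding q_def[symmetric] by auto
      moreover have "dist (L (Y (q i) k') k') (c k') < \<eta> / 2"
        using N1[of "q i" k'] qN[of i] \<open>k' \<le> k\<close> by auto
      ultimately have "dist (ip (Y (q i) k') (Y (q j) k')) (c k') < \<eta>"
        unfolding dist_real_def by linarith
      then show ?thesis unfolding dist_real_def by simp
    qed
    show ?thesis using *[of i j] *[of j i] \<open>i \<noteq> j\<close> by (cases "i < j") (auto simp: mult.commute)
  qed
  \<comment> \<open>Large enough for the \<open>n\<close> diagonal terms to be small against
    \<open>n * n\<close>; the summand 1 ensures \<open>0 < n\<close>.\<close>
  obtain n :: nat where n: "2 * (real k)\<^sup>2 * mass / \<delta>\<^sup>2 + 1 \<le> real n"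
    using real_arch_simple by blast
  have "0 \<le> 2 * (real k)\<^sup>2 * mass / \<delta>\<^sup>2" using mass_nonneg by simp
  then have n0: "0 < n" using n by (cases n) auto
  have nd: "(real k)\<^sup>2 * mass \<le> real n * (\<delta>\<^sup>2 / 2)"
  proof -
    have "2 * (real k)\<^sup>2 * mass / \<delta>\<^sup>2 \<le> real n" using n by simp
    then show ?thesis using \<delta> by (simp add: pos_divide_le_eq algebra_simps)
  qed
  have avg_diff: "sqrt (E (\<lambda>\<xi>. (avg (\<lambda>i. q (M + i)) n k' \<xi> - avg q n k' \<xi>)\<^sup>2)) \<le> \<delta>"
    if "n \<le> M" "k' \<le> k" for M k'
  proof -
    define v where "v i \<xi> = Y (q (M + i)) k' \<xi> - Y (q i) k' \<xi>" for i \<xi>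
    have v: "bdd_fun (v i)" for i unfolding v_def by auto
    have diag: "E2 (v i) \<le> (real k)\<^sup>2 * mass" for i
    proof -
      have "\<bar>v i \<xi>\<bar> \<le> real k" for \<xi>
        unfolding v_def using Y_bounds[of "q (M + i)" k' \<xi>] Y_bounds[of "q i" k' \<xi>] that by linarith
      then have "(v i \<xi>)\<^sup>2 \<le> (real k)\<^sup>2" for \<xi> by (metis abs_ge_zero power2_abs power_mono)
      then have "\<bar>E2 (v i)\<bar> \<le> (real k)\<^sup>2 * mass" using v by (intro E_abs_bound) auto
      then show ?thesis by linarith
    qed
    \<comment> \<open>The product expands into four correlations with signs +, -, -, +. Since
      \<open>n \<le> M\<close>, all four involve distinct indices, so \<open>c k'\<close> cancels
      and four errors \<open>\<eta>\<close> remain.\<close>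
    have off: "\<bar>ip (v i) (v j)\<bar> \<le> 4 * \<eta>" if "i < j" "j < n" for i j
    proof -
      have "ip (v i) (v j) =
          E (\<lambda>\<xi>. (Y (q (M + i)) k' \<xi> * Y (q (M + j)) k' \<xi> - Y (q i) k' \<xi> * Y (q (M + j)) k' \<xi>)
            - (Y (q (M + i)) k' \<xi> * Y (q j) k' \<xi> - Y (q i) k' \<xi> * Y (q j) k' \<xi>))"
        unfolding v_def by (simp only: left_diff_distrib right_diff_distrib)
      also have "\<dots> = (E (\<lambda>\<xi>. Y (q (M + i)) k' \<xi> * Y (q (M + j)) k' \<xi>) - E (\<lambda>\<xi>. Y (q i) k' \<xi> * Y (q (M + j)) k' \<xi>))
            - (E (\<lambda>\<xi>. Y (q (M + i)) k' \<xi> * Y (q j) k' \<xi>) - ip (Y (q i) k') (Y (q j) k'))"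
        by simp
      finally have eq: "ip (v i) (v j) = \<dots>" .
      show ?thesis
      proof -
        have ne: "M + i \<noteq> M + j" "i \<noteq> M + j" "M + i \<noteq> j" "i \<noteq> j" using that \<open>n \<le> M\<close> by auto
        show ?thesis
          unfolding eq using ne[THEN q_corr, OF \<open>k' \<le> k\<close>] by linarith
      qed
    qed
    have "E (\<lambda>\<xi>. (\<Sum>i<n. v i \<xi>)\<^sup>2) \<le>
        (\<Sum>i<n. E2 (v i)) + 2 * (\<Sum>j<n. \<Sum>i<j. \<bar>ip (v i) (v j)\<bar>)"
      using v by (rule second_moment_sum)
    also have "\<dots> \<le> (\<Sum>i<n. (real k)\<^sup>2 * mass) + 2 * (\<Sum>j<n. \<Sum>i<n. 4 * \<eta>)"
    proof (intro add_mono mult_left_mono sum_mono diag)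
      fix j assume j: "j \<in> {..<n}"
      have "(\<Sum>i<j. \<bar>ip (v i) (v j)\<bar>) \<le> (\<Sum>i<j. 4 * \<eta>)"
        using off j by (intro sum_mono) auto
      also have "\<dots> \<le> (\<Sum>i<n. 4 * \<eta>)" using j \<eta> by (intro sum_mono2) auto
      finally show "(\<Sum>i<j. \<bar>ip (v i) (v j)\<bar>) \<le> (\<Sum>i<n. 4 * \<eta>)" .
    qed auto
    also have "\<dots> = real n * ((real k)\<^sup>2 * mass) + (real n)\<^sup>2 * (\<delta>\<^sup>2 / 2)"
      unfolding \<eta>_def by (simp add: power2_eq_square)
    also have "\<dots> \<le> real n * (real n * (\<delta>\<^sup>2 / 2)) + (real n)\<^sup>2 * (\<delta>\<^sup>2 / 2)"
      using nd by (intro add_mono mult_left_mono) auto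
    also have "\<dots> = (real n)\<^sup>2 * \<delta>\<^sup>2" by (simp add: power2_eq_square)
    finally have "E (\<lambda>\<xi>. (\<Sum>i<n. v i \<xi>)\<^sup>2) / (real n)\<^sup>2 \<le> \<delta>\<^sup>2"
      using n0 by (simp add: pos_divide_le_eq mult.commute)
    moreover have "E (\<lambda>\<xi>. (avg (\<lambda>i. q (M + i)) n k' \<xi> - avg q n k' \<xi>)\<^sup>2) = E (\<lambda>\<xi>. (\<Sum>i<n. v i \<xi>)\<^sup>2 / (real n)\<^sup>2)"
      unfolding avg_def v_def by (simp add: sum_subtractf power_divide diff_divide_distrib[symmetric])
    ultimately have "E (\<lambda>\<xi>. (avg (\<lambda>i. q (M + i)) n k' \<xi> - avg q n k' \<xi>)\<^sup>2) \<le> \<delta>\<^sup>2" using v by simp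
    then show ?thesis using \<delta> by (metis abs_of_pos real_sqrt_abs real_sqrt_le_iff)
  qed
  have "\<bar>L z k' - ip z (avg q n k')\<bar> \<le> \<delta> * sqrt (E2 z)"
    if k': "k' \<le> k" and z: "testable z" for k' z
  proof -
    have zb: "bdd_fun z" using z by (rule testable_bdd)
    \<comment> \<open>As \<open>M\<close> grows the shifted average tends weakly to the limit
      described by \<open>L\<close>, while staying within \<open>\<delta>\<close> of the fixed
      average in the second moment norm.\<close>
    have "(\<lambda>M. E (\<lambda>\<xi>. z \<xi> * avg (\<lambda>i. q (M + i)) n k' \<xi>)) \<longlonglongrightarrow> L z k'"
    proof -
      have eq: "E (\<lambda>\<xi>. z \<xi> * avg (\<lambda>i. q (M + i)) n k' \<xi>) = (\<Sum>i<n. E (\<lambda>\<xi>. z \<xi> * Y (q (M + i)) k' \<xi>)) / real n" for M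
        using zb unfolding avg_def by (simp add: sum_distrib_left)
      have "(\<lambda>M. E (\<lambda>\<xi>. z \<xi> * Y (q (M + i)) k' \<xi>)) \<longlonglongrightarrow> L z k'" for i
      proof -
        have "strict_mono (\<lambda>M. q (M + i))" unfolding q_def using r by (simp add: strict_mono_def)
        from LIMSEQ_subseq_LIMSEQ[OF testable_lim[OF z] this] show ?thesis by (simp add: o_def)
      qed
      then have "(\<lambda>M. (\<Sum>i<n. E (\<lambda>\<xi>. z \<xi> * Y (q (M + i)) k' \<xi>)) / real n) \<longlonglongrightarrow> (\<Sum>i<n. L z k') / real n"
        using n0 by (intro tendsto_intros) auto
      then show ?thesis unfolding eq using n0 by simp
    qed
    then have lim: "(\<lambda>M. \<bar>E (\<lambda>\<xi>. z \<xi> * avg (\<lambda>i. q (M + i)) n k' \<xi>) - ip z (avg q n k')\<bar>)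
        \<longlonglongrightarrow> \<bar>L z k' - ip z (avg q n k')\<bar>"
      by (intro tendsto_intros)
    have bound: "\<bar>E (\<lambda>\<xi>. z \<xi> * avg (\<lambda>i. q (M + i)) n k' \<xi>) - ip z (avg q n k')\<bar>
        \<le> \<delta> * sqrt (E2 z)" if "n \<le> M" for M
    proof -
      have ab: "bdd_fun (avg q' n k')" for q' using testable_avg by (rule testable_bdd)
      have eq: "E (\<lambda>\<xi>. z \<xi> * avg (\<lambda>i. q (M + i)) n k' \<xi>) - ip z (avg q n k')
          = E (\<lambda>\<xi>. z \<xi> * (avg (\<lambda>i. q (M + i)) n k' \<xi> - avg q n k' \<xi>))"
        using zb ab by (simp add: right_diff_distrib)
      have "\<bar>E (\<lambda>\<xi>. z \<xi> * (avg (\<lambda>i. q (M + i)) n k' \<xi> - avg q n k' \<xi>))\<bar>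
          \<le> sqrt (E2 z) * sqrt (E (\<lambda>\<xi>. (avg (\<lambda>i. q (M + i)) n k' \<xi> - avg q n k' \<xi>)\<^sup>2))"
        by (rule Cauchy_Schwarz_E[OF zb bdd_fun_diff[OF ab ab]])
      also have "\<dots> \<le> sqrt (E2 z) * \<delta>"
        by (intro mult_left_mono avg_diff[OF that k'] real_sqrt_ge_zero E_nonneg bdd_fun_power2 zb) simp
      finally show ?thesis unfolding eq by (simp add: mult.commute)
    qed
    show ?thesis
      by (rule tendsto_upperbound[OF lim eventually_sequentiallyI[OF bound]]) simp_all
  qed
  moreover have "N0 \<le> q i" for i using qN[of i] by simp
  ultimately show ?thesis using that[OF n0] by blast
qed

end

section \<open>Compensators and the choice of the subsequence\<close>

context stabilized_sequence
begin

lemma E_avg_le: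
  assumes n: "0 < n"
  shows "E (avg q n k) \<le> C"
proof -
  have "(\<Sum>i<n. E (Y (q i) k)) \<le> (\<Sum>i<n. C)"
  proof (rule sum_mono)
    fix i
    have "E (Y (q i) k) \<le> E (X (q i))" using Y_bounds by (intro E_mono) auto
    then show "E (Y (q i) k) \<le> C" using X_le order_trans by blast
  qed
  moreover have "E (avg q n k) = (\<Sum>i<n. E (Y (q i) k)) / real n"
    unfolding avg_def[abs_def] by simp
  ultimately show ?thesis using n by (simp add: pos_divide_le_eq mult.commute)
qed

lemma E_avg_square_le:
  assumes n: "0 < n" and c: "\<And>i. E2 (Y (q i) k) \<le> c"
  shows "E2 (avg q n k) \<le> c"
proof -
  have "(avg q n k \<xi>)\<^sup>2 \<le> (\<Sum>i<n. (Y (q i) k \<xi>)\<^sup>2) / real n" for \<xi>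
  proof -
    have "(\<Sum>i<n. Y (q i) k \<xi>)\<^sup>2 \<le> (\<Sum>i<n. (Y (q i) k \<xi>)\<^sup>2) * real n"
      using sum_squared_le_sum_of_squares[of "\<lambda>i. Y (q i) k \<xi>" "{..<n}"] by simp
    then show ?thesis
      unfolding avg_def using n by (simp add: power_divide power2_eq_square[of "real n"] pos_divide_le_eq)
  qed
  then have "E2 (avg q n k) \<le> E (\<lambda>\<xi>. (\<Sum>i<n. (Y (q i) k \<xi>)\<^sup>2) / real n)"
    using testable_bdd[OF testable_avg] by (intro E_mono) auto
  also have "\<dots> = (\<Sum>i<n. E2 (Y (q i) k)) / real n" by simp
  also have "\<dots> \<le> (\<Sum>i<n. c) / real n" using c by (intro divide_right_mono sum_mono) auto
  also have "\<dots> = c" using n by simp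
  finally show ?thesis .
qed

definition V :: "nat \<Rightarrow> real" where
  "V k = lim (\<lambda>m. E2 (Y m k))"

definition G :: "nat \<Rightarrow> real" where
  "G k = lim (\<lambda>m. tail_mass m k)"

lemma V_lim: "(\<lambda>m. E2 (Y m k)) \<longlonglongrightarrow> V k"
  using var unfolding V_def by (simp add: convergent_LIMSEQ_iff)

lemma G_lim: "(\<lambda>m. tail_mass m k) \<longlonglongrightarrow> G k"
  using tail unfolding G_def by (simp add: convergent_LIMSEQ_iff)

lemma V_nonneg: "0 \<le> V k"
  by (rule tendsto_lowerbound[OF V_lim]) (auto intro!: always_eventually E_nonneg)

lemma G_nonneg: "0 \<le> G k"
  by (rule tendsto_lowerbound[OF G_lim]) (auto intro!: always_eventually E_nonneg)

text \<open>For fixed \<open>m\<close> the pointwise inequality for truncations bounds the partial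
  sums by twice the mean of \<open>X m\<close>; the bound survives the limit in
  \<open>m\<close>.\<close>

lemma summable_V: "summable (\<lambda>k. V k / (real (Suc k))\<^sup>2)"
proof (rule summableI_nonneg_bounded)
  fix K
  have lim: "(\<lambda>m. \<Sum>k<K. E2 (Y m k) / (real (Suc k))\<^sup>2) \<longlonglongrightarrow> (\<Sum>k<K. V k / (real (Suc k))\<^sup>2)"
    by (intro tendsto_sum tendsto_divide V_lim tendsto_const) auto
  have le: "(\<Sum>k<K. E2 (Y m k) / (real (Suc k))\<^sup>2) \<le> 2 * C" for m
  proof -
    have "(\<Sum>k<K. E2 (Y m k) / (real (Suc k))\<^sup>2) = E (\<lambda>\<xi>. \<Sum>k<K. (Y m k \<xi>)\<^sup>2 / (real (Suc k))\<^sup>2)"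
      by (subst E_sum) auto
    also have "\<dots> \<le> E (\<lambda>\<xi>. 2 * X m \<xi>)"
      unfolding Y_def using X_nonneg by (intro E_mono sum_truncations_le) auto
    also have "\<dots> \<le> 2 * C" using X_le by simp
    finally show ?thesis .
  qed
  show "(\<Sum>k<K. V k / (real (Suc k))\<^sup>2) \<le> 2 * C"
    by (rule tendsto_upperbound[OF lim always_eventually]) (use le in auto)
qed (use V_nonneg in auto)

lemma summable_G: "summable G"
proof (rule summableI_nonneg_bounded)
  fix K
  have lim: "(\<lambda>m. \<Sum>k<K. tail_mass m k) \<longlonglongrightarrow> (\<Sum>k<K. G k)"
    by (intro tendsto_sum G_lim)
  have le: "(\<Sum>k<K. tail_mass m k) \<le> C + mass" for m
  proof -
    have "(\<Sum>k<K. tail_mass m k) = E (\<lambda>\<xi>. \<Sum>k<K. of_bool (real k < X m \<xi>))"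
      by (rule E_sum[symmetric]) auto
    also have "\<dots> \<le> E (\<lambda>\<xi>. X m \<xi> + 1)"
      using X_nonneg by (intro E_mono sum_indicators_le bdd_fun_sum) auto
    also have "\<dots> \<le> C + mass" using X_le by simp
    finally show ?thesis .
  qed
  show "(\<Sum>k<K. G k) \<le> C + mass"
    by (rule tendsto_upperbound[OF lim always_eventually]) (use le in auto)
qed (use G_nonneg in auto)

lemma summable_inverse_squares: "summable (\<lambda>i. 1 / (real (Suc i))\<^sup>2)"
proof -
  have "summable (\<lambda>i. inverse ((real (Suc i))\<^sup>2))"
    using inverse_power_summable[of 2, where 'a = real] by (subst summable_Suc_iff) auto
  then show ?thesis by (simp add: divide_inverse)
qed

text \<open>The compensator \<open>b k\<close> averages terms truncated at level \<open>k\<close>,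
  taken at indices so late that their second moments are at most \<open>V k + 1\<close>. It is a
  genuine bounded function that nearly represents \<open>L\<close> at level \<open>k\<close>, and it
  is fixed before the subsequence is chosen.\<close>

lemma exists_tracked_subsequence:
  "\<exists>(r :: nat \<Rightarrow> nat) b. strict_mono r \<and>
    (\<forall>s :: nat \<Rightarrow> nat. strict_mono s \<longrightarrow> tracks (\<lambda>n \<xi>. (\<Sum>i\<le>n. X (r (s i)) \<xi>) / real (Suc n)) b)"
proof -
  have "\<exists>N. \<forall>m\<ge>N. E2 (Y m k) \<le> V k + 1" for k
  proof -
    have "\<forall>\<^sub>F m in sequentially. E2 (Y m k) < V k + 1"
      by (rule order_tendstoD(2)[OF V_lim]) simp
    then show ?thesis unfolding eventually_sequentially by (meson less_imp_le)
  qed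
  then obtain N0 where N0: "\<And>k m. N0 k \<le> m \<Longrightarrow> E2 (Y m k) \<le> V k + 1" by metis
  \<comment> \<open>Inverse squares serve twice: they are summable, which controls the increments of
    \<open>b\<close>, and against the growth \<open>real (Suc j)\<close> of the truncations they
    still leave \<open>1 / real (Suc j)\<close> for the covariances.\<close>
  define \<delta> where "\<delta> k = 1 / (real (Suc k))\<^sup>2" for k
  have \<delta>: "0 < \<delta> k" for k unfolding \<delta>_def by simp
  have "\<exists>q n. 0 < n \<and> (\<forall>i. N0 k \<le> q i) \<and> (\<forall>k'\<le>k. \<forall>z. testable z \<longrightarrow>
      \<bar>L z k' - ip z (avg q n k')\<bar> \<le> \<delta> k * sqrt (E2 z))" for k
    by (rule exists_avg_close[OF \<delta>, of "N0 k" k k]) blast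
  then obtain q n where n: "\<And>k. 0 < n k" and q: "\<And>k i. N0 k \<le> q k i"
    and qL: "\<And>k k' z. k' \<le> k \<Longrightarrow> testable z \<Longrightarrow>
      \<bar>L z k' - ip z (avg (q k) (n k) k')\<bar> \<le> \<delta> k * sqrt (E2 z)"
    by metis
  define b where "b k = avg (q k) (n k) k" for k
  have tb: "testable (b k)" and bb: "bdd_fun (b k)" for k
    unfolding b_def by (auto intro: testable_avg testable_bdd)
  have b0: "0 \<le> b k \<xi>" and bk: "b k \<xi> \<le> real k" for k \<xi>
    unfolding b_def by (rule avg_nonneg avg_le)+
  have EbC: "E (b k) \<le> C" for k unfolding b_def using n by (rule E_avg_le)
  have Eb2: "E2 (b k) \<le> V k + 1" for k
    unfolding b_def using n q N0 by (intro E_avg_square_le) auto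
  have tZ: "testable (\<lambda>\<xi>. Y i k \<xi> - b k \<xi>)" for i k
    by (intro testable_diff testable_Y tb)

  define d where "d k = E (\<lambda>\<xi>. \<bar>b (Suc k) \<xi> - b k \<xi>\<bar>)" for k
  have d_le: "d k \<le> E (b (Suc k)) - E (b k) + 4 * sqrt mass * \<delta> k" for k
  proof -
    \<comment> \<open>\<open>b'\<close> averages the same terms as \<open>b (Suc k)\<close> but
      truncates them at level \<open>k\<close>. So it lies below \<open>b (Suc k)\<close> and, like
      \<open>b k\<close>, nearly represents \<open>L\<close> at level \<open>k\<close>.\<close>
    define b' where "b' = avg (q (Suc k)) (n (Suc k)) k"
    define D where "D \<xi> = b' \<xi> - b k \<xi>" for \<xi>
    have tD: "testable D" unfolding D_def[abs_def] b'_def by (intro testable_diff testable_avg tb)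
    then have bD: "bdd_fun D" by (rule testable_bdd)
    have bb': "bdd_fun b'" unfolding b'_def by (intro testable_bdd testable_avg)
    \<comment> \<open>\<open>D\<close> is itself testable, so both approximations of
      \<open>L\<close> may be tested on \<open>D\<close>; this bounds \<open>S * S\<close> by a
      multiple of \<open>S\<close>.\<close>
    define S where "S = sqrt (E2 D)"
    have ED: "0 \<le> E2 D" using bD by (intro E_nonneg) auto
    have "S\<^sup>2 = E2 D" unfolding S_def using ED by simp
    also have "(\<lambda>\<xi>. (D \<xi>)\<^sup>2) = (\<lambda>\<xi>. D \<xi> * b' \<xi> - D \<xi> * b k \<xi>)"
      unfolding D_def by (auto simp: power2_eq_square right_diff_distrib)
    also have "E \<dots> = ip D b' - ip D (b k)"
      using bD bb' bb by simp
    finally have "S\<^sup>2 = ip D b' - ip D (b k)" .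
    moreover have "\<bar>L D k - ip D b'\<bar> \<le> \<delta> (Suc k) * S"
      unfolding b'_def S_def using tD by (intro qL) auto
    moreover have "\<bar>L D k - ip D (b k)\<bar> \<le> \<delta> k * S"
      unfolding b_def S_def using tD by (intro qL) auto
    ultimately have S2: "S\<^sup>2 \<le> \<delta> (Suc k) * S + \<delta> k * S" by linarith
    have "\<delta> (Suc k) \<le> \<delta> k" unfolding \<delta>_def by (intro divide_left_mono power_mono) auto
    then have "\<delta> (Suc k) * S \<le> \<delta> k * S" using ED unfolding S_def by (intro mult_right_mono) auto
    with S2 have "S * S \<le> (2 * \<delta> k) * S" by (simp add: power2_eq_square)
    have S: "S \<le> 2 * \<delta> k"
    proof (cases "S = 0")
      case True
      then show ?thesis using \<delta>[of k] by simp
    next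
      case False
      then have "0 < S" using ED unfolding S_def by simp
      then show ?thesis using \<open>S * S \<le> (2 * \<delta> k) * S\<close> by simp
    qed
    have "E (\<lambda>\<xi>. \<bar>D \<xi>\<bar>) \<le> S * sqrt mass" unfolding S_def by (rule E_abs_le[OF bD])
    also have "\<dots> \<le> 2 * \<delta> k * sqrt mass" using S mass_nonneg by (intro mult_right_mono) auto
    finally have ED1: "E (\<lambda>\<xi>. \<bar>D \<xi>\<bar>) \<le> 2 * \<delta> k * sqrt mass" .
    \<comment> \<open>The increment is a nonnegative function plus \<open>D\<close>. Its signed
      expectations telescope and are bounded through \<open>C\<close>, so only the expectations of
      \<open>\<bar>D \<xi>\<bar>\<close> have to be summed.\<close>
    have "\<bar>b (Suc k) \<xi> - b k \<xi>\<bar> \<le> b (Suc k) \<xi> - b k \<xi> + 2 * \<bar>D \<xi>\<bar>" for \<xi>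
    proof -
      have "b' \<xi> \<le> b (Suc k) \<xi>"
        unfolding b'_def b_def avg_def Y_def by (intro divide_right_mono sum_mono) auto
      then show ?thesis
        using abs_ge_self[of "D \<xi>"] abs_ge_minus_self[of "D \<xi>"] abs_ge_zero[of "D \<xi>"]
        unfolding abs_le_iff D_def by auto
    qed
    then have "d k \<le> E (\<lambda>\<xi>. b (Suc k) \<xi> - b k \<xi> + 2 * \<bar>D \<xi>\<bar>)"
      unfolding d_def using bb bD by (intro E_mono) auto
    also have "\<dots> = E (b (Suc k)) - E (b k) + 2 * E (\<lambda>\<xi>. \<bar>D \<xi>\<bar>)" using bb bD by simp
    finally show ?thesis using ED1 by (simp add: mult_ac)
  qed
  have d0: "0 \<le> d k" for k unfolding d_def using bb by (intro E_nonneg) auto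
  have d_sum: "summable d"
  proof (rule summableI_nonneg_bounded)
    fix K
    have "(\<Sum>k<K. d k) \<le> (\<Sum>k<K. E (b (Suc k)) - E (b k)) + 4 * sqrt mass * (\<Sum>k<K. \<delta> k)"
      unfolding sum_distrib_left sum.distrib[symmetric] using d_le by (intro sum_mono) auto
    also have "(\<Sum>k<K. E (b (Suc k)) - E (b k)) = E (b K) - E (b 0)"
      by (rule sum_lessThan_telescope)
    also have "E (b K) - E (b 0) \<le> C"
      using EbC[of K] E_nonneg[OF bb b0, of 0] by linarith
    also have "(\<Sum>k<K. \<delta> k) \<le> (\<Sum>k. \<delta> k)"
      using summable_inverse_squares \<delta> unfolding \<delta>_def by (intro sum_le_suminf) auto
    finally show "(\<Sum>k<K. d k) \<le> C + 4 * sqrt mass * (\<Sum>k. \<delta> k)"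
      using mass_nonneg by (simp add: mult_left_mono)
  qed (rule d0)

  \<comment> \<open>Index \<open>m\<close> is to become term \<open>j\<close>, after index
    \<open>i\<close>. All levels up to \<open>j\<close> are required because a further subsequence
    moves terms to earlier positions, where they are truncated at lower levels.\<close>
  define P where "P j i m \<longleftrightarrow>
     (\<forall>k\<in>{..j}. tail_mass m k < G k + (1/2) ^ k) \<and>
     (\<forall>k\<in>{..j}. E2 (Y m k) < V k + 1) \<and>
     (\<forall>k\<in>{..i}. \<forall>k'\<in>{..j}. dist (E (\<lambda>\<xi>. (Y i k \<xi> - b k \<xi>) * Y m k' \<xi>)) (L (\<lambda>\<xi>. Y i k \<xi> - b k \<xi>) k') < 1 / real (Suc j))"
    for j i m
  have evP: "\<forall>\<^sub>F m in sequentially. P j i m" for i j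
    unfolding P_def
    by (intro eventually_conj eventually_ball_finite ballI order_tendstoD(2)[OF G_lim]
        order_tendstoD(2)[OF V_lim] tendstoD[OF testable_lim[OF tZ]]) auto
  obtain r0 :: "nat \<Rightarrow> nat" where r0: "strict_mono r0" "\<And>i j. i < j \<Longrightarrow> P j (r0 i) (r0 j)"
    by (rule exists_subsequence_pairwise[of P, OF evP]) blast
  \<comment> \<open>Dropping the first index gives every remaining one a predecessor, so the
    conditions in \<open>P\<close> that do not mention \<open>i\<close> hold for all terms.\<close>
  define r where "r i = r0 (Suc i)" for i
  have r: "strict_mono r" using r0(1) unfolding r_def strict_mono_def by auto
  have "tracks (\<lambda>n \<xi>. (\<Sum>i\<le>n. X (r (s i)) \<xi>) / real (Suc n)) b" if s: "strict_mono s" for s :: "nat \<Rightarrow> nat"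
  proof -
    define t where "t i = r (s i)" for i
    have si: "i \<le> Suc (s i)" for i using seq_suble[OF s, of i] by simp
    have it: "i \<le> t i" for i
      using seq_suble[OF s, of i] seq_suble[OF r, of "s i"] unfolding t_def by simp
    have Pt: "P (Suc (s i)) (r0 0) (t i)" for i unfolding t_def r_def using r0(2) by simp
    have Ptt: "P (Suc (s j)) (t i) (t j)" if "i < j" for i j
      unfolding t_def r_def using r0(2)[of "Suc (s i)" "Suc (s j)"] strict_monoD[OF s that] by simp
    have 1: "tail_mass (t i) i \<le> G i + (1/2) ^ i" for i
      using Pt[of i] si[of i] unfolding P_def by (auto intro: less_imp_le)
    have 2: "E (\<lambda>\<xi>. (min (X (t i) \<xi>) (real i) - b i \<xi>)\<^sup>2) \<le> 4 * (V i + 1)" for i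
    proof -
      have "E (\<lambda>\<xi>. (Y (t i) i \<xi> - b i \<xi>)\<^sup>2) \<le> E (\<lambda>\<xi>. 2 * (Y (t i) i \<xi>)\<^sup>2 + 2 * (b i \<xi>)\<^sup>2)"
      proof (rule E_mono)
        fix \<xi>
        have "0 \<le> (Y (t i) i \<xi> + b i \<xi>)\<^sup>2" by simp
        then show "(Y (t i) i \<xi> - b i \<xi>)\<^sup>2 \<le> 2 * (Y (t i) i \<xi>)\<^sup>2 + 2 * (b i \<xi>)\<^sup>2"
          by (simp add: power2_sum power2_diff)
      qed (use bb in auto)
      also have "\<dots> = 2 * E2 (Y (t i) i) + 2 * E2 (b i)" using bb by simp
      also have "\<dots> \<le> 2 * (V i + 1) + 2 * (V i + 1)"
        using Pt[of i] si[of i] Eb2 unfolding P_def by (intro add_mono mult_left_mono) (auto intro: less_imp_le)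
      finally show ?thesis unfolding Y_def by simp
    qed
    \<comment> \<open>Both \<open>ip Z (Y (t j) j)\<close> and \<open>ip Z (b j)\<close> are close
      to \<open>L Z j\<close>: the first by the choice of the subsequence, the second up to
      \<open>\<delta> j\<close> times the norm of \<open>Z\<close>, which grows at most linearly in
      \<open>j\<close>.\<close>
    have 3: "\<bar>E (\<lambda>\<xi>. (min (X (t i) \<xi>) (real i) - b i \<xi>) * (min (X (t j) \<xi>) (real j) - b j \<xi>))\<bar>
        \<le> (1 + sqrt mass) / real (Suc j)" if ij: "i < j" for i j
    proof -
      define Z where "Z \<xi> = Y (t i) i \<xi> - b i \<xi>" for \<xi>
      have Z: "testable Z" "bdd_fun Z" unfolding Z_def[abs_def] using tZ testable_bdd by auto
      have Zi: "(Z \<xi>)\<^sup>2 \<le> (real i)\<^sup>2" for \<xi>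
      proof -
        have "\<bar>Z \<xi>\<bar> \<le> real i"
          unfolding Z_def using Y_bounds[of "t i" i \<xi>] b0[of i \<xi>] bk[of i \<xi>] by linarith
        then show ?thesis by (metis abs_ge_zero power2_abs power_mono)
      qed
      have "E2 Z \<le> E (\<lambda>_. (real i)\<^sup>2)" using Zi Z by (intro E_mono) auto
      then have "sqrt (E2 Z) \<le> sqrt ((real i)\<^sup>2 * mass)" by simp
      also have "\<dots> = real i * sqrt mass" by (simp add: real_sqrt_mult)
      also have "\<dots> \<le> real (Suc j) * sqrt mass" using ij mass_nonneg by (intro mult_right_mono) auto
      finally have "\<delta> j * sqrt (E2 Z) \<le> \<delta> j * (real (Suc j) * sqrt mass)"
        using \<delta>[of j] by (intro mult_left_mono) auto
      also have "\<dots> = sqrt mass / real (Suc j)" unfolding \<delta>_def by (simp add: power2_eq_square del: of_nat_Suc)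
      finally have a: "\<delta> j * sqrt (E2 Z) \<le> sqrt mass / real (Suc j)" .
      have c: "\<bar>L Z j - ip Z (b j)\<bar> \<le> \<delta> j * sqrt (E2 Z)"
        unfolding b_def using Z by (intro qL) auto
      have "dist (ip Z (Y (t j) j)) (L Z j) < 1 / real (Suc (Suc (s j)))"
        using Ptt[OF ij] it[of i] si[of j] unfolding P_def Z_def[abs_def] by blast
      also have "\<dots> \<le> 1 / real (Suc j)" using si[of j] by (intro divide_left_mono) auto
      finally have e: "\<bar>ip Z (Y (t j) j) - L Z j\<bar> \<le> 1 / real (Suc j)"
        unfolding dist_real_def by simp
      have "E (\<lambda>\<xi>. Z \<xi> * (Y (t j) j \<xi> - b j \<xi>)) = ip Z (Y (t j) j) - ip Z (b j)"
        using Z bb by (simp add: right_diff_distrib)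
      then have "\<bar>E (\<lambda>\<xi>. Z \<xi> * (Y (t j) j \<xi> - b j \<xi>))\<bar> \<le> 1 / real (Suc j) + sqrt mass / real (Suc j)"
        using a c e by linarith
      then show ?thesis unfolding Z_def Y_def by (simp add: add_divide_distrib)
    qed
    have 4: "summable (\<lambda>i. G i + (1/2) ^ i)" by (intro summable_add summable_G summable_geometric) auto
    have 5: "summable (\<lambda>i. 4 * (V i + 1) / (real (Suc i))\<^sup>2)"
    proof -
      have "summable (\<lambda>i. 4 * (V i / (real (Suc i))\<^sup>2 + 1 / (real (Suc i))\<^sup>2))"
        by (intro summable_mult summable_add summable_V summable_inverse_squares)
      then show ?thesis by (simp only: add_divide_distrib[symmetric] times_divide_eq_right)
    qed
    show ?thesis
      unfolding t_def[symmetric]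
      using X_bdd X_nonneg bb b0 EbC 1 4 2 5 3 d_def d_sum
      by (intro cesaro_tracks_compensator[where C = C and g = "\<lambda>i. G i + (1/2) ^ i"
            and z = "\<lambda>i. 4 * (V i + 1)" and K = "1 + sqrt mass" and d = d]) auto
  qed
  then show ?thesis using r by blast
qed

end

section \<open>Diagonal extraction of a stabilized subsequence\<close>

context positive_sequence
begin

text \<open>One diagonal argument makes all correlations, second moments and tail masses converge. A
  second one is applied to the limits \<open>l\<close>, which are defined only along the first
  subsequence.\<close>

lemma exists_tracked_subsequence:
  "\<exists>(r :: nat \<Rightarrow> nat) b. strict_mono r \<and>
    (\<forall>s :: nat \<Rightarrow> nat. strict_mono s \<longrightarrow> tracks (\<lambda>n \<xi>. (\<Sum>i\<le>n. X (r (s i)) \<xi>) / real (Suc n)) b)"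
proof -
  have bdd_ip: "\<bar>ip (Y i k) (Y m k')\<bar> \<le> real k * real k' * mass" for i k m k'
    using Y_bounds by (intro E_abs_bound) (auto simp: abs_mult intro!: mult_mono)
  have bdd_tail: "\<bar>E (\<lambda>\<xi>. of_bool (P \<xi>))\<bar> \<le> 1 * mass" for P
    by (intro E_abs_bound) auto
  define a :: "(nat \<times> nat \<times> nat) + (nat + nat) \<Rightarrow> nat \<Rightarrow> real" where
    "a j m = (case j of Inl (i, k, k') \<Rightarrow> ip (Y i k) (Y m k')
      | Inr (Inl k) \<Rightarrow> ip (Y m k) (Y m k)
      | Inr (Inr k) \<Rightarrow> tail_mass m k)" for j m
  have bdd_a: "bounded (range (a j))" for j
  proof -
    have "\<exists>c. \<forall>m. \<bar>a j m\<bar> \<le> c"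
    proof (cases j)
      case (Inl t)
      obtain i k k' where "t = (i, k, k')" by (cases t)
      then show ?thesis using Inl bdd_ip[of i k _ k'] unfolding a_def by auto
    next
      case (Inr t)
      show ?thesis
      proof (cases t)
        case (Inl k)
        then show ?thesis using \<open>j = Inr t\<close> bdd_ip[of _ k _ k] unfolding a_def by auto
      next
        case (Inr k)
        then show ?thesis using \<open>j = Inr t\<close> bdd_tail unfolding a_def by (auto intro!: exI[of _ mass])
      qed
    qed
    then show ?thesis unfolding bounded_iff by auto
  qed
  obtain r1 where r1: "strict_mono r1" "\<And>j. convergent (\<lambda>m. a j (r1 m))"
    by (rule diagonal_convergent[of a, OF bdd_a]) blast
  define l where "l k i = lim (\<lambda>m. ip (Y (r1 i) k) (Y (r1 m) k))" for k i
  have l: "(\<lambda>m. ip (Y (r1 i) k) (Y (r1 m) k)) \<longlonglongrightarrow> l k i" for i k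
    using r1(2)[of "Inl (r1 i, k, k)"] unfolding l_def a_def by (simp add: convergent_LIMSEQ_iff)
  have bdd_l: "bounded (range (l k))" for k
  proof -
    have "\<bar>l k i\<bar> \<le> real k * real k * mass" for i
      by (rule tendsto_upperbound[OF tendsto_rabs[OF l] always_eventually]) (use bdd_ip in auto)
    then show ?thesis unfolding bounded_iff by auto
  qed
  obtain r2 where r2: "strict_mono r2" "\<And>k. convergent (\<lambda>i. l k (r2 i))"
    by (rule diagonal_convergent[of l, OF bdd_l]) blast
  define r where "r = r1 \<circ> r2"
  have r: "strict_mono r" unfolding r_def using r1(1) r2(1) by (rule strict_mono_o)
  have conv: "convergent (\<lambda>m. a j (r m))" for j
    using convergent_subseq_convergent[OF r1(2) r2(1), of j] by (simp add: r_def o_def)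
  interpret sub: positive_sequence E "\<lambda>m. X (r m)" C
    by unfold_locales (auto simp: X_nonneg X_le)
  have subY: "sub.Y m k = Y (r m) k" for m k
    unfolding sub.Y_def[abs_def] Y_def[abs_def] ..
  interpret sub: stabilized_sequence E "\<lambda>m. X (r m)" C
  proof
    fix i k k'
    show "convergent (\<lambda>m. E (\<lambda>\<xi>. sub.Y i k \<xi> * sub.Y m k' \<xi>))"
      using conv[of "Inl (r i, k, k')"] unfolding subY a_def by simp
    show "convergent (\<lambda>m. E (\<lambda>\<xi>. (sub.Y m k \<xi>)\<^sup>2))"
      using conv[of "Inr (Inl k)"] unfolding subY a_def by (simp add: power2_eq_square)
    show "convergent (\<lambda>m. tail_mass (r m) k)"
      using conv[of "Inr (Inr k)"] unfolding a_def by simp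
    \<comment> \<open>The inner limit along \<open>r\<close> is the one along \<open>r1\<close>, and
      those limits converge along \<open>r2\<close>.\<close>
    have "lim (\<lambda>m. ip (Y (r i) k) (Y (r m) k)) = l k (r2 i)" for i
      using LIMSEQ_subseq_LIMSEQ[OF l[of "r2 i" k] r2(1)] by (intro limI) (simp add: r_def o_def)
    then show "convergent (\<lambda>i. lim (\<lambda>m. E (\<lambda>\<xi>. sub.Y i k \<xi> * sub.Y m k \<xi>)))"
      using r2(2)[of k] unfolding subY by simp
  qed
  obtain r' :: "nat \<Rightarrow> nat" and b where r': "strict_mono r'" and b: "\<And>s :: nat \<Rightarrow> nat. strict_mono s \<Longrightarrow>
      tracks (\<lambda>n \<xi>. (\<Sum>i\<le>n. X (r (r' (s i))) \<xi>) / real (Suc n)) b"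
    using sub.exists_tracked_subsequence by blast
  show ?thesis
    using strict_mono_o[OF r r'] b by (intro exI[of _ "r \<circ> r'"] exI[of _ b]) simp
qed

end

section \<open>Minimal sublinear functionals\<close>

definition sublinear_on :: "'v::real_vector set \<Rightarrow> ('v \<Rightarrow> real) \<Rightarrow> bool" where
  "sublinear_on V p \<longleftrightarrow>
     (\<forall>u\<in>V. \<forall>v\<in>V. p (u + v) \<le> p u + p v) \<and> (\<forall>c\<ge>0. \<forall>u\<in>V. p (c *\<^sub>R u) = c * p u)"

lemma sublinear_on_zero: "sublinear_on V p \<Longrightarrow> subspace V \<Longrightarrow> p 0 = 0"
  using subspace_0[of V] unfolding sublinear_on_def by (auto dest!: spec[of _ "0::real"])

lemma sublinear_on_minus:
  assumes "sublinear_on V p" "subspace V" "v \<in> V"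
  shows "- p (- v) \<le> p v"
proof -
  have "p (v + - v) \<le> p v + p (- v)"
    using assms subspace_neg unfolding sublinear_on_def by blast
  then show ?thesis using sublinear_on_zero[OF assms(1,2)] by simp
qed

text \<open>For \<open>join = sup\<close> and a monotone linear \<open>p\<close> this says that
  \<open>p\<close> is a lattice homomorphism, the reverse inequality being monotonicity. The
  condition is stable under infima over chains and under \<open>face\<close>.\<close>

definition join_bounded :: "('v \<Rightarrow> 'v \<Rightarrow> 'v) \<Rightarrow> 'v set \<Rightarrow> ('v \<Rightarrow> real) \<Rightarrow> bool" where
  "join_bounded join V p \<longleftrightarrow> (\<forall>u\<in>V. \<forall>v\<in>V. p (join u v) \<le> max (p u) (p v))"

text \<open>For sublinear \<open>p\<close> this is the directional derivative of \<open>p\<close> at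
  \<open>w\<close> in direction \<open>v\<close>. The linear functionals below it are those below
  \<open>p\<close> that attain the value \<open>p w\<close> at \<open>w\<close>, hence the
  name.\<close>

definition face :: "('v::real_vector \<Rightarrow> real) \<Rightarrow> 'v \<Rightarrow> 'v \<Rightarrow> real" where
  "face p w v = (INF t\<in>{0..}. p (v + t *\<^sub>R w) - t * p w)"

context
  fixes V :: "'v::real_vector set" and p :: "'v \<Rightarrow> real" and w :: 'v
  assumes p: "sublinear_on V p" and V: "subspace V" and w: "w \<in> V"
begin

lemma subspace_line: "v \<in> V \<Longrightarrow> v + t *\<^sub>R w \<in> V"
  using V w by (simp add: subspace_add subspace_scale)

lemma face_antimono:
  assumes v: "v \<in> V" and t: "0 \<le> t" "t \<le> t'"
  shows "p (v + t' *\<^sub>R w) - t' * p w \<le> p (v + t *\<^sub>R w) - t * p w"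
proof -
  have "v + t' *\<^sub>R w = (v + t *\<^sub>R w) + (t' - t) *\<^sub>R w" by (simp add: algebra_simps)
  then have "p (v + t' *\<^sub>R w) \<le> p (v + t *\<^sub>R w) + p ((t' - t) *\<^sub>R w)"
    using p v subspace_line V w unfolding sublinear_on_def by (metis subspace_scale)
  also have "p ((t' - t) *\<^sub>R w) = (t' - t) * p w" using p w t unfolding sublinear_on_def by auto
  finally show ?thesis by (simp add: algebra_simps)
qed

lemma face_bdd_below:
  assumes v: "v \<in> V"
  shows "bdd_below ((\<lambda>t. p (v + t *\<^sub>R w) - t * p w) ` {0..})"
proof (rule bdd_belowI2)
  fix t :: real assume "t \<in> {0..}"
  have "p ((v + t *\<^sub>R w) + - v) \<le> p (v + t *\<^sub>R w) + p (- v)"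
    using p v subspace_line V subspace_neg unfolding sublinear_on_def by blast
  moreover have "p (t *\<^sub>R w) = t * p w" using p w \<open>t \<in> _\<close> unfolding sublinear_on_def by auto
  ultimately show "- p (- v) \<le> p (v + t *\<^sub>R w) - t * p w" by simp
qed

lemma face_le: "v \<in> V \<Longrightarrow> 0 \<le> t \<Longrightarrow> face p w v \<le> p (v + t *\<^sub>R w) - t * p w"
  unfolding face_def by (rule cINF_lower[OF face_bdd_below]) auto

lemma face_le_self: "v \<in> V \<Longrightarrow> face p w v \<le> p v"
  using face_le[of v 0] by simp

text \<open>The expression decreases in \<open>t\<close>, so all large \<open>t\<close> are good and
  two vectors can share one \<open>t\<close>.\<close>

lemma face_approx:
  assumes "v \<in> V" "face p w v < c"
  obtains t where "0 \<le> t" "\<And>t'. t \<le> t' \<Longrightarrow> p (v + t' *\<^sub>R w) - t' * p w < c"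
proof -
  obtain t where t: "0 \<le> t" "p (v + t *\<^sub>R w) - t * p w < c"
    using assms(2) cINF_less_iff[OF _ face_bdd_below[OF assms(1)]] unfolding face_def by auto
  show ?thesis
    using that[of t] t face_antimono[OF assms(1) t(1)] by fastforce
qed

lemma face_sublinear: "sublinear_on V (face p w)"
proof -
  have "face p w (u + v) \<le> face p w u + face p w v" if uv: "u \<in> V" "v \<in> V" for u v
  proof (rule field_le_epsilon)
    fix e :: real assume "0 < e"
    then obtain s t where s: "0 \<le> s" "\<And>t'. s \<le> t' \<Longrightarrow> p (u + t' *\<^sub>R w) - t' * p w < face p w u + e / 2"
      and t: "0 \<le> t" "\<And>t'. t \<le> t' \<Longrightarrow> p (v + t' *\<^sub>R w) - t' * p w < face p w v + e / 2"
      using face_approx[OF uv(1), of "face p w u + e/2"] face_approx[OF uv(2), of "face p w v + e/2"]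
      by (metis half_gt_zero less_add_same_cancel1)
    have "face p w (u + v) \<le> p ((u + v) + (s + t) *\<^sub>R w) - (s + t) * p w"
      using uv V s t by (intro face_le) (auto simp: subspace_add)
    also have "(u + v) + (s + t) *\<^sub>R w = (u + s *\<^sub>R w) + (v + t *\<^sub>R w)" by (simp add: algebra_simps)
    also have "p \<dots> \<le> p (u + s *\<^sub>R w) + p (v + t *\<^sub>R w)"
      using p uv subspace_line unfolding sublinear_on_def by blast
    finally show "face p w (u + v) \<le> face p w u + face p w v + e"
      using s(2)[of s] t(2)[of t] by (simp add: algebra_simps)
  qed
  moreover have le: "face p w (c *\<^sub>R v) \<le> c * face p w v" if c: "c > 0" and v: "v \<in> V" for c v
  proof -
    have "face p w (c *\<^sub>R v) / c \<le> p (v + t *\<^sub>R w) - t * p w" if t: "t \<in> {0..}" for t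
    proof -
      have "face p w (c *\<^sub>R v) \<le> p (c *\<^sub>R v + (c * t) *\<^sub>R w) - (c * t) * p w"
        using v V c t by (intro face_le) (auto simp: subspace_scale)
      also have "c *\<^sub>R v + (c * t) *\<^sub>R w = c *\<^sub>R (v + t *\<^sub>R w)" by (simp add: algebra_simps)
      also have "p \<dots> = c * p (v + t *\<^sub>R w)"
        using p v subspace_line c unfolding sublinear_on_def by auto
      finally show ?thesis using c by (simp add: field_simps)
    qed
    then have "face p w (c *\<^sub>R v) / c \<le> face p w v"
      unfolding face_def by (intro cINF_greatest) auto
    then show ?thesis using c by (simp add: field_simps)
  qed
  moreover have "face p w (c *\<^sub>R v) = c * face p w v" if c: "c \<ge> 0" and v: "v \<in> V" for c v
  proof (cases "c = 0")
    case True
    have "p (t *\<^sub>R w) = t * p w" if "t \<ge> 0" for t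
      using p w that unfolding sublinear_on_def by auto
    then have "face p w 0 = (INF t\<in>{0::real..}. 0)"
      unfolding face_def by (intro INF_cong) auto
    then show ?thesis using True by simp
  next
    case False
    then have c: "c > 0" using c by simp
    have "face p w (inverse c *\<^sub>R (c *\<^sub>R v)) \<le> inverse c * face p w (c *\<^sub>R v)"
      using c v V by (intro le) (auto simp: subspace_scale)
    then have "c * face p w v \<le> face p w (c *\<^sub>R v)" using c by (simp add: field_simps)
    then show ?thesis using le[OF c v] by simp
  qed
  ultimately show ?thesis unfolding sublinear_on_def by blast
qed

text \<open>Translation by \<open>m *\<^sub>R w\<close> commutes with \<open>join\<close>, so a
  common large \<open>m\<close> reduces the claim to the one for \<open>p\<close>, up to an
  arbitrarily small error.\<close>

lemma face_join:
  assumes closed: "\<And>u v. u \<in> V \<Longrightarrow> v \<in> V \<Longrightarrow> join u v \<in> V"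
    and trans: "\<And>u v z. join (u + z) (v + z) = join u v + z"
    and j: "join_bounded join V p"
  shows "join_bounded join V (face p w)"
  unfolding join_bounded_def
proof (intro ballI)
  fix u v assume uv: "u \<in> V" "v \<in> V"
  show "face p w (join u v) \<le> max (face p w u) (face p w v)"
  proof (rule field_le_epsilon)
    fix e :: real assume "0 < e"
    then obtain s t where s: "0 \<le> s" "\<And>t'. s \<le> t' \<Longrightarrow> p (u + t' *\<^sub>R w) - t' * p w < face p w u + e"
      and t: "0 \<le> t" "\<And>t'. t \<le> t' \<Longrightarrow> p (v + t' *\<^sub>R w) - t' * p w < face p w v + e"
      using face_approx[OF uv(1), of "face p w u + e"] face_approx[OF uv(2), of "face p w v + e"]
      by (metis less_add_same_cancel1)
    define m where "m = max s t"
    have "face p w (join u v) \<le> p (join u v + m *\<^sub>R w) - m * p w"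
      using uv s t by (intro face_le closed) (auto simp: m_def)
    also have "join u v + m *\<^sub>R w = join (u + m *\<^sub>R w) (v + m *\<^sub>R w)" by (simp add: trans)
    also have "p \<dots> \<le> max (p (u + m *\<^sub>R w)) (p (v + m *\<^sub>R w))"
      using j subspace_line uv unfolding join_bounded_def by blast
    finally show "face p w (join u v) \<le> max (face p w u) (face p w v) + e"
      using s(2)[of m] t(2)[of m] by (auto simp: m_def max_def split: if_splits)
  qed
qed

end

text \<open>A minimal element of a class of sublinear functionals that is stable under
  \<open>face\<close> is linear. With the binary supremum as \<open>join\<close> this produces lattice
  homomorphisms; with the first projection it is the Hahn--Banach theorem.\<close>

lemma minimal_sublinear_linear:
  fixes p0 :: "'v::real_vector \<Rightarrow> real"
  assumes p0: "sublinear_on V p0" and V: "subspace V"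
    and closed: "\<And>u v. u \<in> V \<Longrightarrow> v \<in> V \<Longrightarrow> join u v \<in> V"
    and trans: "\<And>u v z. join (u + z) (v + z) = join u v + z"
    and j: "join_bounded join V p0"
  obtains q where "\<And>u v. u \<in> V \<Longrightarrow> v \<in> V \<Longrightarrow> q (u + v) = q u + q v"
    "\<And>c v. v \<in> V \<Longrightarrow> q (c *\<^sub>R v) = c * q v"
    "\<And>v. v \<in> V \<Longrightarrow> q v \<le> p0 v" "join_bounded join V q"
proof -
  \<comment> \<open>Candidates vanish off \<open>V\<close>, so the order on functions compares
    values on \<open>V\<close> only and minimality gives equality of functions.\<close>
  define A where "A = {p. sublinear_on V p \<and> join_bounded join V p \<and> (\<forall>v\<in>V. p v \<le> p0 v) \<and> (\<forall>v. v \<notin> V \<longrightarrow> p v = 0)}"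
  define restr where "restr p v = (if v \<in> V then p v else 0)" for p :: "'v \<Rightarrow> real" and v
  have restr_A: "restr p \<in> A"
    if "sublinear_on V p" "join_bounded join V p" "\<forall>v\<in>V. p v \<le> p0 v" for p
  proof -
    have "sublinear_on V (restr p)"
      using that(1) V unfolding sublinear_on_def restr_def by (simp add: subspace_add subspace_scale)
    moreover have "join_bounded join V (restr p)"
      using that(2) closed unfolding join_bounded_def restr_def by simp
    ultimately show ?thesis using that(3) unfolding A_def restr_def by simp
  qed
  \<comment> \<open>A lower bound common to all candidates; it makes infima over chains
    finite.\<close>
  have lower: "- p0 (- v) \<le> p v" if "p \<in> A" "v \<in> V" for p v
  proof -
    have "- p (- v) \<le> p v" using that V sublinear_on_minus unfolding A_def by blast
    moreover have "p (- v) \<le> p0 (- v)" using that V unfolding A_def by (simp add: subspace_neg)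
    ultimately show ?thesis by simp
  qed
  have "\<exists>m\<in>A. \<forall>a\<in>A. m \<ge> a \<longrightarrow> a = m"
  proof (rule predicate_Zorn)
    show "partial_order_on A (relation_of (\<ge>) A)"
      by (intro partial_order_on_relation_ofI) auto
  next
    fix C assume C: "C \<in> Chains (relation_of (\<ge>) A)"
    then have CA: "C \<subseteq> A" unfolding Chains_def relation_of_def by auto
    have chain: "a \<le> b \<or> b \<le> a" if "a \<in> C" "b \<in> C" for a b
      using C that unfolding Chains_def relation_of_def by auto
    show "\<exists>u\<in>A. \<forall>a\<in>C. a \<ge> u"
    proof (cases "C = {}")
      case True
      then show ?thesis using restr_A[OF p0 j] by auto
    next
      case False
      define q where "q v = (INF p\<in>C. p v)" for v
      have bdd: "bdd_below ((\<lambda>p. p v) ` C)" if "v \<in> V" for v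
        using lower CA that by (intro bdd_belowI2[of _ "- p0 (- v)"]) auto
      have q_le: "q v \<le> p v" if "v \<in> V" "p \<in> C" for v p
        unfolding q_def using cINF_lower[OF bdd[OF that(1)] that(2)] .
      have approx: "\<exists>p\<in>C. p v < c" if "v \<in> V" "q v < c" for v c
        using that cINF_less_iff[OF False bdd[OF that(1)]] unfolding q_def by simp
      have approx2: "\<exists>p\<in>C. p u < c \<and> p v < d" if uv: "u \<in> V" "v \<in> V" "q u < c" "q v < d" for u v c d
      proof -
        obtain a b where "a \<in> C" "a u < c" "b \<in> C" "b v < d"
          using approx[OF uv(1,3)] approx[OF uv(2,4)] by blast
        moreover have "(\<forall>x. a x \<le> b x) \<or> (\<forall>x. b x \<le> a x)"
          using chain[of a b] calculation unfolding le_fun_def by blast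
        ultimately show ?thesis by (metis le_less_trans)
      qed
      have "sublinear_on V q"
        unfolding sublinear_on_def
      proof (intro conjI ballI allI impI)
        fix u v assume uv: "u \<in> V" "v \<in> V"
        show "q (u + v) \<le> q u + q v"
        proof (rule field_le_epsilon)
          fix e :: real assume "0 < e"
          then obtain p where "p \<in> C" "p u < q u + e / 2" "p v < q v + e / 2"
            using approx2[OF uv, of "q u + e/2" "q v + e/2"] by auto
          moreover have "p (u + v) \<le> p u + p v"
            using \<open>p \<in> C\<close> CA uv unfolding A_def sublinear_on_def by blast
          moreover have "q (u + v) \<le> p (u + v)" using q_le V uv \<open>p \<in> C\<close> by (simp add: subspace_add)
          ultimately show "q (u + v) \<le> q u + q v + e" by simp
        qed
      next
        fix c :: real and v assume c: "c \<ge> 0" and v: "v \<in> V"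
        have "q (c *\<^sub>R v) = (INF p\<in>C. c * p v)"
          unfolding q_def using CA c v unfolding A_def sublinear_on_def by (intro INF_cong) auto
        also have "\<dots> = c * q v"
        proof (cases "c = 0")
          case True
          then show ?thesis using False by simp
        next
          case c0: False
          show ?thesis
          proof (rule antisym)
            have "(INF p\<in>C. c * p v) / c \<le> p v" if "p \<in> C" for p
            proof -
              have "bdd_below ((\<lambda>p. c * p v) ` C)"
                using lower CA v c by (intro bdd_belowI2[of _ "c * - p0 (- v)"] mult_left_mono) auto
              then have "(INF p\<in>C. c * p v) \<le> c * p v" using that by (rule cINF_lower)
              then show ?thesis using c c0 by (simp add: field_simps)
            qed
            then have "(INF p\<in>C. c * p v) / c \<le> q v"
              unfolding q_def using False by (intro cINF_greatest)
            then show "(INF p\<in>C. c * p v) \<le> c * q v" using c c0 by (simp add: field_simps)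
            show "c * q v \<le> (INF p\<in>C. c * p v)"
              using False q_le v c by (intro cINF_greatest mult_left_mono) auto
          qed
        qed
        finally show "q (c *\<^sub>R v) = c * q v" .
      qed
      moreover have "join_bounded join V q"
        unfolding join_bounded_def
      proof (intro ballI)
        fix u v assume uv: "u \<in> V" "v \<in> V"
        show "q (join u v) \<le> max (q u) (q v)"
        proof (rule field_le_epsilon)
          fix e :: real assume "0 < e"
          then obtain p where "p \<in> C" "p u < q u + e" "p v < q v + e"
            using approx2[OF uv, of "q u + e" "q v + e"] by auto
          moreover have "p (join u v) \<le> max (p u) (p v)"
            using \<open>p \<in> C\<close> CA uv unfolding A_def join_bounded_def by blast
          moreover have "q (join u v) \<le> p (join u v)" using q_le closed uv \<open>p \<in> C\<close> by simp
          ultimately show "q (join u v) \<le> max (q u) (q v) + e" by (auto simp: max_def split: if_splits)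
        qed
      qed
      moreover have "\<forall>v\<in>V. q v \<le> p0 v"
      proof
        fix v assume v: "v \<in> V"
        obtain p where p: "p \<in> C" using False by blast
        then have "p v \<le> p0 v" using CA v unfolding A_def by blast
        then show "q v \<le> p0 v" using q_le[OF v p] by simp
      qed
      ultimately have "restr q \<in> A" by (rule restr_A)
      moreover have "restr q \<le> p" if "p \<in> C" for p
        using q_le that CA unfolding A_def restr_def le_fun_def by auto
      ultimately show ?thesis by blast
    qed
  qed
  then obtain q where q: "q \<in> A" and min: "\<And>a. a \<in> A \<Longrightarrow> a \<le> q \<Longrightarrow> a = q" by blast
  have sub: "sublinear_on V q" and jq: "join_bounded join V q" and le: "\<forall>v\<in>V. q v \<le> p0 v"
    and out: "\<forall>v. v \<notin> V \<longrightarrow> q v = 0"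
    using q unfolding A_def by auto
  have add: "q (v + w) = q v + q w" if "v \<in> V" "w \<in> V" for v w
  proof -
    \<comment> \<open>\<open>face q w\<close> is again a candidate and lies below \<open>q\<close>,
      so by minimality it is \<open>q\<close> on \<open>V\<close>. The value \<open>t = 1\<close> in
      its infimum then gives superadditivity.\<close>
    have "restr (face q w) \<in> A"
      using face_sublinear[OF sub V that(2)] face_join[OF sub V that(2) closed trans jq]
        face_le_self[OF sub V that(2)] le by (intro restr_A) (auto intro: order_trans)
    moreover have "restr (face q w) \<le> q"
      using face_le_self[OF sub V that(2)] out unfolding restr_def le_fun_def by auto
    ultimately have "restr (face q w) = q" by (rule min)
    then have "q v = face q w v" using that(1) unfolding restr_def by (auto dest: fun_cong[of _ _ v])
    also have "\<dots> \<le> q (v + 1 *\<^sub>R w) - 1 * q w" using face_le[OF sub V that(2,1)] zero_le_one by blast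
    finally show ?thesis using sub that unfolding sublinear_on_def by (simp add: dual_order.antisym le_diff_eq)
  qed
  have neg: "q (- v) = - q v" if "v \<in> V" for v
    using add[OF that subspace_neg[OF V that]] sublinear_on_zero[OF sub V] by simp
  have nonneg: "q (c *\<^sub>R v) = c * q v" if "v \<in> V" "c \<ge> 0" for c v
    using sub that by (simp add: sublinear_on_def)
  have scale: "q (c *\<^sub>R v) = c * q v" if "v \<in> V" for c v
  proof (cases "c \<ge> 0")
    case True
    then show ?thesis using nonneg[OF that] by blast
  next
    case False
    then have "q (- c *\<^sub>R v) = - c * q v" using nonneg[OF that, of "- c"] by simp
    moreover have "q (- (c *\<^sub>R v)) = - q (c *\<^sub>R v)" using neg V that by (simp add: subspace_scale)
    ultimately show ?thesis by simp
  qed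
  show ?thesis using that add scale le jq by blast
qed

text \<open>Lets \<open>minimal_sublinear_linear\<close> be applied to the space of bounded
  functions on which the expectation is constructed.\<close>

instantiation "fun" :: (type, real_vector) real_vector
begin

definition scaleR_fun :: "real \<Rightarrow> ('a \<Rightarrow> 'b) \<Rightarrow> 'a \<Rightarrow> 'b" where
  "scaleR_fun c f = (\<lambda>x. c *\<^sub>R f x)"

instance
  by standard (auto simp: scaleR_fun_def plus_fun_def algebra_simps)

end

section \<open>Vector lattices and Banach lattices\<close>

lemma scaleR_sup:
  fixes u v :: "'a::vector_lattice"
  assumes c: "0 \<le> c"
  shows "c *\<^sub>R sup u v = sup (c *\<^sub>R u) (c *\<^sub>R v)"
proof (cases "c = 0")
  case False
  then have c: "0 < c" using c by simp
  show ?thesis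
  proof (rule antisym)
    have "sup u v \<le> sup (c *\<^sub>R u) (c *\<^sub>R v) /\<^sub>R c"
      using c by (intro sup_least) (simp_all only: pos_le_divideR_eq sup.cobounded1 sup.cobounded2)
    then show "c *\<^sub>R sup u v \<le> sup (c *\<^sub>R u) (c *\<^sub>R v)"
      using c by (simp only: pos_le_divideR_eq)
    show "sup (c *\<^sub>R u) (c *\<^sub>R v) \<le> c *\<^sub>R sup u v"
      using c by (intro sup_least scaleR_left_mono) auto
  qed
qed simp

lemma abs_sup_diff_le:
  fixes x y z :: "'a::vector_lattice"
  shows "\<bar>sup x z - sup y z\<bar> \<le> \<bar>x - y\<bar>"
proof -
  have *: "sup x z - sup y z \<le> \<bar>x - y\<bar>" for x y z :: 'a
  proof -
    have "x - y \<le> \<bar>x - y\<bar>" by (rule abs_ge_self)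
    then have "x \<le> y + \<bar>x - y\<bar>" by (simp add: algebra_simps)
    also have "\<dots> \<le> sup y z + \<bar>x - y\<bar>" by (intro add_right_mono) simp
    finally have "x \<le> sup y z + \<bar>x - y\<bar>" .
    moreover have "z \<le> sup y z + \<bar>x - y\<bar>" by (simp add: add_increasing2)
    ultimately have "sup x z \<le> sup y z + \<bar>x - y\<bar>" by (rule sup_least)
    then show ?thesis by (simp only: diff_le_eq add.commute)
  qed
  show ?thesis
    by (rule abs_leI, rule *) (unfold minus_diff_eq abs_minus_commute[of x y], rule *)
qed

lemma norm_abs_lattice [simp]: "norm \<bar>x\<bar> = norm (x :: 'a::banach_lattice)"
  by (intro antisym lattice_norm) auto

lemma norm_mono_lattice: "0 \<le> x \<Longrightarrow> x \<le> y \<Longrightarrow> norm x \<le> norm (y :: 'a::banach_lattice)"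
  by (intro lattice_norm) auto

text \<open>Passing to positive parts gives \<open>real n *\<^sub>R sup u 0 \<le> sup e 0\<close>;
  the norm is monotone on positive vectors, so that of \<open>sup u 0\<close> must be 0.\<close>

lemma archimedean_lattice:
  fixes u e :: "'a::banach_lattice"
  assumes "\<And>n::nat. real n *\<^sub>R u \<le> e"
  shows "u \<le> 0"
proof -
  have "real n * norm (sup u 0) \<le> norm (sup e 0)" for n :: nat
  proof -
    have "real n *\<^sub>R sup u 0 = sup (real n *\<^sub>R u) 0" by (simp add: scaleR_sup)
    also have "\<dots> \<le> sup e 0" using assms[of n] by (intro sup_mono) auto
    finally have "norm (real n *\<^sub>R sup u 0) \<le> norm (sup e 0)"
      by (intro norm_mono_lattice scaleR_nonneg_nonneg) auto
    then show ?thesis by simp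
  qed
  then have "norm (sup u 0) \<le> 0"
    by (metis linorder_not_less reals_Archimedean3)
  then have "sup u 0 = 0" by simp
  then show ?thesis by (metis sup_ge1)
qed

text \<open>The positive part is Lipschitz for the norm, so the positive cone is closed.\<close>

lemma LIMSEQ_ge_lattice:
  fixes x a :: "'a::banach_lattice"
  assumes lim: "X \<longlonglongrightarrow> x" and ge: "\<And>n. N \<le> n \<Longrightarrow> a \<le> X n"
  shows "a \<le> x"
proof -
  have le: "norm (sup (a - x) 0) \<le> norm (X n - x)" if "N \<le> n" for n
  proof -
    have "sup (a - X n) 0 = 0" using ge[OF that] by (simp add: sup_absorb2)
    then have "sup (a - x) 0 = sup (a - x) 0 - sup (a - X n) 0" by simp
    then have "\<bar>sup (a - x) 0\<bar> \<le> \<bar>(a - x) - (a - X n)\<bar>" by (metis abs_sup_diff_le)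
    then show ?thesis by (intro lattice_norm) simp
  qed
  have lim0: "(\<lambda>n. norm (X n - x)) \<longlonglongrightarrow> 0"
    using lim by (simp add: LIM_zero tendsto_norm_zero)
  have "norm (sup (a - x) 0) \<le> 0"
    by (rule tendsto_lowerbound[OF lim0 eventually_sequentiallyI[OF le]]) simp_all
  then have "sup (a - x) 0 = 0" by simp
  then have "a - x \<le> 0" by (metis sup_ge1)
  then show ?thesis by simp
qed

lemma sums_ge_partial:
  fixes f :: "nat \<Rightarrow> 'a::banach_lattice"
  assumes "f sums s" "\<And>i. 0 \<le> f i"
  shows "(\<Sum>i<n. f i) \<le> s"
proof (rule LIMSEQ_ge_lattice)
  show "(\<lambda>n. \<Sum>i<n. f i) \<longlonglongrightarrow> s" using assms(1) unfolding sums_def .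
  show "(\<Sum>i<n. f i) \<le> (\<Sum>i<m. f i)" if "n \<le> m" for m
    using that assms(2) by (intro sum_mono2) auto
qed

lemma sums_le_lattice:
  fixes f :: "nat \<Rightarrow> 'a::banach_lattice"
  assumes "f sums s" "\<And>n. (\<Sum>i<n. f i) \<le> u"
  shows "s \<le> u"
proof -
  have "- u \<le> - s"
  proof (rule LIMSEQ_ge_lattice)
    show "(\<lambda>n. - (\<Sum>i<n. f i)) \<longlonglongrightarrow> - s" using assms(1) unfolding sums_def by (rule tendsto_minus)
    show "- u \<le> - (\<Sum>i<n. f i)" if "0 \<le> n" for n using assms(2)[of n] by simp
  qed
  then show ?thesis by simp
qed

section \<open>Lattice homomorphisms of ideals with a strong unit\<close>

definition ideal_of :: "'a::vector_lattice \<Rightarrow> 'a set" where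
  "ideal_of e = {v. \<exists>c. \<bar>v\<bar> \<le> c *\<^sub>R e}"

lemma ideal_ofI: "\<bar>v\<bar> \<le> c *\<^sub>R e \<Longrightarrow> v \<in> ideal_of e"
  unfolding ideal_of_def by blast

lemma ideal_ofE:
  assumes "v \<in> ideal_of e" "0 \<le> e"
  obtains c where "0 \<le> c" "\<bar>v\<bar> \<le> c *\<^sub>R e"
proof -
  obtain c where "\<bar>v\<bar> \<le> c *\<^sub>R e" using assms unfolding ideal_of_def by blast
  also have "\<dots> \<le> \<bar>c\<bar> *\<^sub>R e" using assms(2) by (intro scaleR_right_mono) auto
  finally show ?thesis using that[of "\<bar>c\<bar>"] by simp
qed

lemma ideal_of_solid: "v \<in> ideal_of e \<Longrightarrow> \<bar>u\<bar> \<le> \<bar>v\<bar> \<Longrightarrow> u \<in> ideal_of e"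
  unfolding ideal_of_def by (blast intro: order_trans)

lemma subspace_ideal_of:
  assumes e: "0 \<le> e"
  shows "subspace (ideal_of e)"
  unfolding subspace_def
proof (intro conjI ballI allI)
  show "0 \<in> ideal_of e" by (rule ideal_ofI[of _ 0]) simp
  fix u v assume "u \<in> ideal_of e" "v \<in> ideal_of e"
  then obtain c d where "\<bar>u\<bar> \<le> c *\<^sub>R e" "\<bar>v\<bar> \<le> d *\<^sub>R e" unfolding ideal_of_def by blast
  then have "\<bar>u + v\<bar> \<le> (c + d) *\<^sub>R e"
    unfolding scaleR_add_left by (meson abs_triangle_ineq add_mono order_trans)
  then show "u + v \<in> ideal_of e" by (rule ideal_ofI)
next
  fix c :: real and u assume "u \<in> ideal_of e"
  then obtain d where d: "\<bar>u\<bar> \<le> d *\<^sub>R e" unfolding ideal_of_def by blast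
  have pos: "\<bar>k *\<^sub>R u\<bar> \<le> (k * d) *\<^sub>R e" if k: "0 \<le> k" for k
  proof -
    have "k *\<^sub>R u \<le> k *\<^sub>R (d *\<^sub>R e)"
      using order_trans[OF abs_ge_self d] k by (rule scaleR_left_mono)
    moreover have "k *\<^sub>R (- u) \<le> k *\<^sub>R (d *\<^sub>R e)"
      using order_trans[OF abs_ge_minus_self d] k by (rule scaleR_left_mono)
    ultimately show ?thesis by (intro abs_leI) simp_all
  qed
  show "c *\<^sub>R u \<in> ideal_of e"
  proof (cases "0 \<le> c")
    case True
    then show ?thesis by (rule ideal_ofI[OF pos])
  next
    case False
    then have "\<bar>(- c) *\<^sub>R u\<bar> \<le> (- c * d) *\<^sub>R e" by (intro pos) simp
    then have "\<bar>c *\<^sub>R u\<bar> \<le> (- c * d) *\<^sub>R e" by (metis abs_minus_cancel scaleR_minus_left)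
    then show ?thesis by (rule ideal_ofI)
  qed
qed

lemma ideal_of_self: "0 \<le> e \<Longrightarrow> e \<in> ideal_of e"
  by (rule ideal_ofI[of _ 1]) simp

lemma abs_in_ideal_of: "v \<in> ideal_of e \<Longrightarrow> \<bar>v\<bar> \<in> ideal_of e"
  by (erule ideal_of_solid) simp

lemma sup_eq_abs: "sup u v = (1 / 2) *\<^sub>R (u + v + \<bar>u - v\<bar>)" for u v :: "'a::vector_lattice"
proof -
  have "\<bar>u - v\<bar> = sup (u - v) (- (u - v))" by (rule abs_lattice)
  then have "u + v + \<bar>u - v\<bar> = sup (u + u) (v + v)"
    by (simp add: add_sup_distrib_left algebra_simps)
  also have "\<dots> = 2 *\<^sub>R sup u v" by (simp only: scaleR_2[symmetric] scaleR_sup zero_le_numeral)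
  finally show ?thesis by simp
qed

lemma sup_in_ideal_of:
  assumes "0 \<le> e" "u \<in> ideal_of e" "v \<in> ideal_of e"
  shows "sup u v \<in> ideal_of e"
  unfolding sup_eq_abs
  by (intro subspace_scale subspace_add subspace_diff abs_in_ideal_of subspace_ideal_of assms)

definition lattice_hom_on :: "'a::vector_lattice \<Rightarrow> ('a \<Rightarrow> real) \<Rightarrow> bool" where
  "lattice_hom_on e \<xi> \<longleftrightarrow>
     (\<forall>u\<in>ideal_of e. \<forall>v\<in>ideal_of e. \<xi> (u + v) = \<xi> u + \<xi> v) \<and>
     (\<forall>c. \<forall>v\<in>ideal_of e. \<xi> (c *\<^sub>R v) = c * \<xi> v) \<and>
     (\<forall>u\<in>ideal_of e. \<forall>v\<in>ideal_of e. \<xi> (sup u v) = max (\<xi> u) (\<xi> v)) \<and> \<xi> e = 1"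

text \<open>The gauge \<open>p v = inf {c. v \<le> c e}\<close> is the maximum of \<open>v\<close> over all lattice homomorphisms.\<close>

lemma lattice_hom_separates:
  fixes e u :: "'a::banach_lattice"
  assumes e: "0 \<le> e" and u: "u \<in> ideal_of e" and nu: "\<not> u \<le> 0"
  shows "\<exists>\<xi>. lattice_hom_on e \<xi> \<and> 0 < \<xi> u"
proof -
  let ?V = "ideal_of e"
  have V: "subspace ?V" using e by (rule subspace_ideal_of)
  have e0: "e \<noteq> 0"
  proof
    assume "e = 0"
    then have "\<bar>u\<bar> \<le> 0" using u unfolding ideal_of_def by simp
    then show False using nu by simp
  qed
  define p where "p v = Inf {c. v \<le> c *\<^sub>R e}" for v
  have scale_e: "0 \<le> c" if "0 \<le> c *\<^sub>R e" for c
  proof (rule ccontr)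
    assume "\<not> 0 \<le> c"
    then have c: "0 < - c" by simp
    have "(- c) *\<^sub>R e \<le> 0" using that by simp
    then have "(- c) *\<^sub>R e \<le> (- c) *\<^sub>R 0" by simp
    then have "e \<le> 0" using scaleR_le_cancel_left_pos[OF c] by blast
    then show False using e0 e by simp
  qed
  have p_iff: "v \<le> c *\<^sub>R e \<longleftrightarrow> p v \<le> c" if v: "v \<in> ?V" for v c
  proof -
    obtain d where d: "0 \<le> d" "\<bar>v\<bar> \<le> d *\<^sub>R e" by (rule ideal_ofE[OF v e])
    have bdd: "bdd_below {c. v \<le> c *\<^sub>R e}"
    proof (rule bdd_belowI)
      fix c assume c: "c \<in> {c. v \<le> c *\<^sub>R e}"
      have "- v \<le> d *\<^sub>R e" using d abs_ge_minus_self order_trans by blast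
      then have "v + - v \<le> c *\<^sub>R e + d *\<^sub>R e" using c by (intro add_mono) auto
      then have "0 \<le> (c + d) *\<^sub>R e" by (simp add: scaleR_add_left)
      then show "- d \<le> c" using scale_e by fastforce
    qed
    have ne: "{c. v \<le> c *\<^sub>R e} \<noteq> {}" using d abs_ge_self order_trans by blast
    \<comment> \<open>The infimum is attained by the Archimedean property: every positive integer
      multiple of the excess of \<open>v\<close> over \<open>p v *\<^sub>R e\<close> is at most
      \<open>e\<close>.\<close>
    have attained: "v \<le> p v *\<^sub>R e"
    proof -
      have "real n *\<^sub>R (v - p v *\<^sub>R e) \<le> e" for n
      proof (cases "n = 0")
        case False
        have "p v < p v + 1 / real n" using False by simp
        then obtain c where c: "v \<le> c *\<^sub>R e" "c < p v + 1 / real n"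
          using cInf_lessD[OF ne] unfolding p_def by blast
        have "v \<le> (p v + 1 / real n) *\<^sub>R e"
          using c e by (intro order_trans[OF c(1)] scaleR_right_mono) auto
        then have "v - p v *\<^sub>R e \<le> (1 / real n) *\<^sub>R e" by (simp add: algebra_simps)
        then have "real n *\<^sub>R (v - p v *\<^sub>R e) \<le> real n *\<^sub>R ((1 / real n) *\<^sub>R e)"
          by (intro scaleR_left_mono) auto
        then show ?thesis using False by simp
      qed (use e in simp)
      then have "v - p v *\<^sub>R e \<le> 0" by (rule archimedean_lattice)
      then show ?thesis by simp
    qed
    show ?thesis
    proof
      assume "v \<le> c *\<^sub>R e"
      then show "p v \<le> c" unfolding p_def using bdd by (intro cInf_lower) auto
    next
      assume "p v \<le> c"
      then show "v \<le> c *\<^sub>R e" using attained e by (meson order_trans scaleR_right_mono)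
    qed
  qed
  have pV: "v \<le> p v *\<^sub>R e" if "v \<in> ?V" for v using p_iff[OF that] by blast
  have p_scale_le: "p (c *\<^sub>R v) \<le> c * p v" if "0 \<le> c" "v \<in> ?V" for c v
  proof -
    have "c *\<^sub>R v \<le> c *\<^sub>R (p v *\<^sub>R e)" using that pV by (intro scaleR_left_mono) auto
    then have "c *\<^sub>R v \<le> (c * p v) *\<^sub>R e" by simp
    then show ?thesis by (rule iffD1[OF p_iff[OF subspace_scale[OF V that(2)]]])
  qed
  have p0: "p 0 = 0"
  proof (rule antisym)
    show "p 0 \<le> 0" by (rule iffD1[OF p_iff[OF subspace_0[OF V]]]) simp
    show "0 \<le> p 0" by (rule scale_e[OF pV[OF subspace_0[OF V]]])
  qed
  have sub: "sublinear_on ?V p"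
    unfolding sublinear_on_def
  proof (intro conjI ballI allI impI)
    fix v w assume vw: "v \<in> ?V" "w \<in> ?V"
    have "v + w \<le> (p v + p w) *\<^sub>R e"
      unfolding scaleR_add_left using vw pV by (intro add_mono)
    then show "p (v + w) \<le> p v + p w" by (rule iffD1[OF p_iff[OF subspace_add[OF V vw]]])
  next
    fix c :: real and v assume c: "0 \<le> c" and v: "v \<in> ?V"
    show "p (c *\<^sub>R v) = c * p v"
    proof (cases "c = 0")
      case False
      then have "p (inverse c *\<^sub>R (c *\<^sub>R v)) \<le> inverse c * p (c *\<^sub>R v)"
        using c v V by (intro p_scale_le) (auto simp: subspace_scale)
      then have "c * p v \<le> p (c *\<^sub>R v)" using False c by (simp add: field_simps)
      then show ?thesis using p_scale_le[OF c v] by simp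
    qed (simp add: p0)
  qed
  have join: "join_bounded sup ?V p"
    unfolding join_bounded_def
  proof (intro ballI)
    fix v w assume vw: "v \<in> ?V" "w \<in> ?V"
    have "sup v w \<le> max (p v) (p w) *\<^sub>R e"
      by (intro sup_least iffD2[OF p_iff] vw) simp_all
    then show "p (sup v w) \<le> max (p v) (p w)" by (rule iffD1[OF p_iff[OF sup_in_ideal_of[OF e vw]]])
  qed
  obtain q where q: "\<And>v w. v \<in> ?V \<Longrightarrow> w \<in> ?V \<Longrightarrow> q (v + w) = q v + q w"
    "\<And>c v. v \<in> ?V \<Longrightarrow> q (c *\<^sub>R v) = c * q v"
    "\<And>v. v \<in> ?V \<Longrightarrow> q v \<le> face p u v" "join_bounded sup ?V q"
  \<comment> \<open>Starting from \<open>face p u\<close> instead of \<open>p\<close> forces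
    \<open>q u = p u\<close>, which is positive because \<open>u \<le> 0\<close> fails.\<close>
  proof (rule minimal_sublinear_linear[of ?V "face p u" sup])
    show "sublinear_on ?V (face p u)" by (rule face_sublinear[OF sub V u])
    show "subspace ?V" by (rule V)
    show closed: "sup v w \<in> ?V" if "v \<in> ?V" "w \<in> ?V" for v w
      using e that by (rule sup_in_ideal_of)
    show trans: "sup (v + z) (w + z) = sup v w + z" for v w z :: 'a
      by (simp add: add_sup_distrib_right)
    show "join_bounded sup ?V (face p u)" by (rule face_join[OF sub V u closed trans join])
  next
    fix q assume "\<And>v w. v \<in> ?V \<Longrightarrow> w \<in> ?V \<Longrightarrow> q (v + w) = q v + q w"
      "\<And>c v. v \<in> ?V \<Longrightarrow> q (c *\<^sub>R v) = c * q v"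
      "\<And>v. v \<in> ?V \<Longrightarrow> q v \<le> face p u v" "join_bounded sup ?V q"
    then show thesis by (rule that)
  qed
  have qp: "q v \<le> p v" if "v \<in> ?V" for v
    using q(3)[OF that] face_le_self[OF sub V u that] by linarith
  have neg: "q (- v) = - q v" if "v \<in> ?V" for v using q(2)[OF that, of "- 1"] by simp
  have mono: "q v \<le> q w" if vw: "v \<in> ?V" "w \<in> ?V" "v \<le> w" for v w
  proof -
    have vw': "v - w \<in> ?V" using vw V by (simp add: subspace_diff)
    have "q (v - w) \<le> 0" using qp[OF vw'] p_iff[OF vw', of 0] vw by simp
    moreover have "q v = q ((v - w) + w)" by simp
    ultimately show ?thesis using q(1)[OF vw' vw(2)] by linarith
  qed
  have "q (- u) \<le> p (- u + 1 *\<^sub>R u) - 1 * p u"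
    using q(3)[of "- u"] face_le[OF sub V u, of "- u" 1] u V by (simp add: subspace_neg)
  then have "p u \<le> q u" using neg[OF u] p0 by simp
  moreover have "0 < p u" using p_iff[OF u, of 0] nu by simp
  ultimately have "0 < q u" by simp
  have eV: "e \<in> ?V" using e by (rule ideal_of_self)
  have "p e \<le> 1" using p_iff[OF eV, of 1] by simp
  moreover have "p (- e) \<le> - 1" using p_iff[of "- e" "- 1"] eV V by (simp add: subspace_neg)
  ultimately have "q e = 1" using qp[OF eV] qp[of "- e"] eV neg[OF eV] V by (simp add: subspace_neg)
  moreover have "q (sup v w) = max (q v) (q w)" if "v \<in> ?V" "w \<in> ?V" for v w
    using q(4) that mono[OF that(1) sup_in_ideal_of[OF e that]] mono[OF that(2) sup_in_ideal_of[OF e that]]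
    unfolding join_bounded_def by (auto intro!: antisym)
  ultimately show ?thesis using q \<open>0 < q u\<close> unfolding lattice_hom_on_def by blast
qed

section \<open>Representing a positive functional by an expectation\<close>

text \<open>Outside the set of lattice homomorphisms the representing functions are \<open>0\<close>; there also the
  strong unit is represented by \<open>0\<close>.\<close>

locale lattice_representation = expectation E
  for E :: "(('a::banach_lattice \<Rightarrow> real) \<Rightarrow> real) \<Rightarrow> real" +
  fixes e :: 'a and f :: "'a \<Rightarrow> real" and h :: "'a \<Rightarrow> ('a \<Rightarrow> real) \<Rightarrow> real"
  assumes e_nonneg: "0 \<le> e"
    and h_bdd: "v \<in> ideal_of e \<Longrightarrow> bdd_fun (h v)"
    and E_h: "v \<in> ideal_of e \<Longrightarrow> E (h v) = f v"
    and h_add: "u \<in> ideal_of e \<Longrightarrow> v \<in> ideal_of e \<Longrightarrow> h (u + v) \<xi> = h u \<xi> + h v \<xi>"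
    and h_scale: "v \<in> ideal_of e \<Longrightarrow> h (c *\<^sub>R v) \<xi> = c * h v \<xi>"
    and h_sup: "u \<in> ideal_of e \<Longrightarrow> v \<in> ideal_of e \<Longrightarrow> h (sup u v) \<xi> = max (h u \<xi>) (h v \<xi>)"
    and h_unit: "h e \<xi> = 1 \<or> (\<forall>v\<in>ideal_of e. h v \<xi> = 0)"

text \<open>Since homomorphisms separate, evaluation of vectors at them reflects the order. So
  \<open>p g\<close>, the infimum of \<open>f\<close> over the vectors whose evaluations majorise
  \<open>g\<close>, is a finite sublinear upper integral, and every linear functional below it is
  positive and extends \<open>f\<close>.\<close>

lemma exists_lattice_representation:
  fixes e :: "'a::banach_lattice"
  assumes e: "0 \<le> e"
    and f_add: "\<And>u v. u \<in> ideal_of e \<Longrightarrow> v \<in> ideal_of e \<Longrightarrow> f (u + v) = f u + f v"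
    and f_scale: "\<And>c v. v \<in> ideal_of e \<Longrightarrow> f (c *\<^sub>R v) = c * f v"
    and f_nonneg: "\<And>v. v \<in> ideal_of e \<Longrightarrow> 0 \<le> v \<Longrightarrow> 0 \<le> f v"
  shows "\<exists>E h. lattice_representation E e f h"
proof -
  let ?V = "ideal_of e"
  have V: "subspace ?V" using e by (rule subspace_ideal_of)
  have eV: "e \<in> ?V" using e by (rule ideal_of_self)
  define \<Omega> where "\<Omega> = {\<xi>. lattice_hom_on e \<xi>}"
  have \<Omega>: "\<xi> (u + v) = \<xi> u + \<xi> v" "\<xi> (c *\<^sub>R v) = c * \<xi> v" "\<xi> (sup u v) = max (\<xi> u) (\<xi> v)" "\<xi> e = 1"
    if "\<xi> \<in> \<Omega>" "u \<in> ?V" "v \<in> ?V" for \<xi> u v c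
    using that unfolding \<Omega>_def lattice_hom_on_def by auto
  have sep: "0 \<le> v" if sv: "v \<in> ?V" "\<And>\<xi>. \<xi> \<in> \<Omega> \<Longrightarrow> 0 \<le> \<xi> v" for v
  proof (rule ccontr)
    assume "\<not> 0 \<le> v"
    then have "\<not> - v \<le> 0" by simp
    then obtain \<xi> where \<xi>: "\<xi> \<in> \<Omega>" "0 < \<xi> (- v)"
      using lattice_hom_separates[OF e subspace_neg[OF V sv(1)]] unfolding \<Omega>_def by auto
    moreover have "\<xi> (- v) = - \<xi> v" using \<Omega>(2)[OF \<xi>(1) sv(1) sv(1), of "- 1"] by simp
    ultimately show False using sv(2)[of \<xi>] by simp
  qed
  define F where "F g = {f v |v. v \<in> ?V \<and> (\<forall>\<xi>\<in>\<Omega>. g \<xi> \<le> \<xi> v)}" for g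
  define p where "p g = Inf (F g)" for g
  let ?B = "{g :: ('a \<Rightarrow> real) \<Rightarrow> real. bdd_fun g}"
  have B: "subspace ?B"
    unfolding subspace_def zero_fun_def plus_fun_def scaleR_fun_def by auto
  have ne: "F g \<noteq> {}" if g: "g \<in> ?B" for g
  proof -
    obtain c where c: "\<And>\<xi>. \<bar>g \<xi>\<bar> \<le> c" using g unfolding bdd_fun_def by auto
    have "g \<xi> \<le> \<xi> (c *\<^sub>R e)" if "\<xi> \<in> \<Omega>" for \<xi>
      using c[of \<xi>] \<Omega>[OF that eV eV] by (simp add: abs_le_iff)
    then have "f (c *\<^sub>R e) \<in> F g" unfolding F_def using eV V by (auto simp: subspace_scale)
    then show ?thesis by blast
  qed
  have bdd: "bdd_below (F g)" if g: "g \<in> ?B" for g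
  proof -
    obtain c where c: "\<And>\<xi>. \<bar>g \<xi>\<bar> \<le> c" using g unfolding bdd_fun_def by auto
    show ?thesis
    proof (rule bdd_belowI)
      fix a assume "a \<in> F g"
      then obtain v where v: "a = f v" "v \<in> ?V" "\<And>\<xi>. \<xi> \<in> \<Omega> \<Longrightarrow> g \<xi> \<le> \<xi> v" unfolding F_def by blast
      have ce: "c *\<^sub>R e \<in> ?V" using eV V by (simp add: subspace_scale)
      have "0 \<le> v + c *\<^sub>R e"
      proof (rule sep)
        show "v + c *\<^sub>R e \<in> ?V" using v ce V by (simp add: subspace_add)
        fix \<xi> assume \<xi>: "\<xi> \<in> \<Omega>"
        have "\<xi> (v + c *\<^sub>R e) = \<xi> v + c" using \<Omega>[OF \<xi>] v ce eV by simp
        then show "0 \<le> \<xi> (v + c *\<^sub>R e)" using v(3)[OF \<xi>] c[of \<xi>] by (simp add: abs_le_iff)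
      qed
      then have "0 \<le> f (v + c *\<^sub>R e)" using v ce V by (intro f_nonneg) (auto simp: subspace_add)
      then show "- (c * f e) \<le> a" using v ce eV f_add f_scale by simp
    qed
  qed
  have p_le: "p g \<le> f v" if "g \<in> ?B" "v \<in> ?V" "\<And>\<xi>. \<xi> \<in> \<Omega> \<Longrightarrow> g \<xi> \<le> \<xi> v" for g v
    unfolding p_def using that by (intro cInf_lower bdd) (auto simp: F_def)
  have le_p: "c \<le> p g" if "g \<in> ?B" "\<And>v. v \<in> ?V \<Longrightarrow> (\<And>\<xi>. \<xi> \<in> \<Omega> \<Longrightarrow> g \<xi> \<le> \<xi> v) \<Longrightarrow> c \<le> f v" for c g
    unfolding p_def using that by (intro cInf_greatest ne) (auto simp: F_def)
  have p_scale_le: "p (c *\<^sub>R g) \<le> c * p g" if c: "0 < c" and g: "g \<in> ?B" for c g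
  proof -
    have "p (c *\<^sub>R g) / c \<le> p g"
    proof (rule le_p[OF g])
      fix v assume v: "v \<in> ?V" "\<And>\<xi>. \<xi> \<in> \<Omega> \<Longrightarrow> g \<xi> \<le> \<xi> v"
      have "p (c *\<^sub>R g) \<le> f (c *\<^sub>R v)"
      proof (rule p_le[OF subspace_scale[OF B g] subspace_scale[OF V v(1)]])
        fix \<xi> assume \<xi>: "\<xi> \<in> \<Omega>"
        show "(c *\<^sub>R g) \<xi> \<le> \<xi> (c *\<^sub>R v)"
          unfolding scaleR_fun_def \<Omega>(2)[OF \<xi> v(1) v(1)] real_scaleR_def
          using v(2)[OF \<xi>] c by (intro mult_left_mono) auto
      qed
      then show "p (c *\<^sub>R g) / c \<le> f v" using f_scale[OF v(1)] c by (simp add: field_simps)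
    qed
    then show ?thesis using c by (simp add: field_simps)
  qed
  have p_zero: "p 0 = 0"
  proof (rule antisym)
    have f0: "f 0 = 0" using f_scale[OF eV, of 0] by simp
    have \<xi>0: "\<xi> 0 = 0" if "\<xi> \<in> \<Omega>" for \<xi> using \<Omega>(2)[OF that eV eV, of 0] by simp
    have "p 0 \<le> f 0"
      by (rule p_le[OF subspace_0[OF B] subspace_0[OF V]]) (simp add: \<xi>0)
    then show "p 0 \<le> 0" using f0 by simp
    show "0 \<le> p 0"
    proof (rule le_p[OF subspace_0[OF B]])
      fix v assume v: "v \<in> ?V" "\<And>\<xi>. \<xi> \<in> \<Omega> \<Longrightarrow> (0 :: ('a \<Rightarrow> real) \<Rightarrow> real) \<xi> \<le> \<xi> v"
      show "0 \<le> f v" using v by (intro f_nonneg sep) auto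
    qed
  qed
  have sub: "sublinear_on ?B p"
    unfolding sublinear_on_def
  proof (intro conjI ballI allI impI)
    fix g k assume gk: "g \<in> ?B" "k \<in> ?B"
    have "p (g + k) - p k \<le> p g"
    proof (rule le_p[OF gk(1)])
      fix v assume v: "v \<in> ?V" "\<And>\<xi>. \<xi> \<in> \<Omega> \<Longrightarrow> g \<xi> \<le> \<xi> v"
      have "p (g + k) - f v \<le> p k"
      proof (rule le_p[OF gk(2)])
        fix w assume w: "w \<in> ?V" "\<And>\<xi>. \<xi> \<in> \<Omega> \<Longrightarrow> k \<xi> \<le> \<xi> w"
        have "p (g + k) \<le> f (v + w)"
        proof (rule p_le[OF subspace_add[OF B gk] subspace_add[OF V v(1) w(1)]])
          fix \<xi> assume \<xi>: "\<xi> \<in> \<Omega>"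
          show "(g + k) \<xi> \<le> \<xi> (v + w)"
            unfolding plus_fun_def \<Omega>(1)[OF \<xi> v(1) w(1)] using v(2)[OF \<xi>] w(2)[OF \<xi>] by (rule add_mono)
        qed
        then show "p (g + k) - f v \<le> f w" using f_add[OF v(1) w(1)] by simp
      qed
      then show "p (g + k) - p k \<le> f v" by simp
    qed
    then show "p (g + k) \<le> p g + p k" by simp
  next
    fix c :: real and g assume c: "0 \<le> c" and g: "g \<in> ?B"
    show "p (c *\<^sub>R g) = c * p g"
    proof (cases "c = 0")
      case False
      then have c: "0 < c" using c by simp
      have "p (inverse c *\<^sub>R (c *\<^sub>R g)) \<le> inverse c * p (c *\<^sub>R g)"
        using c subspace_scale[OF B g, of c] by (intro p_scale_le) auto
      then have "c * p g \<le> p (c *\<^sub>R g)" using c by (simp add: field_simps)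
      then show ?thesis using p_scale_le[OF c g] by simp
    qed (simp add: p_zero)
  qed
  obtain E where E: "\<And>g k. g \<in> ?B \<Longrightarrow> k \<in> ?B \<Longrightarrow> E (g + k) = E g + E k"
    "\<And>c g. g \<in> ?B \<Longrightarrow> E (c *\<^sub>R g) = c * E g" "\<And>g. g \<in> ?B \<Longrightarrow> E g \<le> p g"
  proof (rule minimal_sublinear_linear[OF sub B, of "\<lambda>g k. g"], goal_cases)
    case (4 q)
    from 4(2-4) show ?case by (rule that)
  qed (auto simp: join_bounded_def)
  define h where "h v \<xi> = (if \<xi> \<in> \<Omega> then \<xi> v else 0)" for v and \<xi> :: "'a \<Rightarrow> real"
  have h_mono: "\<xi> u \<le> \<xi> v" if "u \<in> ?V" "v \<in> ?V" "u \<le> v" "\<xi> \<in> \<Omega>" for \<xi> u v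
    using \<Omega>(3)[OF that(4,1,2)] that(3) by (simp add: sup_absorb2)
  have h_bdd: "bdd_fun (h v)" if v: "v \<in> ?V" for v
  proof -
    obtain c where c: "0 \<le> c" "\<bar>v\<bar> \<le> c *\<^sub>R e" by (rule ideal_ofE[OF v e])
    have "\<bar>h v \<xi>\<bar> \<le> c" for \<xi>
    proof (cases "\<xi> \<in> \<Omega>")
      case True
      have "v \<le> c *\<^sub>R e" "- v \<le> c *\<^sub>R e"
        using c abs_ge_self[of v] abs_ge_minus_self[of v] order_trans by blast+
      then have "\<xi> v \<le> \<xi> (c *\<^sub>R e)" "\<xi> ((- 1) *\<^sub>R v) \<le> \<xi> (c *\<^sub>R e)"
        using True v eV V by (auto intro!: h_mono simp: subspace_scale subspace_neg)
      then show ?thesis using True \<Omega>(2)[OF True v v, of "- 1"] \<Omega>(2)[OF True eV eV, of c] \<Omega>(4)[OF True eV eV]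
        unfolding h_def by simp
    qed (use c in \<open>simp add: h_def\<close>)
    then show ?thesis by (rule bdd_funI)
  qed
  have "lattice_representation E e f h"
  proof
    fix g k :: "('a \<Rightarrow> real) \<Rightarrow> real"
    assume gk: "bdd_fun g" "bdd_fun k"
    then show "E (\<lambda>\<xi>. g \<xi> + k \<xi>) = E g + E k" using E(1)[of g k] by (simp add: plus_fun_def)
  next
    fix g :: "('a \<Rightarrow> real) \<Rightarrow> real" and c
    assume "bdd_fun g"
    then show "E (\<lambda>\<xi>. c * g \<xi>) = c * E g" using E(2)[of g c] by (simp add: scaleR_fun_def)
  next
    fix g :: "('a \<Rightarrow> real) \<Rightarrow> real"
    assume g: "bdd_fun g" "\<And>\<xi>. 0 \<le> g \<xi>"
    have gB: "- 1 *\<^sub>R g \<in> ?B" using g subspace_scale[OF B, of g "- 1"] by simp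
    have \<xi>0: "\<xi> 0 = 0" if "\<xi> \<in> \<Omega>" for \<xi> using \<Omega>(2)[OF that eV eV, of 0] by simp
    \<comment> \<open>The zero vector is among the majorants of \<open>- g\<close>.\<close>
    have "E (- 1 *\<^sub>R g) \<le> p (- 1 *\<^sub>R g)" using gB by (rule E(3))
    also have "\<dots> \<le> f 0"
    proof (rule p_le[OF gB subspace_0[OF V]])
      show "(- 1 *\<^sub>R g) \<xi> \<le> \<xi> 0" if "\<xi> \<in> \<Omega>" for \<xi>
        using g(2)[of \<xi>] \<xi>0[OF that] unfolding scaleR_fun_def by simp
    qed
    also have "f 0 = 0" using f_scale[OF eV, of 0] by simp
    finally show "0 \<le> E g" using E(2)[of g "- 1"] g by simp
  next
    show "0 \<le> e" by (rule e)
    fix v assume v: "v \<in> ?V"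
    show "bdd_fun (h v)" using v by (rule h_bdd)
    have le: "E (h w) \<le> f w" if "w \<in> ?V" for w
    proof -
      have "E (h w) \<le> p (h w)" using h_bdd[OF that] by (intro E(3)) simp
      also have "\<dots> \<le> f w" using h_bdd[OF that] that by (intro p_le) (simp_all add: h_def)
      finally show ?thesis .
    qed
    have "h (- 1 *\<^sub>R v) = - 1 *\<^sub>R h v"
      using \<Omega>(2)[OF _ v v, of _ "- 1"] unfolding h_def[abs_def] scaleR_fun_def
      by (intro ext) (simp del: scaleR_minus_left)
    then have "- E (h v) \<le> - f v"
      using le[OF subspace_scale[OF V v, of "- 1"]] E(2)[of "h v" "- 1"] h_bdd[OF v] f_scale[OF v, of "- 1"]
      by (simp del: scaleR_minus_left)
    then show "E (h v) = f v" using le[OF v] by simp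
  next
    fix u v \<xi> assume "u \<in> ?V" "v \<in> ?V"
    then show "h (u + v) \<xi> = h u \<xi> + h v \<xi>" "h (sup u v) \<xi> = max (h u \<xi>) (h v \<xi>)"
      using \<Omega> unfolding h_def by auto
  next
    fix v c \<xi> assume "v \<in> ?V"
    then show "h (c *\<^sub>R v) \<xi> = c * h v \<xi>" using \<Omega> unfolding h_def by auto
  next
    show "h e \<xi> = 1 \<or> (\<forall>v\<in>?V. h v \<xi> = 0)" for \<xi>
      using \<Omega>(4)[OF _ eV eV] unfolding h_def by auto
  qed
  then show ?thesis by blast
qed

section \<open>Vanishing double sequences\<close>

context expectation
begin

text \<open>A finite form of convergence to 0 almost everywhere: \<open>g\<close> ranges over the
  bounded functions below the minimum of 1 and the maximum of \<open>\<bar>z n m\<bar>\<close> over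
  a finite square, and the bound does not depend on \<open>M\<close>.\<close>

definition vanishing :: "(nat \<Rightarrow> nat \<Rightarrow> 'w \<Rightarrow> real) \<Rightarrow> bool" where
  "vanishing z \<longleftrightarrow> (\<forall>\<epsilon>>0. \<exists>N. \<forall>M g. bdd_fun g \<and>
    (\<forall>\<xi>. g \<xi> \<le> 1 \<and> (\<exists>n\<in>{N..M}. \<exists>m\<in>{N..M}. g \<xi> \<le> \<bar>z n m \<xi>\<bar>)) \<longrightarrow> E g \<le> \<epsilon>)"

text \<open>All four sequences are compared with compensators at one common \<open>p\<close>. As
  \<open>a1\<close>, \<open>a3\<close> share \<open>b1\<close> and \<open>a2\<close>,
  \<open>a4\<close> share \<open>b2\<close>, the compensators cancel; the four errors, capped at 1,
  get \<open>\<epsilon> / 4\<close> each.\<close>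

lemma tracks_imp_vanishing:
  assumes t: "tracks a1 b1" "tracks a2 b2" "tracks a3 b1" "tracks a4 b2"
    and z: "\<And>n m \<xi>. \<bar>z n m \<xi>\<bar> \<le> \<bar>(a1 n \<xi> - a2 n \<xi>) - (a3 m \<xi> - a4 m \<xi>)\<bar>"
  shows "vanishing z"
  unfolding vanishing_def
proof (intro allI impI)
  fix \<epsilon> :: real assume "0 < \<epsilon>"
  then have \<epsilon>: "0 < \<epsilon> / 4" by simp
  let ?Q = "\<lambda>a b p N. \<forall>M h. bdd_fun h \<and>
    (\<forall>\<xi>. h \<xi> \<le> 1 \<and> (\<exists>n\<in>{N..M}. h \<xi> \<le> \<bar>a n \<xi> - b p \<xi>\<bar>)) \<longrightarrow> E h \<le> \<epsilon> / 4"
  have ev: "\<exists>N0. \<forall>p\<ge>N0. \<exists>N. ?Q a b p N" if "tracks a b" for a b :: "nat \<Rightarrow> 'w \<Rightarrow> real"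
    using that \<epsilon> unfolding tracks_def by blast
  obtain P1 where P1: "\<And>p. P1 \<le> p \<Longrightarrow> \<exists>N. ?Q a1 b1 p N" using ev[OF t(1)] by blast
  obtain P2 where P2: "\<And>p. P2 \<le> p \<Longrightarrow> \<exists>N. ?Q a2 b2 p N" using ev[OF t(2)] by blast
  obtain P3 where P3: "\<And>p. P3 \<le> p \<Longrightarrow> \<exists>N. ?Q a3 b1 p N" using ev[OF t(3)] by blast
  obtain P4 where P4: "\<And>p. P4 \<le> p \<Longrightarrow> \<exists>N. ?Q a4 b2 p N" using ev[OF t(4)] by blast
  define p where "p = P1 + P2 + P3 + P4"
  have p: "P1 \<le> p" "P2 \<le> p" "P3 \<le> p" "P4 \<le> p" unfolding p_def by auto
  obtain N1 where N1: "?Q a1 b1 p N1" using P1[OF p(1)] by blast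
  obtain N2 where N2: "?Q a2 b2 p N2" using P2[OF p(2)] by blast
  obtain N3 where N3: "?Q a3 b1 p N3" using P3[OF p(3)] by blast
  obtain N4 where N4: "?Q a4 b2 p N4" using P4[OF p(4)] by blast
  define N where "N = N1 + N2 + N3 + N4"
  \<comment> \<open>The index \<open>\<nu> \<xi>\<close> may depend on the point in any way, because
    \<open>E\<close> accepts every bounded function.\<close>
  have piece: "E (\<lambda>\<xi>. min 1 \<bar>a (\<nu> \<xi>) \<xi> - b p \<xi>\<bar>) \<le> \<epsilon> / 4"
      "bdd_fun (\<lambda>\<xi>. min 1 \<bar>a (\<nu> \<xi>) \<xi> - b p \<xi>\<bar>)"
    if "?Q a b p N'" "N' \<le> N" "\<And>\<xi>. \<nu> \<xi> \<in> {N..M}" for a b N' M and \<nu> :: "'w \<Rightarrow> nat"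
  proof -
    show bdd: "bdd_fun (\<lambda>\<xi>. min 1 \<bar>a (\<nu> \<xi>) \<xi> - b p \<xi>\<bar>)" by (rule bdd_funI[of _ 1]) auto
    have "\<exists>n\<in>{N'..M}. min 1 \<bar>a (\<nu> \<xi>) \<xi> - b p \<xi>\<bar> \<le> \<bar>a n \<xi> - b p \<xi>\<bar>" for \<xi>
      using that(2) that(3)[of \<xi>] by (intro bexI[of _ "\<nu> \<xi>"]) auto
    then show "E (\<lambda>\<xi>. min 1 \<bar>a (\<nu> \<xi>) \<xi> - b p \<xi>\<bar>) \<le> \<epsilon> / 4"
      using that(1)[rule_format, of "\<lambda>\<xi>. min 1 \<bar>a (\<nu> \<xi>) \<xi> - b p \<xi>\<bar>" M] bdd by auto
  qed
  show "\<exists>N. \<forall>M g. bdd_fun g \<and>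
    (\<forall>\<xi>. g \<xi> \<le> 1 \<and> (\<exists>n\<in>{N..M}. \<exists>m\<in>{N..M}. g \<xi> \<le> \<bar>z n m \<xi>\<bar>)) \<longrightarrow> E g \<le> \<epsilon>"
  proof (rule exI[of _ N], intro allI impI, elim conjE)
    fix M g assume g: "bdd_fun g"
      and gz: "\<forall>\<xi>. g \<xi> \<le> 1 \<and> (\<exists>n\<in>{N..M}. \<exists>m\<in>{N..M}. g \<xi> \<le> \<bar>z n m \<xi>\<bar>)"
    have "\<forall>\<xi>. \<exists>n m. n \<in> {N..M} \<and> m \<in> {N..M} \<and> g \<xi> \<le> \<bar>z n m \<xi>\<bar>" using gz by blast
    then obtain \<nu> \<mu> where \<nu>: "\<And>\<xi>. \<nu> \<xi> \<in> {N..M}" and \<mu>: "\<And>\<xi>. \<mu> \<xi> \<in> {N..M}"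
      and gle: "\<And>\<xi>. g \<xi> \<le> \<bar>z (\<nu> \<xi>) (\<mu> \<xi>) \<xi>\<bar>"
      by metis
    define g1 where "g1 \<xi> = min 1 \<bar>a1 (\<nu> \<xi>) \<xi> - b1 p \<xi>\<bar>" for \<xi>
    define g2 where "g2 \<xi> = min 1 \<bar>a2 (\<nu> \<xi>) \<xi> - b2 p \<xi>\<bar>" for \<xi>
    define g3 where "g3 \<xi> = min 1 \<bar>a3 (\<mu> \<xi>) \<xi> - b1 p \<xi>\<bar>" for \<xi>
    define g4 where "g4 \<xi> = min 1 \<bar>a4 (\<mu> \<xi>) \<xi> - b2 p \<xi>\<bar>" for \<xi>
    have le: "N1 \<le> N" "N2 \<le> N" "N3 \<le> N" "N4 \<le> N" unfolding N_def by auto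
    have Eg: "E g1 \<le> \<epsilon> / 4" "E g2 \<le> \<epsilon> / 4" "E g3 \<le> \<epsilon> / 4" "E g4 \<le> \<epsilon> / 4"
      unfolding g1_def[abs_def] g2_def[abs_def] g3_def[abs_def] g4_def[abs_def]
      using piece(1)[of N1 a1 b1 \<nu> M, OF N1 le(1) \<nu>]
        piece(1)[of N2 a2 b2 \<nu> M, OF N2 le(2) \<nu>]
        piece(1)[of N3 a3 b1 \<mu> M, OF N3 le(3) \<mu>]
        piece(1)[of N4 a4 b2 \<mu> M, OF N4 le(4) \<mu>] .
    have bg: "bdd_fun g1" "bdd_fun g2" "bdd_fun g3" "bdd_fun g4"
      unfolding g1_def[abs_def] g2_def[abs_def] g3_def[abs_def] g4_def[abs_def]
      using piece(2)[of N1 a1 b1 \<nu> M, OF N1 le(1) \<nu>]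
        piece(2)[of N2 a2 b2 \<nu> M, OF N2 le(2) \<nu>]
        piece(2)[of N3 a3 b1 \<mu> M, OF N3 le(3) \<mu>]
        piece(2)[of N4 a4 b2 \<mu> M, OF N4 le(4) \<mu>] .
    have subadd: "min 1 (u + v) \<le> min 1 u + min 1 v" if "0 \<le> u" "0 \<le> v" for u v :: real
      using that by (auto simp: min_def)
    have "g \<xi> \<le> (g1 \<xi> + g2 \<xi>) + (g3 \<xi> + g4 \<xi>)" for \<xi>
    proof -
      have "\<bar>z (\<nu> \<xi>) (\<mu> \<xi>) \<xi>\<bar> \<le> (\<bar>a1 (\<nu> \<xi>) \<xi> - b1 p \<xi>\<bar> + \<bar>a2 (\<nu> \<xi>) \<xi> - b2 p \<xi>\<bar>)
          + (\<bar>a3 (\<mu> \<xi>) \<xi> - b1 p \<xi>\<bar> + \<bar>a4 (\<mu> \<xi>) \<xi> - b2 p \<xi>\<bar>)"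
        using z[of "\<nu> \<xi>" "\<mu> \<xi>" \<xi>] by linarith
      then have "g \<xi> \<le> min 1 ((\<bar>a1 (\<nu> \<xi>) \<xi> - b1 p \<xi>\<bar> + \<bar>a2 (\<nu> \<xi>) \<xi> - b2 p \<xi>\<bar>)
          + (\<bar>a3 (\<mu> \<xi>) \<xi> - b1 p \<xi>\<bar> + \<bar>a4 (\<mu> \<xi>) \<xi> - b2 p \<xi>\<bar>))"
        using gle[of \<xi>] gz by (intro min.boundedI) (auto intro: order_trans)
      also have "\<dots> \<le> min 1 (\<bar>a1 (\<nu> \<xi>) \<xi> - b1 p \<xi>\<bar> + \<bar>a2 (\<nu> \<xi>) \<xi> - b2 p \<xi>\<bar>)
          + min 1 (\<bar>a3 (\<mu> \<xi>) \<xi> - b1 p \<xi>\<bar> + \<bar>a4 (\<mu> \<xi>) \<xi> - b2 p \<xi>\<bar>)"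
        by (rule subadd) simp_all
      also have "\<dots> \<le> (g1 \<xi> + g2 \<xi>) + (g3 \<xi> + g4 \<xi>)"
        unfolding g1_def g2_def g3_def g4_def by (intro add_mono subadd) simp_all
      finally show ?thesis .
    qed
    then have "E g \<le> E (\<lambda>\<xi>. (g1 \<xi> + g2 \<xi>) + (g3 \<xi> + g4 \<xi>))" using g bg by (intro E_mono) auto
    also have "\<dots> = (E g1 + E g2) + (E g3 + E g4)" using bg by simp
    finally show "E g \<le> \<epsilon>" using Eg by linarith
  qed
qed

end

section \<open>Bands\<close>

lemma band_Inter:
  assumes "\<And>B. B \<in> \<B> \<Longrightarrow> band B"
  shows "band (\<Inter>\<B>)"
  unfolding band_def order_ideal_def
proof (intro conjI allI impI)
  show "subspace (\<Inter>\<B>)"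
    using assms unfolding band_def order_ideal_def by (intro subspace_Inter) auto
next
  fix x y :: 'a assume "y \<in> \<Inter>\<B> \<and> \<bar>x\<bar> \<le> \<bar>y\<bar>"
  then show "x \<in> \<Inter>\<B>" using assms unfolding band_def order_ideal_def by blast
next
  fix A and s :: 'a
  assume A: "A \<subseteq> \<Inter>\<B> \<and> (\<forall>a\<in>A. a \<le> s) \<and> (\<forall>u. (\<forall>a\<in>A. a \<le> u) \<longrightarrow> s \<le> u)"
  show "s \<in> \<Inter>\<B>"
  proof
    fix B assume B: "B \<in> \<B>"
    then have "A \<subseteq> B" using A by blast
    then show "s \<in> B" using assms[OF B] A unfolding band_def by blast
  qed
qed

lemma band_principal_band: "band (principal_band x)"
  unfolding principal_band_def by (rule hull_in) (blast intro: band_Inter)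

lemma mem_principal_band: "x \<in> principal_band x"
  unfolding principal_band_def using hull_subset[of "{x}"] by blast

lemma band_subspace: "band B \<Longrightarrow> subspace B"
  unfolding band_def order_ideal_def by blast

lemma band_solid: "band B \<Longrightarrow> y \<in> B \<Longrightarrow> \<bar>x\<bar> \<le> \<bar>y\<bar> \<Longrightarrow> x \<in> B"
  unfolding band_def order_ideal_def by blast

lemma band_sup:
  assumes "band B" "A \<subseteq> B" "\<And>a. a \<in> A \<Longrightarrow> a \<le> s" "\<And>u. (\<And>a. a \<in> A \<Longrightarrow> a \<le> u) \<Longrightarrow> s \<le> u"
  shows "s \<in> B"
proof -
  have "A \<subseteq> B \<and> (\<forall>a\<in>A. a \<le> s) \<and> (\<forall>u. (\<forall>a\<in>A. a \<le> u) \<longrightarrow> s \<le> u)"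
    using assms(2-4) by simp
  then show ?thesis using assms(1) unfolding band_def by simp
qed

lemma band_nonneg_solid: "band B \<Longrightarrow> y \<in> B \<Longrightarrow> 0 \<le> x \<Longrightarrow> x \<le> y \<Longrightarrow> x \<in> B"
  by (erule band_solid) (auto intro: order_trans[OF _ abs_ge_self])

lemma ideal_of_subset_principal_band:
  assumes e: "0 \<le> e"
  shows "ideal_of e \<subseteq> principal_band e"
proof
  fix v assume "v \<in> ideal_of e"
  then obtain c where "\<bar>v\<bar> \<le> c *\<^sub>R e" unfolding ideal_of_def by blast
  then have "\<bar>v\<bar> \<le> \<bar>c *\<^sub>R e\<bar>" using abs_ge_self order_trans by blast
  moreover have "c *\<^sub>R e \<in> principal_band e"
    by (intro subspace_scale band_subspace band_principal_band mem_principal_band)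
  ultimately show "v \<in> principal_band e" by (meson band_principal_band band_solid)
qed

locale positive_functional_on_band =
  fixes B :: "'a::banach_lattice set" and f :: "'a \<Rightarrow> real"
  assumes band_B: "band B"
    and f_linear: "linear_functional_on B f"
    and f_pos: "strictly_positive_on B f"
begin

lemma subspace_B: "subspace B" using band_B by (rule band_subspace)

lemma f_add: "u \<in> B \<Longrightarrow> v \<in> B \<Longrightarrow> f (u + v) = f u + f v"
  using f_linear unfolding linear_functional_on_def by blast

lemma f_scale: "v \<in> B \<Longrightarrow> f (c *\<^sub>R v) = c * f v"
  using f_linear unfolding linear_functional_on_def by blast

lemma f_zero: "f 0 = 0"
  using f_scale[of 0 0] subspace_0[OF subspace_B] by simp

lemma f_nonneg: "v \<in> B \<Longrightarrow> 0 \<le> v \<Longrightarrow> 0 \<le> f v"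
  using f_pos f_zero unfolding strictly_positive_on_def by (cases "v = 0") (auto simp: less_le)

lemma f_diff: "u \<in> B \<Longrightarrow> v \<in> B \<Longrightarrow> f (u - v) = f u - f v"
  using f_add[of "u - v" v] subspace_diff[OF subspace_B] by simp

lemma f_mono: "u \<in> B \<Longrightarrow> v \<in> B \<Longrightarrow> u \<le> v \<Longrightarrow> f u \<le> f v"
  using f_nonneg[of "v - u"] f_diff[of v u] subspace_diff[OF subspace_B] by simp

text \<open>The sum of a positive series is the supremum of its partial sums, and bands are closed
  under suprema.\<close>

lemma sums_in_band:
  assumes "\<And>n. g n \<in> B" "\<And>n. 0 \<le> g n" "g sums s"
  shows "s \<in> B"
proof (rule band_sup[OF band_B, of "range (\<lambda>n. \<Sum>i<n. g i)"])
  show "range (\<lambda>n. \<Sum>i<n. g i) \<subseteq> B" using assms(1) by (auto intro: subspace_sum[OF subspace_B])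
  show "a \<le> s" if "a \<in> range (\<lambda>n. \<Sum>i<n. g i)" for a
    using that sums_ge_partial[OF assms(3,2)] by auto
  show "s \<le> u" if "\<And>a. a \<in> range (\<lambda>n. \<Sum>i<n. g i) \<Longrightarrow> a \<le> u" for u
    by (rule sums_le_lattice[OF assms(3)]) (simp add: that)
qed

text \<open>Automatic continuity of positive functionals: if \<open>f \<bar>x (n k)\<bar>\<close>
  exceeded \<open>4 ^ k\<close> for all \<open>k\<close>, the sum of the vectors
  \<open>(1 / 2) ^ k *\<^sub>R \<bar>x (n k)\<bar>\<close> would lie in \<open>B\<close> and have a
  value above every \<open>2 ^ k\<close>.\<close>

lemma f_bounded:
  assumes x: "\<And>n::nat. x n \<in> B" "\<And>n. norm (x n) \<le> C"
  shows "\<exists>K. \<forall>n. f \<bar>x n\<bar> \<le> K"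
proof (rule ccontr)
  assume "\<not> ?thesis"
  then have "\<forall>k::nat. \<exists>n. 4 ^ k < f \<bar>x n\<bar>" by (meson not_le)
  then obtain n where n: "\<And>k::nat. 4 ^ k < f \<bar>x (n k)\<bar>" by metis
  define g where "g k = (1 / 2) ^ k *\<^sub>R \<bar>x (n k)\<bar>" for k
  have ax: "\<bar>x m\<bar> \<in> B" for m using x(1)[of m] by (rule band_solid[OF band_B]) simp
  have g: "g k \<in> B" "0 \<le> g k" for k
    unfolding g_def using ax by (auto intro: subspace_scale[OF subspace_B] scaleR_nonneg_nonneg)
  have "summable (\<lambda>k. norm (g k))"
  proof (rule summable_comparison_test')
    show "summable (\<lambda>k. (1 / 2) ^ k * C)" by (intro summable_mult2 summable_geometric) auto
    show "norm (norm (g k)) \<le> (1 / 2) ^ k * C" if "0 \<le> k" for k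
      unfolding g_def using x(2) by (simp add: mult_left_mono)
  qed
  then have "summable g" by (rule summable_norm_cancel)
  then have s: "g sums suminf g" by (rule summable_sums)
  have sB: "suminf g \<in> B" by (rule sums_in_band[OF g s])
  have "2 ^ k \<le> f (suminf g)" for k :: nat
  proof -
    have "g k \<le> (\<Sum>i<Suc k. g i)" using g(2) by (simp add: sum_nonneg add_increasing)
    also have "\<dots> \<le> suminf g" by (rule sums_ge_partial[OF s g(2)])
    finally have "f (g k) \<le> f (suminf g)" by (rule f_mono[OF g(1) sB])
    moreover have "(1 / 2) ^ k * 4 ^ k \<le> f (g k)"
      unfolding g_def f_scale[OF ax] using n[of k] by (intro mult_left_mono) auto
    moreover have "(1 / 2) ^ k * 4 ^ k = (2 :: real) ^ k" by (simp flip: power_mult_distrib)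
    ultimately show ?thesis by simp
  qed
  moreover obtain k :: nat where "f (suminf g) < 2 ^ k" using real_arch_pow[of 2] by auto
  ultimately show False by (meson not_le)
qed

end

section \<open>Order convergence from the expectation\<close>

lemma inf_add_le:
  fixes p q w :: "'a::vector_lattice"
  assumes "0 \<le> p" "0 \<le> q" "0 \<le> w"
  shows "inf (p + q) w \<le> inf p w + inf q w"
proof -
  have a: "inf (p + q) w \<le> p + inf q w"
    unfolding add_inf_distrib_left using assms by (intro inf_mono) (auto intro: add_increasing)
  have "inf (p + q) w \<le> w + inf q w"
    using assms by (intro order_trans[OF inf_le2]) (simp add: add_increasing2)
  with a show ?thesis unfolding add_inf_distrib_right by (rule le_infI)
qed

text \<open>If the dominators of a net that is bounded by \<open>y\<close> have a lower bound \<open>l\<close>, then \<open>l\<close> is the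
  supremum of its meets with the members of the net: otherwise, subtracting the gap repeatedly
  from \<open>y\<close> would produce arbitrarily small dominators.\<close>

lemma lower_bound_is_sup_of_meets:
  fixes l y w :: "'a::banach_lattice"
  assumes l: "\<And>d. (\<And>t. t \<in> T \<Longrightarrow> t \<le> d) \<Longrightarrow> l \<le> d"
    and y: "\<And>t. t \<in> T \<Longrightarrow> t \<le> y" and l0: "0 \<le> l"
    and w: "\<And>t. t \<in> T \<Longrightarrow> inf l t \<le> w"
  shows "l \<le> w"
proof -
  define \<delta> where "\<delta> = l - inf w l"
  have step: "t \<le> d - \<delta>" if d: "\<And>t. t \<in> T \<Longrightarrow> t \<le> d" and t: "t \<in> T" for d t
  proof -
    have "inf l t \<le> inf w l" using w[OF t] by simp
    \<comment> \<open>The part of \<open>t\<close> below \<open>l\<close> is at most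
      \<open>inf w l\<close>, and its excess over \<open>l\<close> is at most \<open>d - l\<close>,
      as \<open>d\<close> dominates \<open>t\<close> and \<open>l\<close>. Together they stay below
      \<open>d\<close> by \<open>\<delta>\<close>.\<close>
    moreover have "t - inf l t \<le> d - l"
    proof -
      have "t - inf l t = sup (t - l) 0"
        by (simp add: diff_inf_eq_sup add_sup_distrib_left)
      also have "\<dots> \<le> d - l" using d[OF t] l[OF d] by (intro sup_least) auto
      finally show ?thesis .
    qed
    ultimately have "inf l t + (t - inf l t) \<le> inf w l + (d - l)" by (rule add_mono)
    moreover have "a + (b - a) = b" "a + (d - l) = d - (l - a)" for a b :: 'a
      by (simp_all add: algebra_simps)
    ultimately show ?thesis unfolding \<delta>_def by (simp only:)
  qed
  have "t \<le> y - real n *\<^sub>R \<delta>" if "t \<in> T" for t n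
    using that
  proof (induction n arbitrary: t)
    case 0
    then show ?case using y by simp
  next
    case (Suc n)
    have "t \<le> (y - real n *\<^sub>R \<delta>) - \<delta>" using Suc by (intro step) auto
    also have "\<dots> = y - real (Suc n) *\<^sub>R \<delta>" by (simp add: algebra_simps)
    finally show ?case .
  qed
  then have "l \<le> y - real n *\<^sub>R \<delta>" for n by (rule l)
  then have "real n *\<^sub>R \<delta> \<le> y" for n
    using l0 by (metis add_increasing2 le_diff_eq add.commute order_trans le_add_same_cancel1)
  then have "\<delta> \<le> 0" by (rule archimedean_lattice)
  then have "l \<le> inf w l" unfolding \<delta>_def diff_le_0_iff_le .
  then show ?thesis by simp
qed

locale order_continuous_functional = positive_functional_on_band +
  assumes f_oc: "order_continuous_on B f"
begin

text \<open>Over the finite subsets of \<open>T\<close>, ordered by inclusion, the differences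
  decrease to 0 inside the band, where \<open>f\<close> is order continuous.\<close>

lemma approximated_by_finite_sups:
  assumes l: "l \<in> B" "0 \<le> l" and T: "T \<noteq> {}" "\<And>t. t \<in> T \<Longrightarrow> 0 \<le> t"
    and sup: "\<And>w. (\<And>t. t \<in> T \<Longrightarrow> inf l t \<le> w) \<Longrightarrow> l \<le> w" and \<epsilon>: "0 < \<epsilon>"
  obtains F where "finite F" "F \<noteq> {}" "F \<subseteq> T" "f (l - inf l (Sup_fin F)) < \<epsilon>"
proof -
  define I where "I = {F. finite F \<and> F \<noteq> {} \<and> F \<subseteq> T}"
  define b where "b F = l - inf l (Sup_fin F)" for F
  have b0: "0 \<le> b F" for F unfolding b_def diff_ge_0_iff_ge by (rule inf_le1)
  have bl: "b F \<le> l" if F: "F \<in> I" for F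
  proof -
    obtain t where "t \<in> F" using F unfolding I_def by blast
    then have "0 \<le> Sup_fin F"
      using F T(2) Sup_fin.coboundedI[of F t] unfolding I_def by (auto intro: order_trans)
    then have "0 \<le> inf l (Sup_fin F)" using l(2) by simp
    then show ?thesis unfolding b_def by (simp only: diff_le_eq le_add_same_cancel1)
  qed
  have bB: "b F \<in> B" if "F \<in> I" for F
    using band_nonneg_solid[OF band_B l(1) b0 bl[OF that]] .
  have dir: "directed_index I (\<subseteq>)"
    unfolding directed_index_def
  proof (intro conjI ballI)
    obtain t where "t \<in> T" using T(1) by blast
    then have "{t} \<in> I" unfolding I_def by simp
    then show "I \<noteq> {}" by blast
    show "reflp_on I (\<subseteq>)" by (rule reflp_onI) (rule subset_refl)
    show "transp_on I (\<subseteq>)" by (rule transp_onI) (rule subset_trans)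
    fix F G assume "F \<in> I" "G \<in> I"
    then show "\<exists>H\<in>I. F \<subseteq> H \<and> G \<subseteq> H" unfolding I_def by (intro bexI[of _ "F \<union> G"]) auto
  qed
  have anti: "b G \<le> b F" if "F \<in> I" "G \<in> I" "F \<subseteq> G" for F G
    using that unfolding b_def I_def
    by (intro diff_left_mono inf_mono order_refl) (auto intro: Sup_fin.subset_imp)
  have dec: "decreases_to_0_in B I (\<subseteq>) b"
    unfolding decreases_to_0_in_def
  proof (intro conjI ballI impI dir)
    \<comment> \<open>Singletons suffice: \<open>l' \<le> l - inf l t\<close> makes
      \<open>l - l'\<close> an upper bound of all meets, hence of \<open>l\<close>.\<close>
    fix l' assume "l' \<in> B" and l': "\<forall>F\<in>I. l' \<le> b F"
    have "l \<le> l - l'"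
    proof (rule sup)
      fix t assume "t \<in> T"
      then have "{t} \<in> I" unfolding I_def by simp
      then have "l' \<le> b {t}" using l' by blast
      then have "l' \<le> l - inf l t" by (simp add: b_def)
      then show "inf l t \<le> l - l'" by (simp only: le_diff_eq add.commute)
    qed
    then show "l' \<le> 0" by simp
  qed (use bB b0 anti in auto)
  have "order_converges_in B I (\<subseteq>) b 0"
  proof (rule order_converges_inI[OF dec], intro ballI)
    fix F assume "F \<in> I"
    then show "\<exists>i0\<in>I. \<forall>i\<in>I. i0 \<subseteq> i \<longrightarrow> \<bar>b i - 0\<bar> \<le> b F" using anti b0 by auto
  qed
  then obtain F where F: "F \<in> I" "\<bar>f (b F)\<bar> < \<epsilon>"
    using order_continuous_onD[OF f_oc dir _ _ \<epsilon>, of b] bB by blast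
  then show ?thesis using that[of F] unfolding I_def b_def by auto
qed

end

abbreviation le2 :: "nat \<times> nat \<Rightarrow> nat \<times> nat \<Rightarrow> bool" where
  "le2 \<equiv> \<lambda>(n, m) (n', m'). n \<le> n' \<and> m \<le> m'"

locale represented_functional = lattice_representation E e f h +
  order_continuous_functional "principal_band e" f
  for E :: "(('a::banach_lattice \<Rightarrow> real) \<Rightarrow> real) \<Rightarrow> real" and e f h
begin

lemma V: "subspace (ideal_of e)" using e_nonneg by (rule subspace_ideal_of)

lemma in_B: "v \<in> ideal_of e \<Longrightarrow> v \<in> principal_band e"
  using ideal_of_subset_principal_band[OF e_nonneg] by blast

lemma h_zero: "h 0 \<xi> = 0"
  using h_scale[of 0 0] subspace_0[OF V] by simp

lemma h_minus: "v \<in> ideal_of e \<Longrightarrow> h (- v) \<xi> = - h v \<xi>"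
  using h_scale[of v "- 1"] by simp

lemma h_diff: "u \<in> ideal_of e \<Longrightarrow> v \<in> ideal_of e \<Longrightarrow> h (u - v) \<xi> = h u \<xi> - h v \<xi>"
  using h_add[of u "- v"] h_minus[of v] subspace_neg[OF V, of v] by simp

lemma h_sum: "(\<And>i. i \<in> A \<Longrightarrow> v i \<in> ideal_of e) \<Longrightarrow> h (\<Sum>i\<in>A. v i) \<xi> = (\<Sum>i\<in>A. h (v i) \<xi>)"
  by (induction A rule: infinite_finite_induct) (auto simp: h_zero h_add subspace_sum[OF V])

lemma h_mono:
  assumes "u \<in> ideal_of e" "v \<in> ideal_of e" "u \<le> v"
  shows "h u \<xi> \<le> h v \<xi>"
  using h_sup[OF assms(1,2), of \<xi>] assms(3) by (simp add: sup_absorb2)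

lemma h_abs:
  assumes v: "v \<in> ideal_of e"
  shows "h \<bar>v\<bar> \<xi> = \<bar>h v \<xi>\<bar>"
  using h_sup[OF v subspace_neg[OF V v], of \<xi>] h_minus[OF v] by (simp add: abs_lattice[of v])

lemma inf_in_ideal: "u \<in> ideal_of e \<Longrightarrow> v \<in> ideal_of e \<Longrightarrow> inf u v \<in> ideal_of e"
  unfolding inf_eq_neg_sup
  by (intro subspace_neg[OF V] sup_in_ideal_of[OF e_nonneg])

lemma h_inf:
  assumes "u \<in> ideal_of e" "v \<in> ideal_of e"
  shows "h (inf u v) \<xi> = min (h u \<xi>) (h v \<xi>)"
  using assms subspace_neg[OF V] sup_in_ideal_of[OF e_nonneg]
  unfolding inf_eq_neg_sup by (simp add: h_minus h_sup del: neg_sup_eq_inf)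

text \<open>The member that realises the supremum varies with the point, just as the indices in
  \<open>vanishing\<close> do.\<close>

lemma h_Sup_fin:
  assumes "finite F" "F \<noteq> {}" "F \<subseteq> ideal_of e"
  shows "Sup_fin F \<in> ideal_of e \<and> (\<exists>t\<in>F. h (Sup_fin F) \<xi> = h t \<xi>)"
  using assms
proof (induction F rule: finite_ne_induct)
  case (singleton t)
  then show ?case by simp
next
  case (insert t F)
  then obtain t' where t': "Sup_fin F \<in> ideal_of e" "t' \<in> F" "h (Sup_fin F) \<xi> = h t' \<xi>" by auto
  have "Sup_fin (insert t F) = sup t (Sup_fin F)" using insert by (simp add: Sup_fin.insert)
  then show ?case
    using t' insert.prems h_sup[of t "Sup_fin F" \<xi>] sup_in_ideal_of[OF e_nonneg, of t "Sup_fin F"]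
    by (auto simp: max_def)
qed

lemma h_unit_le: "h e \<xi> \<le> 1"
  using h_unit[of \<xi>] ideal_of_self[OF e_nonneg] by auto

text \<open>The eventual upper bounds of the net form a directed set \<open>D\<close>, so it
  suffices that \<open>D\<close> has infimum 0. A positive lower bound \<open>k\<close> is cut down
  twice: to \<open>k'\<close> below a multiple of \<open>e\<close>, and to the meet with a finite
  supremum \<open>s\<close> of late terms. Each cut costs \<open>\<epsilon>\<close> under
  \<open>f\<close>, and what is left is at most \<open>\<epsilon>\<close> because the net
  vanishes.\<close>

lemma vanishing_imp_uo_null:
  fixes z :: "nat \<Rightarrow> nat \<Rightarrow> 'a"
  assumes z: "\<And>n m. z n m \<in> ideal_of e" and van: "vanishing (\<lambda>n m. h (z n m))"
  shows "uo_converges UNIV le2 (\<lambda>(n, m). z n m) 0"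
  unfolding uo_converges_def
proof (intro allI impI)
  fix y :: 'a assume y: "0 \<le> y"
  define t where "t n m = inf \<bar>z n m\<bar> y" for n m
  have t0: "0 \<le> t n m" for n m unfolding t_def using y by simp
  have tV: "t n m \<in> ideal_of e" for n m
  proof (rule ideal_of_solid[OF abs_in_ideal_of[OF z[of n m]]])
    show "\<bar>t n m\<bar> \<le> \<bar>\<bar>z n m\<bar>\<bar>" unfolding abs_of_nonneg[OF t0] abs_idempotent by (simp add: t_def)
  qed
  define T where "T N = {t n m |n m. N \<le> n \<and> N \<le> m}" for N
  define D where "D = {d. \<exists>N. \<forall>s\<in>T N. s \<le> d}"
  have T_mono: "T N' \<subseteq> T N" if "N \<le> N'" for N N' using that unfolding T_def by fastforce
  have d0: "0 \<le> d" if d: "d \<in> D" for d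
  proof -
    obtain N where "\<forall>s\<in>T N. s \<le> d" using d unfolding D_def by blast
    then have "t N N \<le> d" unfolding T_def by blast
    then show ?thesis using t0 order_trans by blast
  qed
  have no_lower: "l \<le> 0" if l: "\<And>d. d \<in> D \<Longrightarrow> l \<le> d" for l
  proof (rule ccontr)
    assume "\<not> l \<le> 0"
    define k where "k = sup l 0"
    have k0: "0 \<le> k" unfolding k_def by simp
    have "k \<noteq> 0" using \<open>\<not> l \<le> 0\<close> sup_ge1[of l 0] unfolding k_def by fastforce
    then have kpos: "0 < k" using k0 by simp
    have k: "k \<le> d" if "d \<in> D" for d unfolding k_def using l[OF that] d0[OF that] by simp
    have sup_k: "k \<le> w" if "\<And>s. s \<in> T N \<Longrightarrow> inf k s \<le> w" for N w
    proof (rule lower_bound_is_sup_of_meets[of "T N" k y w])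
      show "k \<le> d" if "\<And>s. s \<in> T N \<Longrightarrow> s \<le> d" for d using that by (intro k) (auto simp: D_def)
      show "s \<le> y" if "s \<in> T N" for s using that unfolding T_def t_def by auto
    qed (use that k0 in auto)
    have TB: "s \<in> ideal_of e" "0 \<le> s" if s: "s \<in> T N" for s N
      using s tV t0 unfolding T_def by auto
    have T_ne: "T N \<noteq> {}" for N unfolding T_def by blast
    have kB: "k \<in> principal_band e"
    proof (rule band_sup[OF band_B, of "inf k ` T 0"])
      show "inf k ` T 0 \<subseteq> principal_band e"
        using TB k0 by (auto intro!: band_nonneg_solid[OF band_B in_B])
      show "k \<le> u" if "\<And>a. a \<in> inf k ` T 0 \<Longrightarrow> a \<le> u" for u using that by (intro sup_k[of 0]) auto
    qed auto
    have inf_B: "inf k s \<in> principal_band e" if "0 \<le> s" for s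
      using kB by (rule band_nonneg_solid[OF band_B]) (use k0 that in auto)
    have "f k \<le> 3 * \<epsilon>" if \<epsilon>: "0 < \<epsilon>" for \<epsilon>
    proof -
      \<comment> \<open>\<open>F0\<close> comes first because it determines the multiple
        \<open>a\<close> of \<open>e\<close>, on which the threshold \<open>N\<close> for the second
        family depends.\<close>
      obtain F0 where F0: "finite F0" "F0 \<noteq> {}" "F0 \<subseteq> T 0" "f (k - inf k (Sup_fin F0)) < \<epsilon>"
        by (rule approximated_by_finite_sups[OF kB k0 T_ne TB(2) sup_k \<epsilon>])
      define k' where "k' = inf k (Sup_fin F0)"
      have S0: "Sup_fin F0 \<in> ideal_of e" using h_Sup_fin[OF F0(1,2)] F0(3) TB by blast
      have S0': "0 \<le> Sup_fin F0"
        using F0 TB(2) Sup_fin.coboundedI[OF F0(1)] by (meson all_not_in_conv order_trans subsetD)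
      have k'0: "0 \<le> k'" unfolding k'_def using k0 S0' by simp
      have k'k: "k' \<le> k" unfolding k'_def by simp
      obtain c where c: "0 \<le> c" "\<bar>Sup_fin F0\<bar> \<le> c *\<^sub>R e" by (rule ideal_ofE[OF S0 e_nonneg])
      \<comment> \<open>\<open>1 \<le> a\<close> yields \<open>inf k' s \<le> a *\<^sub>R s\<close>
        besides \<open>inf k' s \<le> a *\<^sub>R e\<close>, hence the comparison with
        \<open>a *\<^sub>R inf e s\<close>.\<close>
      define a where "a = c + 1"
      have a: "1 \<le> a" unfolding a_def using c by simp
      have "k' \<le> c *\<^sub>R e" unfolding k'_def using order_trans[OF abs_ge_self c(2)] by (rule le_infI2)
      also have "\<dots> \<le> a *\<^sub>R e" unfolding a_def using e_nonneg by (intro scaleR_right_mono) auto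
      finally have k'a: "k' \<le> a *\<^sub>R e" .
      obtain N where N: "\<And>M g. bdd_fun g \<Longrightarrow>
          (\<And>\<xi>. g \<xi> \<le> 1 \<and> (\<exists>n\<in>{N..M}. \<exists>m\<in>{N..M}. g \<xi> \<le> \<bar>h (z n m) \<xi>\<bar>)) \<Longrightarrow> E g \<le> \<epsilon> / a"
        using van \<epsilon> a unfolding vanishing_def
        by (metis (no_types, lifting) divide_pos_pos less_le_trans zero_less_one)
      obtain F where F: "finite F" "F \<noteq> {}" "F \<subseteq> T N" "f (k - inf k (Sup_fin F)) < \<epsilon>"
        by (rule approximated_by_finite_sups[OF kB k0 T_ne TB(2) sup_k \<epsilon>])
      define s where "s = Sup_fin F"
      have FV: "F \<subseteq> ideal_of e" using F(3) TB by blast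
      have sV: "s \<in> ideal_of e" unfolding s_def using h_Sup_fin[OF F(1,2) FV] by blast
      have s0: "0 \<le> s"
        unfolding s_def using F TB(2) Sup_fin.coboundedI[OF F(1)] by (meson all_not_in_conv order_trans subsetD)
      have isV: "inf e s \<in> ideal_of e" using ideal_of_self[OF e_nonneg] sV by (rule inf_in_ideal)
      have "f (inf e s) \<le> \<epsilon> / a"
      proof -
        have "F \<subseteq> (\<lambda>(n, m). t n m) ` ({N..} \<times> {N..})" using F(3) unfolding T_def by auto
        then obtain J where J: "J \<subseteq> {N..} \<times> {N..}" "finite J" "F = (\<lambda>(n, m). t n m) ` J"
          using F(1) finite_subset_image by meson
        obtain M where M: "\<And>j. j \<in> fst ` J \<union> snd ` J \<Longrightarrow> j \<le> M"
          using J(2) finite_nat_set_iff_bounded_le[of "fst ` J \<union> snd ` J"] by auto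
        have "E (h (inf e s)) \<le> \<epsilon> / a"
        proof (rule N[of _ M])
          show "bdd_fun (h (inf e s))" using isV by (rule h_bdd)
          fix \<xi>
          have hi: "h (inf e s) \<xi> = min (h e \<xi>) (h s \<xi>)"
            using ideal_of_self[OF e_nonneg] sV by (rule h_inf)
          obtain v where v: "v \<in> F" "h s \<xi> = h v \<xi>"
            unfolding s_def using h_Sup_fin[OF F(1,2) FV] by blast
          then obtain n m where nm: "(n, m) \<in> J" "v = t n m" using J(3) by auto
          have "n \<le> M" "m \<le> M" using M nm(1) by force+
          moreover have "N \<le> n" "N \<le> m" using J(1) nm(1) by auto
          moreover have "h v \<xi> \<le> h \<bar>z n m\<bar> \<xi>"
            unfolding nm(2) by (intro h_mono tV abs_in_ideal_of z) (simp add: t_def)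
          then have "h (inf e s) \<xi> \<le> \<bar>h (z n m) \<xi>\<bar>" using hi v(2) h_abs[OF z] by auto
          ultimately show "h (inf e s) \<xi> \<le> 1 \<and> (\<exists>n\<in>{N..M}. \<exists>m\<in>{N..M}. h (inf e s) \<xi> \<le> \<bar>h (z n m) \<xi>\<bar>)"
            using hi h_unit_le[of \<xi>] by (intro conjI bexI[of _ n] bexI[of _ m]) auto
        qed
        then show ?thesis using E_h[OF isV] by simp
      qed
      moreover have "inf k' s \<le> a *\<^sub>R inf e s"
      proof -
        have a0: "0 < a" using a by simp
        have "inf k' s /\<^sub>R a \<le> e"
          using le_infI1[OF k'a] a0 by (simp only: pos_divideR_le_eq)
        moreover have "inf k' s /\<^sub>R a \<le> s"
        proof -
          have "1 *\<^sub>R s \<le> a *\<^sub>R s" using a s0 by (rule scaleR_right_mono)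
          then have "inf k' s \<le> a *\<^sub>R s" by (intro le_infI2) simp
          then show ?thesis using a0 by (simp only: pos_divideR_le_eq)
        qed
        ultimately have "inf k' s /\<^sub>R a \<le> inf e s" by (rule le_infI)
        then show ?thesis using a0 by (simp only: pos_divideR_le_eq)
      qed
      moreover have ik'B: "inf k' s \<in> principal_band e"
        using kB by (rule band_nonneg_solid[OF band_B]) (use k'0 s0 k'k in \<open>auto intro: le_infI1\<close>)
      ultimately have "f (inf k' s) \<le> a * (\<epsilon> / a)"
        using f_mono[OF ik'B subspace_scale[OF subspace_B in_B[OF isV], of a]] f_scale[OF in_B[OF isV], of a] a
        by (smt (verit, best) mult_left_mono)
      then have 1: "f (inf k' s) \<le> \<epsilon>" using a by simp
      have k'B: "k' \<in> principal_band e" unfolding k'_def using S0' by (rule inf_B)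
      have "inf k s \<le> inf k (s + (k - k'))"
        using k'k by (intro inf_mono order_refl) (simp add: add_increasing2)
      also have "\<dots> = inf k' s + (k - k')" by (simp add: add_inf_distrib_right)
      finally have "f (inf k s) \<le> f (inf k' s + (k - k'))"
        using s0 ik'B kB k'B subspace_add[OF subspace_B] subspace_diff[OF subspace_B] by (intro f_mono inf_B) auto
      also have "\<dots> = f (inf k' s) + f (k - k')"
        using ik'B kB k'B subspace_diff[OF subspace_B] by (intro f_add) auto
      finally have 2: "f (inf k s) \<le> \<epsilon> + \<epsilon>" using 1 F0(4) unfolding k'_def by linarith
      have "f (k - inf k s) = f k - f (inf k s)" using kB inf_B[OF s0] by (rule f_diff)
      then show ?thesis using F(4) 2 unfolding s_def by linarith
    qed
    \<comment> \<open>With \<open>\<epsilon> = f k / 6\<close> the bound reads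
      \<open>f k \<le> f k / 2\<close>.\<close>
    then have "f k \<le> 3 * (f k / 6)" if "0 < f k" using that by (metis divide_pos_pos zero_less_numeral)
    moreover have "0 < f k" using f_pos kB kpos unfolding strictly_positive_on_def by blast
    ultimately show False by simp
  qed
  have "decreases_to_0_in UNIV D (\<lambda>u v. v \<le> u) (\<lambda>u. u)"
    unfolding decreases_to_0_in_def directed_index_def
  proof (intro conjI ballI impI)
    have "y \<in> D" unfolding D_def T_def t_def by auto
    then show "D \<noteq> {}" by blast
    show "reflp_on D (\<lambda>u v. v \<le> u)" by (rule reflp_onI) (rule order_refl)
    show "transp_on D (\<lambda>u v. v \<le> u)" by (rule transp_onI) (rule order_trans)
    fix c d assume "c \<in> D" "d \<in> D"
    then obtain N N' where "\<forall>s\<in>T N. s \<le> c" "\<forall>s\<in>T N'. s \<le> d" unfolding D_def by blast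
    then have "\<forall>s\<in>T (max N N'). s \<le> inf c d"
      using T_mono[of N "max N N'"] T_mono[of N' "max N N'"] by auto
    then have "inf c d \<in> D" unfolding D_def by blast
    then show "\<exists>k\<in>D. k \<le> c \<and> k \<le> d" by (intro bexI[of _ "inf c d"]) auto
  qed (use d0 no_lower in auto)
  then show "order_converges_in UNIV UNIV le2
      (\<lambda>i. inf \<bar>(case i of (n, m) \<Rightarrow> z n m) - 0\<bar> y) 0"
  proof (rule order_converges_inI, intro ballI)
    fix d assume "d \<in> D"
    then obtain N where N: "\<forall>s\<in>T N. s \<le> d" unfolding D_def by blast
    have "\<bar>inf \<bar>z n m\<bar> y\<bar> \<le> d" if "N \<le> n" "N \<le> m" for n m
    proof -
      have "t n m \<le> d" using N that unfolding T_def by blast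
      moreover have "\<bar>t n m\<bar> = t n m" using t0 by (rule abs_of_nonneg)
      ultimately show ?thesis unfolding t_def by simp
    qed
    then show "\<exists>i0\<in>UNIV. \<forall>i\<in>UNIV. le2 i0 i \<longrightarrow>
        \<bar>inf \<bar>(case i of (n, m) \<Rightarrow> z n m) - 0\<bar> y - 0\<bar> \<le> d"
      by (intro bexI[of _ "(N, N)"]) auto
  qed
qed

end

section \<open>Cesaro means inside the represented ideal\<close>

context represented_functional
begin

lemma cesaro_in_ideal:
  assumes "\<And>n. x n \<in> ideal_of e"
  shows "cesaro x n \<in> ideal_of e"
  unfolding cesaro_def using assms by (intro subspace_scale[OF V] subspace_sum[OF V]) simp

lemma h_cesaro:
  assumes "\<And>n. x n \<in> ideal_of e"
  shows "h (cesaro x n) \<xi> = (\<Sum>i\<le>n. h (x i) \<xi>) / real (Suc n)"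
  unfolding cesaro_def using assms by (simp add: h_scale h_sum subspace_sum[OF V])

text \<open>Positive parts are treated first, then negative parts along the subsequence found; the
  first tracking persists because it holds for all further subsequences. As \<open>b1\<close> and
  \<open>b2\<close> do not depend on \<open>s\<close>, two subsequences can be compared.\<close>

lemma exists_komlos_subsequence:
  fixes x :: "nat \<Rightarrow> 'a"
  assumes x: "\<And>n. x n \<in> ideal_of e" and C: "\<And>n. f \<bar>x n\<bar> \<le> C"
  shows "\<exists>r :: nat \<Rightarrow> nat. strict_mono r \<and> (\<forall>s s'. strict_mono s \<longrightarrow> strict_mono s' \<longrightarrow>
    vanishing (\<lambda>n m. h (cesaro (x \<circ> r \<circ> s) n - cesaro (x \<circ> r \<circ> s') m)))"
proof -
  have V0: "0 \<in> ideal_of e" using V by (rule subspace_0)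
  have pos: "sup u 0 \<in> ideal_of e" "bdd_fun (h (sup u 0))" "0 \<le> h (sup u 0) \<xi>"
      "E (h (sup u 0)) \<le> f \<bar>u\<bar>" if u: "u \<in> ideal_of e" for u \<xi>
  proof -
    show s: "sup u 0 \<in> ideal_of e" using e_nonneg u V0 by (rule sup_in_ideal_of)
    show "bdd_fun (h (sup u 0))" using s by (rule h_bdd)
    show "0 \<le> h (sup u 0) \<xi>" using h_sup[OF u V0, of \<xi>] by (simp add: h_zero)
    have "f (sup u 0) \<le> f \<bar>u\<bar>"
      by (intro f_mono in_B s abs_in_ideal_of u sup_least abs_ge_self abs_ge_zero)
    then show "E (h (sup u 0)) \<le> f \<bar>u\<bar>" using E_h[OF s] by simp
  qed
  have nx: "- x n \<in> ideal_of e" for n using x by (rule subspace_neg[OF V])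
  have nC: "E (h (sup (- x n) 0)) \<le> C" for n using pos(4)[OF nx[of n]] C[of n] by simp
  interpret P: positive_sequence E "\<lambda>n. h (sup (x n) 0)" C
    by unfold_locales (use pos[OF x] C order_trans in blast)+
  obtain r1 :: "nat \<Rightarrow> nat" and b1 where r1: "strict_mono r1" and t1: "\<And>s :: nat \<Rightarrow> nat. strict_mono s \<Longrightarrow>
      tracks (\<lambda>n \<xi>. (\<Sum>i\<le>n. h (sup (x (r1 (s i))) 0) \<xi>) / real (Suc n)) b1"
    using P.exists_tracked_subsequence by blast
  interpret M: positive_sequence E "\<lambda>n. h (sup (- x (r1 n)) 0)" C
    by unfold_locales (use pos[OF nx] nC in blast)+
  obtain r2 :: "nat \<Rightarrow> nat" and b2 where r2: "strict_mono r2" and t2: "\<And>s :: nat \<Rightarrow> nat. strict_mono s \<Longrightarrow>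
      tracks (\<lambda>n \<xi>. (\<Sum>i\<le>n. h (sup (- x (r1 (r2 (s i)))) 0) \<xi>) / real (Suc n)) b2"
    using M.exists_tracked_subsequence by blast
  define r where "r = r1 \<circ> r2"
  have r: "strict_mono r" unfolding r_def using r1 r2 by (rule strict_mono_o)
  define A1 where "A1 s n \<xi> = (\<Sum>i\<le>n. h (sup (x (r (s i))) 0) \<xi>) / real (Suc n)" for s :: "nat \<Rightarrow> nat" and n \<xi>
  define A2 where "A2 s n \<xi> = (\<Sum>i\<le>n. h (sup (- x (r (s i))) 0) \<xi>) / real (Suc n)" for s :: "nat \<Rightarrow> nat" and n \<xi>
  have tA1: "tracks (A1 s) b1" if "strict_mono s" for s
    using t1[OF strict_mono_o[OF r2 that]] unfolding A1_def[abs_def] r_def by simp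
  have tA2: "tracks (A2 s) b2" if "strict_mono s" for s
    using t2[OF that] unfolding A2_def[abs_def] r_def by simp
  have cV: "cesaro (x \<circ> r \<circ> s) n \<in> ideal_of e" for s n
    using x by (intro cesaro_in_ideal) simp
  have hc: "h (cesaro (x \<circ> r \<circ> s) n) \<xi> = A1 s n \<xi> - A2 s n \<xi>" for s n \<xi>
  proof -
    have split: "h u \<xi> = h (sup u 0) \<xi> - h (sup (- u) 0) \<xi>" if "u \<in> ideal_of e" for u
      using h_sup[OF that V0, of \<xi>] h_sup[OF subspace_neg[OF V that] V0, of \<xi>] h_minus[OF that, of \<xi>]
      by (simp add: h_zero max_def)
    have "h (cesaro (x \<circ> r \<circ> s) n) \<xi> = (\<Sum>i\<le>n. h (x (r (s i))) \<xi>) / real (Suc n)"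
      using x by (subst h_cesaro) simp_all
    also have "\<dots> = A1 s n \<xi> - A2 s n \<xi>"
      unfolding A1_def A2_def diff_divide_distrib[symmetric] sum_subtractf[symmetric]
      using split[OF x] by simp
    finally show ?thesis .
  qed
  show ?thesis
  proof (intro exI[of _ r] conjI r allI impI)
    fix s s' :: "nat \<Rightarrow> nat" assume s: "strict_mono s" "strict_mono s'"
    show "vanishing (\<lambda>n m. h (cesaro (x \<circ> r \<circ> s) n - cesaro (x \<circ> r \<circ> s') m))"
      by (rule tracks_imp_vanishing[OF tA1[OF s(1)] tA2[OF s(1)] tA1[OF s(2)] tA2[OF s(2)]])
        (simp add: h_diff cV hc)
  qed
qed

text \<open>uo-convergence is tested with \<open>y = e\<close>. The dominators may lie outside the
  band, but their meets with \<open>e\<close> lie in the ideal, still dominate because the tested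
  terms are below \<open>e\<close>, and decrease to 0 in the band; so \<open>f\<close> is small on
  one of them.\<close>

lemma uo_Cauchy_dominated:
  assumes x: "\<And>n. x n \<in> ideal_of e" and cauchy: "uo_Cauchy x" and \<epsilon>: "0 < \<epsilon>"
  obtains N v where "v \<in> ideal_of e" "f v \<le> \<epsilon>"
    "\<And>n m. N \<le> n \<Longrightarrow> N \<le> m \<Longrightarrow> inf \<bar>x n - x m\<bar> e \<le> v"
proof -
  let ?z = "\<lambda>(n, m). x n - x m"
  have "order_converges_in UNIV UNIV le2 (\<lambda>i :: nat \<times> nat. inf \<bar>?z i - 0\<bar> e) 0"
    using cauchy e_nonneg unfolding uo_Cauchy_def uo_converges_def by blast
  then obtain K :: "'a set" and leK a where dec: "decreases_to_0_in UNIV K leK a"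
    and dom: "\<And>k. k \<in> K \<Longrightarrow> \<exists>i0. \<forall>i. le2 i0 i \<longrightarrow> \<bar>inf \<bar>?z i - 0\<bar> e - 0\<bar> \<le> a k"
    unfolding order_converges_in_def by fastforce
  have a0: "0 \<le> a k" if "k \<in> K" for k using dec that unfolding decreases_to_0_in_def by blast
  have dir: "directed_index K leK" using dec unfolding decreases_to_0_in_def by blast
  define b where "b k = inf (a k) e" for k
  have b0: "0 \<le> b k" if "k \<in> K" for k unfolding b_def using a0[OF that] e_nonneg by simp
  have be: "b k \<le> e" for k unfolding b_def by simp
  have bV: "b k \<in> ideal_of e" if "k \<in> K" for k
  proof (rule ideal_of_solid[OF ideal_of_self[OF e_nonneg]])
    show "\<bar>b k\<bar> \<le> \<bar>e\<bar>" unfolding abs_of_nonneg[OF b0[OF that]] abs_of_nonneg[OF e_nonneg] by (rule be)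
  qed
  have b_mono: "b k \<le> b j" if "j \<in> K" "k \<in> K" "leK j k" for j k
    using dec that unfolding b_def decreases_to_0_in_def by (intro inf_mono) auto
  have decb: "decreases_to_0_in (principal_band e) K leK b"
    unfolding decreases_to_0_in_def
  proof (intro conjI ballI impI dir)
    fix l assume "\<forall>k\<in>K. l \<le> b k"
    then have "\<forall>k\<in>K. l \<le> a k" unfolding b_def by simp
    then show "l \<le> 0" using dec unfolding decreases_to_0_in_def by blast
  qed (use bV in_B b_mono b0 in blast)+
  have "order_converges_in (principal_band e) K leK b 0"
  proof (rule order_converges_inI[OF decb], intro ballI)
    fix k assume "k \<in> K"
    then show "\<exists>i0\<in>K. \<forall>i\<in>K. leK i0 i \<longrightarrow> \<bar>b i - 0\<bar> \<le> b k"
      using b_mono b0 by (intro bexI[of _ k]) (auto simp: abs_of_nonneg)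
  qed
  then have "\<exists>i0\<in>K. \<forall>i\<in>K. leK i0 i \<longrightarrow> \<bar>f (b i)\<bar> < \<epsilon>"
    using order_continuous_onD[OF f_oc dir _ _ \<epsilon>, of b] bV in_B by blast
  then obtain k where k: "k \<in> K" "\<bar>f (b k)\<bar> < \<epsilon>"
    using dir unfolding directed_index_def by (meson reflp_onD)
  obtain n0 m0 where nm: "\<And>n m. n0 \<le> n \<Longrightarrow> m0 \<le> m \<Longrightarrow> \<bar>inf \<bar>x n - x m\<bar> e\<bar> \<le> a k"
    using dom[OF k(1)] by fastforce
  have "inf \<bar>x n - x m\<bar> e \<le> b k" if "max n0 m0 \<le> n" "max n0 m0 \<le> m" for n m
    unfolding b_def using order_trans[OF abs_ge_self nm[of n m]] that by (intro le_infI) auto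
  then show ?thesis using that[OF bV[OF k(1)], of "max n0 m0"] k(2) by auto
qed

text \<open>Where \<open>h e \<xi> = 1\<close> and \<open>h v \<xi> < 1\<close>, the cap
  \<open>e\<close> is inactive and late values of \<open>x\<close> differ by at most
  \<open>h v \<xi>\<close>, so the usual Cesaro argument works; where
  \<open>1 \<le> h v \<xi>\<close>, the bound \<open>g \<xi> \<le> 1\<close> is enough. The
  expectation of \<open>h v\<close> is small.\<close>

lemma uo_Cauchy_cesaro_vanishing:
  assumes x: "\<And>n. x n \<in> ideal_of e" and cauchy: "uo_Cauchy x" and r: "strict_mono r"
  shows "vanishing (\<lambda>n m. h (x n - cesaro (x \<circ> r) m))"
  unfolding vanishing_def
proof (intro allI impI)
  fix \<epsilon> :: real assume "0 < \<epsilon>"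
  then have \<epsilon>: "0 < \<epsilon> / 2" by simp
  obtain N0 v where v: "v \<in> ideal_of e" "f v \<le> \<epsilon> / 2"
    and dom: "\<And>n m. N0 \<le> n \<Longrightarrow> N0 \<le> m \<Longrightarrow> inf \<bar>x n - x m\<bar> e \<le> v"
    by (rule uo_Cauchy_dominated[OF x cauchy \<epsilon>]) blast
  have xd: "x n - x m \<in> ideal_of e" for n m using x by (intro subspace_diff[OF V])
  have hdom: "min \<bar>h (x n) \<xi> - h (x m) \<xi>\<bar> (h e \<xi>) \<le> h v \<xi>" if "N0 \<le> n" "N0 \<le> m" for n m \<xi>
  proof -
    have "h (inf \<bar>x n - x m\<bar> e) \<xi> \<le> h v \<xi>"
      using dom[OF that] v xd by (intro h_mono inf_in_ideal abs_in_ideal_of ideal_of_self e_nonneg)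
    then show ?thesis
      using h_inf[OF abs_in_ideal_of[OF xd[of n m]] ideal_of_self[OF e_nonneg], of \<xi>] h_abs[OF xd] h_diff[OF x x]
      by simp
  qed
  \<comment> \<open>Bounds the first \<open>N0\<close> terms of the mean uniformly in
    \<open>n\<close>: the summand 1 pays for passing from \<open>x n\<close> to \<open>x N0\<close>
    where \<open>h v \<xi> < 1\<close>.\<close>
  define k where "k \<xi> = (\<Sum>j<N0. 1 + \<bar>h (x N0) \<xi> - h (x (r j)) \<xi>\<bar>)" for \<xi>
  have "bdd_fun k" unfolding k_def[abs_def] using h_bdd[OF x] by auto
  then obtain K where K: "0 \<le> K" "\<And>\<xi>. \<bar>k \<xi>\<bar> \<le> K" by (elim bdd_funE) blast
  obtain N1 :: nat where N1: "2 * K * mass / \<epsilon> \<le> real N1" using real_arch_simple by blast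
  define N where "N = max N0 N1"
  show "\<exists>N. \<forall>M g. bdd_fun g \<and> (\<forall>\<xi>. g \<xi> \<le> 1 \<and>
      (\<exists>n\<in>{N..M}. \<exists>m\<in>{N..M}. g \<xi> \<le> \<bar>h (x n - cesaro (x \<circ> r) m) \<xi>\<bar>)) \<longrightarrow> E g \<le> \<epsilon>"
  proof (rule exI[of _ N], intro allI impI, elim conjE)
    fix M g assume g: "bdd_fun g" and gz: "\<forall>\<xi>. g \<xi> \<le> 1 \<and>
      (\<exists>n\<in>{N..M}. \<exists>m\<in>{N..M}. g \<xi> \<le> \<bar>h (x n - cesaro (x \<circ> r) m) \<xi>\<bar>)"
    have "g \<xi> \<le> K / real (Suc N) + h v \<xi>" for \<xi>
    proof -
      obtain n m where nm: "N \<le> n" "N \<le> m" "g \<xi> \<le> \<bar>h (x n - cesaro (x \<circ> r) m) \<xi>\<bar>"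
        using gz by fastforce
      have g1: "g \<xi> \<le> 1" using gz by blast
      have cV: "cesaro (x \<circ> r) m \<in> ideal_of e"
        using x by (intro cesaro_in_ideal) simp
      have K0: "0 \<le> K / real (Suc N)" using K by simp
      \<comment> \<open>Where \<open>h e \<xi>\<close> is not 1, every vector of the ideal is
        represented by 0, so \<open>g \<xi> \<le> 0\<close>.\<close>
      consider "h e \<xi> \<noteq> 1" | "h e \<xi> = 1" "1 \<le> h v \<xi>" | "h e \<xi> = 1" "h v \<xi> < 1" by linarith
      then show ?thesis
      proof cases
        case 1
        then have "h u \<xi> = 0" if "u \<in> ideal_of e" for u using h_unit[of \<xi>] that by auto
        then show ?thesis using nm(3) subspace_diff[OF V x cV] v(1) K0 by simp
      next
        case 2
        then show ?thesis using g1 K0 by linarith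
      next
        case 3
        have d: "\<bar>h (x i) \<xi> - h (x j) \<xi>\<bar> \<le> h v \<xi>" if "N0 \<le> i" "N0 \<le> j" for i j
          using hdom[OF that, of \<xi>] 3 by (simp add: min_def split: if_splits)
        have hv: "0 \<le> h v \<xi>" using d[of N0 N0] by simp
        have "h (x n - cesaro (x \<circ> r) m) \<xi> = h (x n) \<xi> - (\<Sum>j\<le>m. h (x (r j)) \<xi>) / real (Suc m)"
          unfolding h_diff[OF x cV] using x by (subst h_cesaro) simp_all
        also have "\<dots> = (\<Sum>j\<le>m. h (x n) \<xi> - h (x (r j)) \<xi>) / real (Suc m)"
          by (simp add: sum_subtractf diff_divide_distrib del: of_nat_Suc)
        finally have eq: "h (x n - cesaro (x \<circ> r) m) \<xi> = (\<Sum>j\<le>m. h (x n) \<xi> - h (x (r j)) \<xi>) / real (Suc m)" .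
        have "\<bar>\<Sum>j\<le>m. h (x n) \<xi> - h (x (r j)) \<xi>\<bar> \<le> (\<Sum>j\<le>m. \<bar>h (x n) \<xi> - h (x (r j)) \<xi>\<bar>)"
          by (rule sum_abs)
        also have "\<dots> = (\<Sum>j<N0. \<bar>h (x n) \<xi> - h (x (r j)) \<xi>\<bar>) + (\<Sum>j\<in>{N0..m}. \<bar>h (x n) \<xi> - h (x (r j)) \<xi>\<bar>)"
        proof -
          have "{..m} = {..<N0} \<union> {N0..m}" using nm(2) unfolding N_def by auto
          moreover have "{..<N0} \<inter> {N0..m} = {}" by auto
          ultimately show ?thesis by (simp add: sum.union_disjoint)
        qed
        also have "\<dots> \<le> k \<xi> + (\<Sum>j\<in>{N0..m}. h v \<xi>)"
          unfolding k_def
        proof (intro add_mono sum_mono)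
          fix j
          have "\<bar>h (x n) \<xi> - h (x N0) \<xi>\<bar> \<le> h v \<xi>" using nm(1) unfolding N_def by (intro d) auto
          then show "\<bar>h (x n) \<xi> - h (x (r j)) \<xi>\<bar> \<le> 1 + \<bar>h (x N0) \<xi> - h (x (r j)) \<xi>\<bar>" using 3 by linarith
        next
          fix j assume "j \<in> {N0..m}"
          then have "N0 \<le> r j" using seq_suble[OF r, of j] by simp
          then show "\<bar>h (x n) \<xi> - h (x (r j)) \<xi>\<bar> \<le> h v \<xi>" using nm(1) unfolding N_def by (intro d) auto
        qed
        also have "\<dots> \<le> K + real (Suc m) * h v \<xi>"
          using K(2)[of \<xi>] hv by (auto intro!: add_mono mult_right_mono)
        finally have "\<bar>h (x n - cesaro (x \<circ> r) m) \<xi>\<bar> \<le> (K + real (Suc m) * h v \<xi>) / real (Suc m)"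
          unfolding eq by (simp add: abs_divide divide_right_mono)
        also have "\<dots> = K / real (Suc m) + h v \<xi>" by (simp add: add_divide_distrib del: of_nat_Suc)
        also have "K / real (Suc m) \<le> K / real (Suc N)" using K nm(2) by (intro divide_left_mono) auto
        finally show ?thesis using nm(3) by linarith
      qed
    qed
    then have "E g \<le> E (\<lambda>\<xi>. K / real (Suc N) + h v \<xi>)" using g h_bdd[OF v(1)] by (intro E_mono) auto
    also have "\<dots> = K / real (Suc N) * mass + f v" using h_bdd[OF v(1)] E_h[OF v(1)] by simp
    also have "K / real (Suc N) * mass \<le> \<epsilon> / 2"
    proof -
      have "2 * K * mass / \<epsilon> \<le> real (Suc N)" using N1 unfolding N_def by simp
      then have "2 * K * mass \<le> real (Suc N) * \<epsilon>" using \<epsilon> by (simp add: pos_divide_le_eq)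
      then have "K * mass / real (Suc N) \<le> \<epsilon> / 2"
        by (subst pos_divide_le_eq) (simp_all add: algebra_simps)
      then show ?thesis by simp
    qed
    finally show "E g \<le> \<epsilon>" using v(2) by simp
  qed
qed

end

section \<open>Cesaro means and uo-completeness\<close>

text \<open>Sums of the two dominators, indexed by the product of their index sets, dominate the new
  sequence; their infimum is 0 because it can be taken in one variable after the other.\<close>

lemma uo_converges_transfer:
  fixes u v :: "nat \<Rightarrow> 'a::banach_lattice"
  assumes uv: "uo_converges UNIV le2 (\<lambda>(n, m). u n - v m) 0"
    and v: "uo_converges_seq v l"
  shows "uo_converges_seq u l"
  unfolding uo_converges_seq_def uo_converges_def
proof (intro allI impI)
  fix y :: 'a assume y: "0 \<le> y"
  let ?z = "\<lambda>(n, m). u n - v m"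
  have "order_converges_in UNIV UNIV le2 (\<lambda>i :: nat \<times> nat. inf \<bar>?z i - 0\<bar> y) 0"
    using uv y unfolding uo_converges_def by blast
  then obtain K :: "'a set" and leK a where a: "decreases_to_0_in UNIV K leK a"
    and doma: "\<And>k. k \<in> K \<Longrightarrow> \<exists>i0. \<forall>i. le2 i0 i \<longrightarrow> \<bar>inf \<bar>?z i - 0\<bar> y - 0\<bar> \<le> a k"
    unfolding order_converges_in_def by fastforce
  have "order_converges_in UNIV UNIV (\<le>) (\<lambda>i. inf \<bar>v i - l\<bar> y) 0"
    using v y unfolding uo_converges_seq_def uo_converges_def by blast
  then obtain J :: "'a set" and leJ b where b: "decreases_to_0_in UNIV J leJ b"
    and domb: "\<And>j. j \<in> J \<Longrightarrow> \<exists>i0. \<forall>i\<ge>i0. \<bar>inf \<bar>v i - l\<bar> y - 0\<bar> \<le> b j"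
    unfolding order_converges_in_def by fastforce
  define c where "c p = a (fst p) + b (snd p)" for p
  define leP where "leP p q \<longleftrightarrow> leK (fst p) (fst q) \<and> leJ (snd p) (snd q)" for p q
  have c: "decreases_to_0_in UNIV (K \<times> J) leP c"
    unfolding decreases_to_0_in_def
  proof (intro conjI ballI impI)
    have dK: "directed_index K leK" and dJ: "directed_index J leJ"
      using a b unfolding decreases_to_0_in_def by blast+
    show "directed_index (K \<times> J) leP"
      unfolding directed_index_def
    proof (intro conjI ballI)
      show "K \<times> J \<noteq> {}" using dK dJ unfolding directed_index_def by simp
      show "reflp_on (K \<times> J) leP"
        using dK dJ unfolding directed_index_def leP_def by (auto intro!: reflp_onI dest: reflp_onD)
      show "transp_on (K \<times> J) leP"
      proof (rule transp_onI)
        fix p q s assume "p \<in> K \<times> J" "q \<in> K \<times> J" "s \<in> K \<times> J" "leP p q" "leP q s"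
        moreover have "transp_on K leK" "transp_on J leJ" using dK dJ unfolding directed_index_def by blast+
        ultimately show "leP p s" unfolding leP_def
          using transp_onD[of K leK "fst p" "fst q" "fst s"] transp_onD[of J leJ "snd p" "snd q" "snd s"]
          by (auto simp: mem_Times_iff)
      qed
      fix p q assume pq: "p \<in> K \<times> J" "q \<in> K \<times> J"
      obtain k where "k \<in> K" "leK (fst p) k" "leK (fst q) k"
        using dK pq unfolding directed_index_def by (auto simp: mem_Times_iff)
      moreover obtain j where "j \<in> J" "leJ (snd p) j" "leJ (snd q) j"
        using dJ pq unfolding directed_index_def by (auto simp: mem_Times_iff)
      ultimately show "\<exists>s\<in>K \<times> J. leP p s \<and> leP q s"
        unfolding leP_def by (intro bexI[of _ "(k, j)"]) auto
    qed
    show "c p \<in> UNIV" for p by simp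
    fix p assume p: "p \<in> K \<times> J"
    show "0 \<le> c p"
      using a b p unfolding c_def decreases_to_0_in_def by (intro add_nonneg_nonneg) (auto simp: mem_Times_iff)
    fix q assume "q \<in> K \<times> J" "leP p q"
    then show "c q \<le> c p"
      using a b p unfolding c_def leP_def decreases_to_0_in_def by (intro add_mono) (auto simp: mem_Times_iff)
  next
    fix w assume w: "\<forall>p\<in>K \<times> J. w \<le> c p"
    have "w - a k \<le> 0" if "k \<in> K" for k
    proof -
      have "w - a k \<le> b j" if "j \<in> J" for j
        using w \<open>k \<in> K\<close> that unfolding c_def by (force simp: diff_le_eq add.commute)
      then show ?thesis using b unfolding decreases_to_0_in_def by blast
    qed
    then have "\<forall>k\<in>K. w \<le> a k" by simp
    then show "w \<le> 0" using a unfolding decreases_to_0_in_def by blast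
  qed
  show "order_converges_in UNIV UNIV (\<le>) (\<lambda>n. inf \<bar>u n - l\<bar> y) 0"
  proof (rule order_converges_inI[OF c], intro ballI)
    fix p assume p: "p \<in> K \<times> J"
    obtain n0 m0 where nm: "\<And>n m. n0 \<le> n \<Longrightarrow> m0 \<le> m \<Longrightarrow> \<bar>inf \<bar>u n - v m\<bar> y\<bar> \<le> a (fst p)"
      using doma[of "fst p"] p by (fastforce simp: mem_Times_iff)
    obtain m1 where m1: "\<And>m. m1 \<le> m \<Longrightarrow> \<bar>inf \<bar>v m - l\<bar> y\<bar> \<le> b (snd p)"
      using domb[of "snd p"] p by (fastforce simp: mem_Times_iff)
    have "\<bar>inf \<bar>u n - l\<bar> y - 0\<bar> \<le> c p" if n: "n0 \<le> n" for n
    proof -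
      \<comment> \<open>An auxiliary index beyond both thresholds; the resulting bound
        \<open>c p\<close> does not involve it.\<close>
      define m where "m = max m0 m1"
      have "\<bar>u n - l\<bar> \<le> \<bar>u n - v m\<bar> + \<bar>v m - l\<bar>"
        using abs_triangle_ineq[of "u n - v m" "v m - l"] by simp
      then have "inf \<bar>u n - l\<bar> y \<le> inf (\<bar>u n - v m\<bar> + \<bar>v m - l\<bar>) y" by (intro inf_mono order_refl)
      also have "\<dots> \<le> inf \<bar>u n - v m\<bar> y + inf \<bar>v m - l\<bar> y" using y by (intro inf_add_le abs_ge_zero)
      also have "\<dots> \<le> c p"
        unfolding c_def
        using order_trans[OF abs_ge_self nm[of n m]] order_trans[OF abs_ge_self m1[of m]] n
        by (intro add_mono) (auto simp: m_def)
      finally have "inf \<bar>u n - l\<bar> y \<le> c p" .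
      moreover have "0 \<le> inf \<bar>u n - l\<bar> y" using y by simp
      ultimately show ?thesis by (simp add: abs_of_nonneg)
    qed
    then show "\<exists>i0\<in>UNIV. \<forall>i\<in>UNIV. i0 \<le> i \<longrightarrow> \<bar>inf \<bar>u i - l\<bar> y - 0\<bar> \<le> c p" by blast
  qed
qed

lemma exists_represented_functional:
  fixes x :: "nat \<Rightarrow> 'a::banach_lattice"
  assumes H: "\<forall>x::'a. 0 \<le> x \<longrightarrow>
    (\<exists>f. linear_functional_on (principal_band x) f \<and>
         strictly_positive_on (principal_band x) f \<and>
         order_continuous_on (principal_band x) f)"
    and x: "bounded (range x)"
  obtains E e f h C where "represented_functional E e f h" "\<And>n. x n \<in> ideal_of e" "\<And>n. f \<bar>x n\<bar> \<le> C"
proof -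
  obtain D where D: "\<And>n. norm (x n) \<le> D" using x unfolding bounded_iff by blast
  define g where "g n = (1 / 2) ^ n *\<^sub>R \<bar>x n\<bar>" for n
  have g0: "0 \<le> g n" for n unfolding g_def by (intro scaleR_nonneg_nonneg) auto
  have "summable (\<lambda>n. norm (g n))"
  proof (rule summable_comparison_test')
    show "summable (\<lambda>n. (1 / 2) ^ n * D)" by (intro summable_mult2 summable_geometric) auto
    show "norm (norm (g n)) \<le> (1 / 2) ^ n * D" if "0 \<le> n" for n
      unfolding g_def using D by (simp add: mult_left_mono)
  qed
  then have "summable g" by (rule summable_norm_cancel)
  then have s: "g sums suminf g" by (rule summable_sums)
  define e where "e = suminf g"
  have e: "0 \<le> e" unfolding e_def using sums_ge_partial[OF s g0, of 0] by simp
  have xe: "x n \<in> ideal_of e" for n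
  proof (rule ideal_ofI)
    have "g n \<le> (\<Sum>i<Suc n. g i)" using g0 by (simp add: sum_nonneg add_increasing)
    also have "\<dots> \<le> e" unfolding e_def by (rule sums_ge_partial[OF s g0])
    finally have "2 ^ n *\<^sub>R g n \<le> 2 ^ n *\<^sub>R e" by (intro scaleR_left_mono) auto
    moreover have "2 ^ n *\<^sub>R g n = \<bar>x n\<bar>" unfolding g_def by (simp flip: power_mult_distrib)
    ultimately show "\<bar>x n\<bar> \<le> 2 ^ n *\<^sub>R e" by simp
  qed
  obtain f where f: "linear_functional_on (principal_band e) f" "strictly_positive_on (principal_band e) f"
    "order_continuous_on (principal_band e) f"
    using H e by blast
  interpret F: order_continuous_functional "principal_band e" f
    by unfold_locales (use f band_principal_band in auto)
  have sub: "v \<in> principal_band e" if "v \<in> ideal_of e" for v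
    using ideal_of_subset_principal_band[OF e] that by blast
  have "\<exists>E h. lattice_representation E e f h"
    by (rule exists_lattice_representation[OF e]) (use F.f_add F.f_scale F.f_nonneg sub in simp_all)
  then obtain E h where "lattice_representation E e f h" by blast
  then interpret R: lattice_representation E e f h .
  have "represented_functional E e f h" by unfold_locales
  moreover obtain C where "\<And>n. f \<bar>x n\<bar> \<le> C"
    using F.f_bounded[of x D] sub[OF xe] D by blast
  ultimately show ?thesis using that xe by blast
qed

lemma bounded_cesaro:
  fixes x :: "nat \<Rightarrow> 'a::real_normed_vector"
  assumes "bounded (range x)"
  shows "bounded (range (cesaro x))"
proof -
  obtain D where D: "\<And>n. norm (x n) \<le> D" using assms unfolding bounded_iff by blast
  have "norm (cesaro x n) \<le> D" for n
  proof -
    have "norm (\<Sum>k\<le>n. x k) \<le> (\<Sum>k\<le>n. D)" using D by (intro sum_norm_le)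
    then show ?thesis unfolding cesaro_def by (simp add: divide_simps mult.commute)
  qed
  then show ?thesis unfolding bounded_iff by blast
qed

theorem theorem5p9:
  assumes "\<forall>x::'a::banach_lattice. 0 \<le> x \<longrightarrow>
    (\<exists>f. linear_functional_on (principal_band x) f \<and>
         strictly_positive_on (principal_band x) f \<and>
         order_continuous_on (principal_band x) f)"
  shows "pre_komlos_property TYPE('a) \<and>
    (komlos_property TYPE('a) \<longleftrightarrow> seq_boundedly_uo_complete TYPE('a))"
proof -
  \<comment> \<open>\<open>s = s'\<close> gives the uo-Cauchy property, and \<open>s' = id\<close>
    ties all subsequences to one limit.\<close>
  have core: "\<exists>r :: nat \<Rightarrow> nat. strict_mono r \<and> (\<forall>s s'. strict_mono s \<longrightarrow> strict_mono s' \<longrightarrow>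
      uo_converges UNIV le2
        (\<lambda>(n, m). cesaro (x \<circ> r \<circ> s) n - cesaro (x \<circ> r \<circ> s') m) 0)"
    if x: "bounded (range x)" for x :: "nat \<Rightarrow> 'a"
  proof -
    obtain E e f h C where rep: "represented_functional E e f h"
      and xe: "\<And>n. x n \<in> ideal_of e" and C: "\<And>n. f \<bar>x n\<bar> \<le> C"
      by (rule exists_represented_functional[OF assms x]) blast
    interpret represented_functional E e f h by (rule rep)
    obtain r :: "nat \<Rightarrow> nat" where r: "strict_mono r \<and> (\<forall>s s'. strict_mono s \<longrightarrow> strict_mono s' \<longrightarrow>
        vanishing (\<lambda>n m. h (cesaro (x \<circ> r \<circ> s) n - cesaro (x \<circ> r \<circ> s') m)))"
      using exists_komlos_subsequence[OF xe C] ..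
    have "cesaro (x \<circ> r \<circ> s) n - cesaro (x \<circ> r \<circ> s') m \<in> ideal_of e" for s s' n m
      using xe by (intro subspace_diff[OF V] cesaro_in_ideal) simp_all
    then show ?thesis using r by (intro exI[of _ r] conjI allI impI vanishing_imp_uo_null) simp_all
  qed
  have "pre_komlos_property TYPE('a)"
    unfolding pre_komlos_property_def uo_Cauchy_def using core by blast
  moreover have "komlos_property TYPE('a)" if complete: "seq_boundedly_uo_complete TYPE('a)"
    unfolding komlos_property_def
  proof (intro allI impI)
    fix x :: "nat \<Rightarrow> 'a" assume x: "bounded (range x)"
    obtain r :: "nat \<Rightarrow> nat" where r: "strict_mono r"
      and uo: "\<And>s s'. strict_mono s \<Longrightarrow> strict_mono s' \<Longrightarrow>
        uo_converges UNIV le2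
          (\<lambda>(n, m). cesaro (x \<circ> r \<circ> s) n - cesaro (x \<circ> r \<circ> s') m) 0"
      using core[OF x] by blast
    have id: "strict_mono (id :: nat \<Rightarrow> nat)" by (simp add: strict_mono_def)
    have "bounded (range (x \<circ> r \<circ> id))" using x by (rule bounded_subset) auto
    then have "bounded (range (cesaro (x \<circ> r \<circ> id)))" by (rule bounded_cesaro)
    \<comment> \<open>Completeness is applied once, to the means of the extracted subsequence
      itself; all others inherit the limit \<open>y\<close>.\<close>
    then obtain y where "uo_converges_seq (cesaro (x \<circ> r \<circ> id)) y"
      using complete uo[OF id id] unfolding seq_boundedly_uo_complete_def uo_Cauchy_def by blast
    then have "uo_converges_seq (cesaro (x \<circ> r \<circ> s)) y" if "strict_mono s" for s
      using uo_converges_transfer[OF uo[OF that id]] by blast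
    then show "\<exists>(r::nat \<Rightarrow> nat) y. strict_mono r \<and>
        (\<forall>s::nat \<Rightarrow> nat. strict_mono s \<longrightarrow> uo_converges_seq (cesaro (x \<circ> r \<circ> s)) y)"
      using r by blast
  qed
  moreover have "seq_boundedly_uo_complete TYPE('a)" if komlos: "komlos_property TYPE('a)"
    unfolding seq_boundedly_uo_complete_def
  proof (intro allI impI, elim conjE)
    fix x :: "nat \<Rightarrow> 'a" assume x: "bounded (range x)" and cauchy: "uo_Cauchy x"
    obtain r :: "nat \<Rightarrow> nat" and y where r: "strict_mono r"
      and y: "\<And>s :: nat \<Rightarrow> nat. strict_mono s \<Longrightarrow> uo_converges_seq (cesaro (x \<circ> r \<circ> s)) y"
      using komlos x unfolding komlos_property_def by blast
    have lim: "uo_converges_seq (cesaro (x \<circ> r)) y"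
      using y[of id] by (simp add: strict_mono_def)
    obtain E e f h C where rep: "represented_functional E e f h"
      and xe: "\<And>n. x n \<in> ideal_of e" and C: "\<And>n. f \<bar>x n\<bar> \<le> C"
      by (rule exists_represented_functional[OF assms x]) blast
    interpret represented_functional E e f h by (rule rep)
    have "x n - cesaro (x \<circ> r) m \<in> ideal_of e" for n m
      using xe by (intro subspace_diff[OF V] cesaro_in_ideal) simp_all
    then have "uo_converges UNIV le2 (\<lambda>(n, m). x n - cesaro (x \<circ> r) m) 0"
      using uo_Cauchy_cesaro_vanishing[OF xe cauchy r] by (rule vanishing_imp_uo_null)
    then have "uo_converges_seq x y" using lim by (rule uo_converges_transfer)
    then show "\<exists>l. uo_converges_seq x l" by blast
  qed
  ultimately show ?thesis by blast
qed

end
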